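(* Let $R$ be a commutative ring, $\delta\in R$, and let $n,i\ge 0$ be integers with $n\ge 2i+1$. Then the map $$\iota_*\colon H_i(\mathfrak S_n;\mathbb{1})\longrightarrow \operatorname{Tor}_i^{\mathrm{Br}_n(R,\delta)}(\mathbb{1},\mathbb{1})$$ induced by the inclusion $\iota\colon R\mathfrak S_n\to\mathrm{Br}_n(R,\delta)$ is an isomorphism.
   Context: The Brauer algebra $\mathrm{Br}_n(R,\delta)$ is the $R$-algebra that is free as an $R$-module on the set of perfect matchings ("diagrams") of $\{-n,\dots,-1\}\cup\{1,\dots,n\}$, where the negative elements are drawn as nodes on the left, the positive ones as nodes on the right, and matched nodes are joined by an arc. The product $b_1b_2$ of two diagrams is obtained by placing $b_1$ to the left of $b_2$, identifying right node $i$ of $b_1$ with left node $-i$ of $b_2$ for each $i$, and concatenating arcs; each closed loop formed in the middle is removed and replaced by a factor $\delta$. $\iota\colon R\mathfrak S_n\to \mathrm{Br}_n(R,\delta)$ is the algebra map sending $g\in\mathfrak S_n$ to the permutation diagram joining $-g(i)$ to $i$ for all $i$. The trivial module $\mathbb{1}$ over $\mathrm{Br}_n(R,\delta)$ is $R$, with permutation diagrams acting (on the left and on the right) as the identity and all other diagrams acting as $0$; over a group ring, $\mathbb{1}$ is $R$ with trivial action. $H_*(\mathfrak S_n;\mathbb{1})=\operatorname{Tor}_*^{R\mathfrak S_n}(\mathbb{1},\mathbb{1})$. The map $\iota_*$ is the map on Tor induced by the ring map $\iota$ together with the identity on $\mathbb{1}$ in both variables. *)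

theory Defs
  imports "HOL-Algebra.Module" "HOL-Algebra.Sym_Groups" "HOL-Algebra.Free_Abelian_Groups" "HOL-Library.Disjoint_Sets"
begin

text \<open>The locale \<open>module\<close> of HOL-Algebra asks for a commutative ring of scalars. The record type
  is reused here; the fields \<open>mult\<close> and \<open>one\<close> of a module record are never looked at.\<close>

locale left_module = A?: ring A + M?: abelian_group M
  for A :: "('a, 'x) ring_scheme" (structure) and M :: "('a, 'm) module" (structure) +
  assumes smult_closed:
      "\<lbrakk>a \<in> carrier A; x \<in> carrier M\<rbrakk> \<Longrightarrow> a \<odot>\<^bsub>M\<^esub> x \<in> carrier M"
    and smult_l_distr:
      "\<lbrakk>a \<in> carrier A; b \<in> carrier A; x \<in> carrier M\<rbrakk>
        \<Longrightarrow> (a \<oplus>\<^bsub>A\<^esub> b) \<odot>\<^bsub>M\<^esub> x = a \<odot>\<^bsub>M\<^esub> x \<oplus>\<^bsub>M\<^esub> b \<odot>\<^bsub>M\<^esub> x"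
    and smult_r_distr:
      "\<lbrakk>a \<in> carrier A; x \<in> carrier M; y \<in> carrier M\<rbrakk>
        \<Longrightarrow> a \<odot>\<^bsub>M\<^esub> (x \<oplus>\<^bsub>M\<^esub> y) = a \<odot>\<^bsub>M\<^esub> x \<oplus>\<^bsub>M\<^esub> a \<odot>\<^bsub>M\<^esub> y"
    and smult_assoc1:
      "\<lbrakk>a \<in> carrier A; b \<in> carrier A; x \<in> carrier M\<rbrakk>
        \<Longrightarrow> (a \<otimes>\<^bsub>A\<^esub> b) \<odot>\<^bsub>M\<^esub> x = a \<odot>\<^bsub>M\<^esub> (b \<odot>\<^bsub>M\<^esub> x)"
    and smult_one:
      "x \<in> carrier M \<Longrightarrow> \<one>\<^bsub>A\<^esub> \<odot>\<^bsub>M\<^esub> x = x"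

text \<open>\<open>semilinear A \<phi> M N\<close>: the additive maps \<open>h\<close> from an \<open>A\<close>-module \<open>M\<close> to an \<open>A'\<close>-module \<open>N\<close>
  that satisfy \<open>h (a x) = \<phi>(a) h(x)\<close>, where \<open>\<phi>\<close> maps \<open>A\<close> to \<open>A'\<close>.\<close>

definition semilinear ::
  "('a, 'x) ring_scheme \<Rightarrow> ('a \<Rightarrow> 'b) \<Rightarrow> ('a, 'm) module \<Rightarrow> ('b, 'n) module \<Rightarrow> ('m \<Rightarrow> 'n) set" where
  "semilinear A \<phi> M N = {h \<in> carrier M \<rightarrow> carrier N.
     (\<forall>x\<in>carrier M. \<forall>y\<in>carrier M. h (x \<oplus>\<^bsub>M\<^esub> y) = h x \<oplus>\<^bsub>N\<^esub> h y) \<and>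
     (\<forall>a\<in>carrier A. \<forall>x\<in>carrier M. h (a \<odot>\<^bsub>M\<^esub> x) = \<phi> a \<odot>\<^bsub>N\<^esub> h x)}"

abbreviation linear_maps ::
  "('a, 'x) ring_scheme \<Rightarrow> ('a, 'm) module \<Rightarrow> ('a, 'n) module \<Rightarrow> ('m \<Rightarrow> 'n) set" where
  "linear_maps A M N \<equiv> semilinear A (\<lambda>a. a) M N"

definition free_module :: "('a, 'x) ring_scheme \<Rightarrow> 's set \<Rightarrow> ('a, 's \<Rightarrow> 'a) module" where
  "free_module A S =
    \<lparr>carrier = {c \<in> S \<rightarrow>\<^sub>E carrier A. finite {s \<in> S. c s \<noteq> \<zero>\<^bsub>A\<^esub>}},
     monoid.mult = undefined, one = undefined,
     ring.zero = (\<lambda>s\<in>S. \<zero>\<^bsub>A\<^esub>), ring.add = (\<lambda>c c'. \<lambda>s\<in>S. c s \<oplus>\<^bsub>A\<^esub> c' s),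
     smult = (\<lambda>a c. \<lambda>s\<in>S. a \<otimes>\<^bsub>A\<^esub> c s)\<rparr>"

text \<open>A module is projective if it is a direct summand of a free module. Basis sets inside the type
  of the module itself are enough: if \<open>P\<close> is projective, then the canonical surjection
  onto \<open>P\<close> from the free module on the set \<open>carrier P\<close> splits.\<close>

definition projective :: "('a, 'x) ring_scheme \<Rightarrow> ('a, 'm) module \<Rightarrow> bool" where
  "projective A P \<longleftrightarrow> left_module A P \<and>
    (\<exists>(S :: 'm set) j r. j \<in> linear_maps A P (free_module A S) \<and>
       r \<in> linear_maps A (free_module A S) P \<and> (\<forall>x\<in>carrier P. r (j x) = x))"

text \<open>The map \<open>d k\<close> goes from \<open>P (k + 1)\<close> to \<open>P k\<close>, and \<open>e\<close> is the augmentation onto \<open>N\<close>.\<close>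

definition projective_resolution ::
  "('a, 'x) ring_scheme \<Rightarrow> ('a, 'n) module \<Rightarrow>
   (nat \<Rightarrow> ('a, 'p) module) \<Rightarrow> (nat \<Rightarrow> 'p \<Rightarrow> 'p) \<Rightarrow> ('p \<Rightarrow> 'n) \<Rightarrow> bool" where
  "projective_resolution A N P d e \<longleftrightarrow>
     left_module A N \<and> (\<forall>k. projective A (P k)) \<and>
     (\<forall>k. d k \<in> linear_maps A (P (Suc k)) (P k)) \<and> e \<in> linear_maps A (P 0) N \<and>
     e ` carrier (P 0) = carrier N \<and>
     {x \<in> carrier (P 0). e x = \<zero>\<^bsub>N\<^esub>} = d 0 ` carrier (P (Suc 0)) \<and>
     (\<forall>k. {x \<in> carrier (P (Suc k)). d k x = \<zero>\<^bsub>P k\<^esub>} = d (Suc k) ` carrier (P (Suc (Suc k))))"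

definition chain_lift ::
  "('a, 'x) ring_scheme \<Rightarrow> ('a \<Rightarrow> 'b) \<Rightarrow> ('n \<Rightarrow> 'n') \<Rightarrow>
   (nat \<Rightarrow> ('a, 'p) module) \<Rightarrow> (nat \<Rightarrow> 'p \<Rightarrow> 'p) \<Rightarrow> ('p \<Rightarrow> 'n) \<Rightarrow>
   (nat \<Rightarrow> ('b, 'q) module) \<Rightarrow> (nat \<Rightarrow> 'q \<Rightarrow> 'q) \<Rightarrow> ('q \<Rightarrow> 'n') \<Rightarrow> (nat \<Rightarrow> 'p \<Rightarrow> 'q) \<Rightarrow> bool" where
  "chain_lift A \<phi> \<beta> P d e Q d' e' f \<longleftrightarrow>
     (\<forall>k. f k \<in> semilinear A \<phi> (P k) (Q k)) \<and>
     (\<forall>k. \<forall>x\<in>carrier (P (Suc k)). d' k (f (Suc k) x) = f k (d k x)) \<and>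
     (\<forall>x\<in>carrier (P 0). e' (f 0 x) = \<beta> (e x))"


text \<open>The map from \<open>G Mod H\<close> to \<open>G' Mod H'\<close> induced by a homomorphism \<open>f\<close> with \<open>f ` H \<subseteq> H'\<close>;
  all cosets in the union are then equal.\<close>

definition quotient_map ::
  "('b, 'x) monoid_scheme \<Rightarrow> 'b set \<Rightarrow> ('a \<Rightarrow> 'b) \<Rightarrow> 'a set \<Rightarrow> 'b set" where
  "quotient_map G' H' f C = (\<Union>x\<in>C. H' #>\<^bsub>G'\<^esub> f x)"

text \<open>The tensor product over \<open>A\<close> of a right module \<open>M\<close> and a left module \<open>P\<close>. For the right module
  \<open>M\<close>, the field \<open>smult\<close> of the record contains the right action, that is, \<open>a \<odot>\<^bsub>M\<^esub> m\<close> stands for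
  \<open>m \<cdot> a\<close>.\<close>

definition tensor_relations ::
  "('a, 'x) ring_scheme \<Rightarrow> ('a, 'm) module \<Rightarrow> ('a, 'p) module \<Rightarrow> (('m \<times> 'p) \<Rightarrow>\<^sub>0 int) set" where
  "tensor_relations A M P = generate (free_Abelian_group (carrier M \<times> carrier P))
    ({frag_of (m \<oplus>\<^bsub>M\<^esub> m', p) - frag_of (m, p) - frag_of (m', p) | m m' p.
        m \<in> carrier M \<and> m' \<in> carrier M \<and> p \<in> carrier P} \<union>
     {frag_of (m, p \<oplus>\<^bsub>P\<^esub> p') - frag_of (m, p) - frag_of (m, p') | m p p'.
        m \<in> carrier M \<and> p \<in> carrier P \<and> p' \<in> carrier P} \<union>
     {frag_of (a \<odot>\<^bsub>M\<^esub> m, p) - frag_of (m, a \<odot>\<^bsub>P\<^esub> p) | a m p.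
        a \<in> carrier A \<and> m \<in> carrier M \<and> p \<in> carrier P})"

definition tensor ::
  "('a, 'x) ring_scheme \<Rightarrow> ('a, 'm) module \<Rightarrow> ('a, 'p) module \<Rightarrow> (('m \<times> 'p) \<Rightarrow>\<^sub>0 int) set monoid" where
  "tensor A M P = free_Abelian_group (carrier M \<times> carrier P) Mod tensor_relations A M P"

text \<open>\<open>tensor_map A' M' P' \<alpha> h\<close> is the map \<open>m \<otimes> p \<mapsto> \<alpha>(m) \<otimes> h(p)\<close> with values
  in \<open>tensor A' M' P'\<close>.\<close>

definition tensor_map ::
  "('b, 'x) ring_scheme \<Rightarrow> ('b, 'm') module \<Rightarrow> ('b, 'q) module \<Rightarrow> ('m \<Rightarrow> 'm') \<Rightarrow> ('p \<Rightarrow> 'q) \<Rightarrow>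
   (('m \<times> 'p) \<Rightarrow>\<^sub>0 int) set \<Rightarrow> (('m' \<times> 'q) \<Rightarrow>\<^sub>0 int) set" where
  "tensor_map A' M' P' \<alpha> h =
     quotient_map (free_Abelian_group (carrier M' \<times> carrier P')) (tensor_relations A' M' P')
       (frag_extend (\<lambda>(m, p). frag_of (\<alpha> m, h p)))"

primrec tensor_cycles ::
  "('a, 'x) ring_scheme \<Rightarrow> ('a, 'm) module \<Rightarrow> (nat \<Rightarrow> ('a, 'p) module) \<Rightarrow> (nat \<Rightarrow> 'p \<Rightarrow> 'p) \<Rightarrow> nat \<Rightarrow>
   (('m \<times> 'p) \<Rightarrow>\<^sub>0 int) set set" where
  "tensor_cycles A M P d 0 = carrier (tensor A M (P 0))"
| "tensor_cycles A M P d (Suc k) =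
     kernel (tensor A M (P (Suc k))) (tensor A M (P k)) (tensor_map A M (P k) (\<lambda>m. m) (d k))"

definition tensor_boundaries ::
  "('a, 'x) ring_scheme \<Rightarrow> ('a, 'm) module \<Rightarrow> (nat \<Rightarrow> ('a, 'p) module) \<Rightarrow> (nat \<Rightarrow> 'p \<Rightarrow> 'p) \<Rightarrow> nat \<Rightarrow>
   (('m \<times> 'p) \<Rightarrow>\<^sub>0 int) set set" where
  "tensor_boundaries A M P d i =
     tensor_map A M (P i) (\<lambda>m. m) (d i) ` carrier (tensor A M (P (Suc i)))"

text \<open>The group \<open>Tor\<^sub>i\<^sup>A(M, N)\<close>, computed from a projective resolution \<open>(P, d)\<close> of the left module \<open>N\<close>,
  and the map on \<open>Tor\<^sub>i\<close> induced by \<open>\<alpha>\<close> on the right modules and by the chain map \<open>f\<close>. The arguments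
  of \<open>Tor_map\<close> before \<open>\<alpha>\<close> describe its target.\<close>

definition Tor ::
  "('a, 'x) ring_scheme \<Rightarrow> ('a, 'm) module \<Rightarrow> (nat \<Rightarrow> ('a, 'p) module) \<Rightarrow> (nat \<Rightarrow> 'p \<Rightarrow> 'p) \<Rightarrow> nat \<Rightarrow>
   (('m \<times> 'p) \<Rightarrow>\<^sub>0 int) set set monoid" where
  "Tor A M P d i =
     (tensor A M (P i))\<lparr>carrier := tensor_cycles A M P d i\<rparr> Mod tensor_boundaries A M P d i"

definition Tor_map ::
  "('b, 'x) ring_scheme \<Rightarrow> ('b, 'm') module \<Rightarrow> (nat \<Rightarrow> ('b, 'q) module) \<Rightarrow> (nat \<Rightarrow> 'q \<Rightarrow> 'q) \<Rightarrow> nat \<Rightarrow>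
   ('m \<Rightarrow> 'm') \<Rightarrow> (nat \<Rightarrow> 'p \<Rightarrow> 'q) \<Rightarrow>
   (('m \<times> 'p) \<Rightarrow>\<^sub>0 int) set set \<Rightarrow> (('m' \<times> 'q) \<Rightarrow>\<^sub>0 int) set set" where
  "Tor_map A' M' Q d' i \<alpha> f =
     quotient_map (tensor A' M' (Q i)) (tensor_boundaries A' M' Q d' i)
       (tensor_map A' M' (Q i) \<alpha> (f i))"

text \<open>If \<open>A\<close> is an algebra over a commutative ring \<open>R\<close> and \<open>M\<close> is \<open>R\<close> with some right \<open>A\<close>-action,
  then \<open>R\<close> acts on \<open>Tor\<^sub>i\<^sup>A(M, N)\<close> through multiplication on \<open>M\<close>.\<close>

definition Tor_scalar ::
  "('r, 'y) ring_scheme \<Rightarrow> ('a, 'x) ring_scheme \<Rightarrow> ('a, 'r) module \<Rightarrow>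
   (nat \<Rightarrow> ('a, 'p) module) \<Rightarrow> (nat \<Rightarrow> 'p \<Rightarrow> 'p) \<Rightarrow> nat \<Rightarrow>
   'r \<Rightarrow> (('r \<times> 'p) \<Rightarrow>\<^sub>0 int) set set \<Rightarrow> (('r \<times> 'p) \<Rightarrow>\<^sub>0 int) set set" where
  "Tor_scalar R A M P d i r = Tor_map A M P d i (\<lambda>m. r \<otimes>\<^bsub>R\<^esub> m) (\<lambda>k x. x)"


text \<open>The \<open>R\<close>-algebra that is free on the finite set \<open>B\<close>, in which the product of the basis elements
  \<open>x\<close> and \<open>y\<close> is \<open>c x y\<close> times the basis element \<open>m x y\<close>, and whose unit is the basis element
  \<open>u\<close>.\<close>

definition twisted_algebra ::
  "('r, 'x) ring_scheme \<Rightarrow> 'b set \<Rightarrow> ('b \<Rightarrow> 'b \<Rightarrow> 'b) \<Rightarrow> ('b \<Rightarrow> 'b \<Rightarrow> 'r) \<Rightarrow> 'b \<Rightarrow> ('b \<Rightarrow> 'r) ring" where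
  "twisted_algebra R B m c u =
    \<lparr>carrier = B \<rightarrow>\<^sub>E carrier R,
     monoid.mult = (\<lambda>v w. \<lambda>z\<in>B. finsum R (\<lambda>(x, y). c x y \<otimes>\<^bsub>R\<^esub> (v x \<otimes>\<^bsub>R\<^esub> w y))
                              {(x, y) \<in> B \<times> B. m x y = z}),
     one = (\<lambda>z\<in>B. if z = u then \<one>\<^bsub>R\<^esub> else \<zero>\<^bsub>R\<^esub>),
     ring.zero = (\<lambda>z\<in>B. \<zero>\<^bsub>R\<^esub>),
     ring.add = (\<lambda>v w. \<lambda>z\<in>B. v z \<oplus>\<^bsub>R\<^esub> w z)\<rparr>"

text \<open>This is the group ring only if \<open>G\<close> is finite: no finite support is imposed.\<close>

definition group_ring :: "('r, 'x) ring_scheme \<Rightarrow> ('g, 'y) monoid_scheme \<Rightarrow> ('g \<Rightarrow> 'r) ring" where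
  "group_ring R G = twisted_algebra R (carrier G) (monoid.mult G) (\<lambda>x y. \<one>\<^bsub>R\<^esub>) \<one>\<^bsub>G\<^esub>"

text \<open>The negative nodes are drawn on the left, the positive nodes on the right.\<close>

definition nodes :: "nat \<Rightarrow> int set" where
  "nodes n = {- int n..-1} \<union> {1..int n}"

definition diagrams :: "nat \<Rightarrow> int set set set" where
  "diagrams n = {b. partition_on (nodes n) b \<and> (\<forall>e\<in>b. card e = 2)}"

text \<open>To compose \<open>b1\<close> and \<open>b2\<close>, put \<open>b1\<close> to the left of \<open>b2\<close> in a picture with three columns of
  vertices: \<open>(0, j)\<close> is the left node \<open>-j\<close> of \<open>b1\<close>, \<open>(1, j)\<close> is both the right node \<open>j\<close> of \<open>b1\<close> and
  the left node \<open>-j\<close> of \<open>b2\<close>, and \<open>(2, j)\<close> is the right node \<open>j\<close> of \<open>b2\<close>.\<close>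

definition place1 :: "int \<Rightarrow> nat \<times> int" where
  "place1 v = (if v < 0 then (0, - v) else (1, v))"

definition place2 :: "int \<Rightarrow> nat \<times> int" where
  "place2 v = (if v < 0 then (1, - v) else (2, v))"

definition place_outer :: "int \<Rightarrow> nat \<times> int" where
  "place_outer v = (if v < 0 then (0, - v) else (2, v))"

definition glued :: "int set set \<Rightarrow> int set set \<Rightarrow> ((nat \<times> int) \<times> (nat \<times> int)) set" where
  "glued b1 b2 = {(place1 x, place1 y) | x y. {x, y} \<in> b1} \<union> {(place2 x, place2 y) | x y. {x, y} \<in> b2}"

definition diagram_comp :: "nat \<Rightarrow> int set set \<Rightarrow> int set set \<Rightarrow> int set set" where
  "diagram_comp n b1 b2 =
     {{x, y} | x y. x \<in> nodes n \<and> y \<in> nodes n \<and> x \<noteq> y \<and>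
        (place_outer x, place_outer y) \<in> (glued b1 b2)\<^sup>*}"

text \<open>The closed loops are the connected components consisting of middle vertices only.\<close>

definition loops :: "nat \<Rightarrow> int set set \<Rightarrow> int set set \<Rightarrow> nat" where
  "loops n b1 b2 =
     card {C. \<exists>j\<in>{1..int n}. C = (glued b1 b2)\<^sup>* `` {(1, j)} \<and> C \<subseteq> {1} \<times> {1..int n}}"

definition perm_diagram :: "nat \<Rightarrow> (nat \<Rightarrow> nat) \<Rightarrow> int set set" where
  "perm_diagram n g = (\<lambda>i. {- int (g i), int i}) ` {1..n}"

definition brauer_algebra :: "('r, 'x) ring_scheme \<Rightarrow> 'r \<Rightarrow> nat \<Rightarrow> (int set set \<Rightarrow> 'r) ring" where
  "brauer_algebra R \<delta> n =
     twisted_algebra R (diagrams n) (diagram_comp n) (\<lambda>b1 b2. \<delta> [^]\<^bsub>R\<^esub> loops n b1 b2)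
       (perm_diagram n id)"

definition brauer_incl :: "('r, 'x) ring_scheme \<Rightarrow> nat \<Rightarrow> ((nat \<Rightarrow> nat) \<Rightarrow> 'r) \<Rightarrow> int set set \<Rightarrow> 'r" where
  "brauer_incl R n v =
     (\<lambda>b\<in>diagrams n. finsum R v {g \<in> carrier (sym_group n). perm_diagram n g = b})"

text \<open>\<open>R\<close> as a module over an algebra with a given basis: the basis elements in \<open>T\<close> act as the
  identity and all others as zero. As \<open>R\<close> is commutative, the same record serves
  as the right module.\<close>

definition trivial_module :: "('r, 'x) ring_scheme \<Rightarrow> 'b set \<Rightarrow> ('b \<Rightarrow> 'r, 'r) module" where
  "trivial_module R T =
    \<lparr>carrier = carrier R, monoid.mult = monoid.mult R, one = \<one>\<^bsub>R\<^esub>, ring.zero = \<zero>\<^bsub>R\<^esub>, ring.add = ring.add R,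
     smult = (\<lambda>v r. finsum R v T \<otimes>\<^bsub>R\<^esub> r)\<rparr>"

definition sym_trivial :: "('r, 'x) ring_scheme \<Rightarrow> nat \<Rightarrow> ((nat \<Rightarrow> nat) \<Rightarrow> 'r, 'r) module" where
  "sym_trivial R n = trivial_module R (carrier (sym_group n))"

definition brauer_trivial :: "('r, 'x) ring_scheme \<Rightarrow> nat \<Rightarrow> (int set set \<Rightarrow> 'r, 'r) module" where
  "brauer_trivial R n = trivial_module R (perm_diagram n ` carrier (sym_group n))"

end

(* Let A be the Brauer algebra and I the ideal spanned by the diagrams that are not permutations, so
   that A / I is the group ring and the inclusion of the group ring splits the projection. Lifting the
   identity of the trivial module along the projection gives a left inverse of the map on Tor. It is
   also a right inverse in degree i as soon as a resolution Q over A remains exact modulo I in degrees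
   at most i, that is, as soon as I Q is exact in degrees less than i.

   The ideal I is the sum of the right ideals J_t of diagrams with a given left arc t. For a set S of
   left arcs, the intersection J_S of the J_t is generated by an idempotent if S leaves a left node
   free, and this idempotent kills the trivial module; hence J_S Q is exact. By Mayer-Vietoris, which is
   available because J Q and J' Q intersect in (J \<inter> J') Q for projective Q, the complex I Q is exact
   in degree k as long as no k + 1 arcs cover all left nodes. *)

theory Submission
  imports Defs
begin

section \<open>Modules and semilinear maps\<close>

text \<open>The delicate half is the right inverse. The composite Q -> P -> Q of the two lifts is
  semilinear only along \<open>\<iota>\<close> after \<open>\<pi>\<close>, so no A-linear homotopy
  can compare it with the identity. It becomes linear modulo I Q, because
  \<open>\<iota> (\<pi> a)\<close> and a differ by an element of I. Quotient modules are not formed: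
  linearity, exactness and homotopy are expressed as congruences modulo a submodule, and the zero
  submodule gives the ordinary notions used for P -> Q -> P. Nothing is lost on Tor, since I Q
  becomes zero after tensoring with the trivial module. That module is cyclic, so every tensor is
  pure and cycles and boundaries can be handled through elements of the resolutions. Exactness of Q
  modulo I in degree i needs I Q exact in degree i - 1, where intersections of at most i of the
  ideals J_t occur. Their arcs have at most 2 i endpoints, and 2 i < n leaves a left node free. The
  ring axioms of the Brauer algebra are supplied by the resolution Q, whose definition contains
  them.\<close>

lemma left_module_ring: "left_module A M \<Longrightarrow> ring A"
  by (simp add: left_module_def)

lemma left_module_group: "left_module A M \<Longrightarrow> abelian_group M"
  by (simp add: left_module_def)

context left_module
begin

lemma smult_r_null [simp]:
  assumes "a \<in> carrier A" shows "a \<odot>\<^bsub>M\<^esub> \<zero>\<^bsub>M\<^esub> = \<zero>\<^bsub>M\<^esub>"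
proof -
  have "a \<odot>\<^bsub>M\<^esub> \<zero>\<^bsub>M\<^esub> \<oplus>\<^bsub>M\<^esub> a \<odot>\<^bsub>M\<^esub> \<zero>\<^bsub>M\<^esub> = a \<odot>\<^bsub>M\<^esub> \<zero>\<^bsub>M\<^esub>"
    using assms smult_r_distr[of a "\<zero>\<^bsub>M\<^esub>" "\<zero>\<^bsub>M\<^esub>"] by simp
  then show ?thesis
    using assms smult_closed by simp
qed

lemma smult_l_null [simp]:
  assumes "x \<in> carrier M" shows "\<zero>\<^bsub>A\<^esub> \<odot>\<^bsub>M\<^esub> x = \<zero>\<^bsub>M\<^esub>"
proof -
  have "\<zero>\<^bsub>A\<^esub> \<odot>\<^bsub>M\<^esub> x \<oplus>\<^bsub>M\<^esub> \<zero>\<^bsub>A\<^esub> \<odot>\<^bsub>M\<^esub> x = \<zero>\<^bsub>A\<^esub> \<odot>\<^bsub>M\<^esub> x"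
    using assms smult_l_distr[of "\<zero>\<^bsub>A\<^esub>" "\<zero>\<^bsub>A\<^esub>" x] by simp
  then show ?thesis
    using assms smult_closed by simp
qed

lemma smult_r_minus:
  assumes "a \<in> carrier A" "x \<in> carrier M" shows "a \<odot>\<^bsub>M\<^esub> (\<ominus>\<^bsub>M\<^esub> x) = \<ominus>\<^bsub>M\<^esub> (a \<odot>\<^bsub>M\<^esub> x)"
proof -
  have "a \<odot>\<^bsub>M\<^esub> (\<ominus>\<^bsub>M\<^esub> x) \<oplus>\<^bsub>M\<^esub> a \<odot>\<^bsub>M\<^esub> x = \<zero>\<^bsub>M\<^esub>"
    using assms smult_r_distr[of a "\<ominus>\<^bsub>M\<^esub> x" x] by (simp add: M.l_neg)
  then show ?thesis
    using assms smult_closed M.minus_equality by simp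
qed

lemma smult_r_diff:
  "\<lbrakk>a \<in> carrier A; x \<in> carrier M; y \<in> carrier M\<rbrakk>
    \<Longrightarrow> a \<odot>\<^bsub>M\<^esub> (x \<ominus>\<^bsub>M\<^esub> y) = a \<odot>\<^bsub>M\<^esub> x \<ominus>\<^bsub>M\<^esub> a \<odot>\<^bsub>M\<^esub> y"
  by (simp add: M.minus_eq smult_r_distr smult_r_minus)

lemma smult_l_minus:
  assumes "a \<in> carrier A" "x \<in> carrier M" shows "(\<ominus>\<^bsub>A\<^esub> a) \<odot>\<^bsub>M\<^esub> x = \<ominus>\<^bsub>M\<^esub> (a \<odot>\<^bsub>M\<^esub> x)"
proof -
  have "(\<ominus>\<^bsub>A\<^esub> a) \<odot>\<^bsub>M\<^esub> x \<oplus>\<^bsub>M\<^esub> a \<odot>\<^bsub>M\<^esub> x = \<zero>\<^bsub>M\<^esub>"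
    using assms smult_l_distr[of "\<ominus>\<^bsub>A\<^esub> a" a x] by (simp add: A.l_neg)
  then show ?thesis
    using assms smult_closed M.minus_equality by simp
qed

lemma smult_l_diff:
  "\<lbrakk>a \<in> carrier A; b \<in> carrier A; x \<in> carrier M\<rbrakk>
    \<Longrightarrow> (a \<ominus>\<^bsub>A\<^esub> b) \<odot>\<^bsub>M\<^esub> x = a \<odot>\<^bsub>M\<^esub> x \<ominus>\<^bsub>M\<^esub> b \<odot>\<^bsub>M\<^esub> x"
  by (simp add: A.minus_eq M.minus_eq smult_l_distr smult_l_minus)

lemma smult_finsum:
  assumes "finite T" "a \<in> carrier A" "g \<in> T \<rightarrow> carrier M"
  shows "a \<odot>\<^bsub>M\<^esub> finsum M g T = finsum M (\<lambda>t. a \<odot>\<^bsub>M\<^esub> g t) T"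
  using assms(1,3)
proof (induction T)
  case empty
  then show ?case using assms(2) by simp
next
  case (insert t T)
  then have "finsum M g T \<in> carrier M" "g t \<in> carrier M" "(\<lambda>t. a \<odot>\<^bsub>M\<^esub> g t) \<in> T \<rightarrow> carrier M"
    using assms(2) by (auto simp: Pi_iff intro!: M.finsum_closed smult_closed)
  then show ?case
    using insert assms(2) by (simp add: smult_r_distr Pi_iff smult_closed)
qed

end

lemma semilinear_closed: "\<lbrakk>h \<in> semilinear A \<phi> M N; x \<in> carrier M\<rbrakk> \<Longrightarrow> h x \<in> carrier N"
  by (auto simp: semilinear_def)

lemma semilinear_add:
  "\<lbrakk>h \<in> semilinear A \<phi> M N; x \<in> carrier M; y \<in> carrier M\<rbrakk> \<Longrightarrow> h (x \<oplus>\<^bsub>M\<^esub> y) = h x \<oplus>\<^bsub>N\<^esub> h y"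
  by (auto simp: semilinear_def)

lemma semilinear_smult:
  "\<lbrakk>h \<in> semilinear A \<phi> M N; a \<in> carrier A; x \<in> carrier M\<rbrakk> \<Longrightarrow> h (a \<odot>\<^bsub>M\<^esub> x) = \<phi> a \<odot>\<^bsub>N\<^esub> h x"
  by (auto simp: semilinear_def)

lemma semilinearI:
  assumes "\<And>x. x \<in> carrier M \<Longrightarrow> h x \<in> carrier N"
    and "\<And>x y. \<lbrakk>x \<in> carrier M; y \<in> carrier M\<rbrakk> \<Longrightarrow> h (x \<oplus>\<^bsub>M\<^esub> y) = h x \<oplus>\<^bsub>N\<^esub> h y"
    and "\<And>a x. \<lbrakk>a \<in> carrier A; x \<in> carrier M\<rbrakk> \<Longrightarrow> h (a \<odot>\<^bsub>M\<^esub> x) = \<phi> a \<odot>\<^bsub>N\<^esub> h x"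
  shows "h \<in> semilinear A \<phi> M N"
  using assms by (auto simp: semilinear_def)

lemma semilinear_comp:
  assumes "h \<in> semilinear A \<phi> M N" "k \<in> semilinear B \<psi> N L" "\<And>a. a \<in> carrier A \<Longrightarrow> \<phi> a \<in> carrier B"
    and "\<And>a. a \<in> carrier A \<Longrightarrow> \<psi> (\<phi> a) = \<chi> a"
  shows "(\<lambda>x. k (h x)) \<in> semilinear A \<chi> M L"
  using assms by (auto simp: semilinear_def Pi_iff)

lemma semilinear_group_hom:
  assumes "abelian_group M" "abelian_group N" "h \<in> semilinear A \<phi> M N"
  shows "group_hom (add_monoid M) (add_monoid N) h"
  using assms
  by (intro group_hom.intro group_hom_axioms.intro abelian_group.a_group)
     (auto simp: hom_def semilinear_def)

lemma semilinear_zero: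
  "\<lbrakk>abelian_group M; abelian_group N; h \<in> semilinear A \<phi> M N\<rbrakk> \<Longrightarrow> h \<zero>\<^bsub>M\<^esub> = \<zero>\<^bsub>N\<^esub>"
  using group_hom.hom_one[OF semilinear_group_hom] by fastforce

lemma semilinear_a_inv:
  "\<lbrakk>abelian_group M; abelian_group N; h \<in> semilinear A \<phi> M N; x \<in> carrier M\<rbrakk>
    \<Longrightarrow> h (\<ominus>\<^bsub>M\<^esub> x) = \<ominus>\<^bsub>N\<^esub> h x"
  using group_hom.hom_inv[OF semilinear_group_hom] by (fastforce simp: a_inv_def)

lemma semilinear_diff:
  assumes "abelian_group M" "abelian_group N" "h \<in> semilinear A \<phi> M N" "x \<in> carrier M" "y \<in> carrier M"
  shows "h (x \<ominus>\<^bsub>M\<^esub> y) = h x \<ominus>\<^bsub>N\<^esub> h y"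
  using assms semilinear_add[OF assms(3,4)] semilinear_a_inv[OF assms(1-3,5)]
  by (simp add: abelian_group.minus_eq abelian_group.a_inv_closed)

subsection \<open>Free modules\<close>

abbreviation free_basis :: "('a, 'x) ring_scheme \<Rightarrow> 's set \<Rightarrow> 's \<Rightarrow> 's \<Rightarrow> 'a" where
  "free_basis A S s \<equiv> (\<lambda>t\<in>S. if t = s then \<one>\<^bsub>A\<^esub> else \<zero>\<^bsub>A\<^esub>)"

text \<open>The semilinear extension along \<open>\<phi>\<close> of values z prescribed on the
  basis. The sum runs over the support of c because S may be infinite and \<open>finsum\<close> is
  meaningful only over finite sets.\<close>

definition free_ext ::
  "('a, 'x) ring_scheme \<Rightarrow> ('a \<Rightarrow> 'b) \<Rightarrow> 's set \<Rightarrow> ('b, 'n) module \<Rightarrow> ('s \<Rightarrow> 'n) \<Rightarrow> ('s \<Rightarrow> 'a) \<Rightarrow> 'n" where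
  "free_ext A \<phi> S N z c = finsum N (\<lambda>s. \<phi> (c s) \<odot>\<^bsub>N\<^esub> z s) {s \<in> S. c s \<noteq> \<zero>\<^bsub>A\<^esub>}"

abbreviation supp :: "('a, 'x) ring_scheme \<Rightarrow> 's set \<Rightarrow> ('s \<Rightarrow> 'a) \<Rightarrow> 's set" where
  "supp A S c \<equiv> {s \<in> S. c s \<noteq> \<zero>\<^bsub>A\<^esub>}"

lemma free_module_carrier:
  "c \<in> carrier (free_module A S) \<longleftrightarrow> c \<in> S \<rightarrow>\<^sub>E carrier A \<and> finite (supp A S c)"
  by (simp add: free_module_def)

lemma free_module_coeff: "\<lbrakk>c \<in> carrier (free_module A S); s \<in> S\<rbrakk> \<Longrightarrow> c s \<in> carrier A"
  by (auto simp: free_module_def)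

lemma free_module_add: "s \<in> S \<Longrightarrow> (c \<oplus>\<^bsub>free_module A S\<^esub> c') s = c s \<oplus>\<^bsub>A\<^esub> c' s"
  by (simp add: free_module_def)

lemma free_module_smult: "s \<in> S \<Longrightarrow> (a \<odot>\<^bsub>free_module A S\<^esub> c) s = a \<otimes>\<^bsub>A\<^esub> c s"
  by (simp add: free_module_def)

lemma free_module_zero: "s \<in> S \<Longrightarrow> \<zero>\<^bsub>free_module A S\<^esub> s = \<zero>\<^bsub>A\<^esub>"
  by (simp add: free_module_def)

lemma free_basis_closed:
  assumes "ring A" "s \<in> S" shows "free_basis A S s \<in> carrier (free_module A S)"
proof -
  interpret ring A by fact
  have "{t \<in> S. free_basis A S s t \<noteq> \<zero>\<^bsub>A\<^esub>} \<subseteq> {s}" by auto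
  then show ?thesis
    using finite_subset by (auto simp: free_module_carrier)
qed

lemma free_module_smult_closed:
  assumes "ring A" "a \<in> carrier A" "c \<in> carrier (free_module A S)"
  shows "a \<odot>\<^bsub>free_module A S\<^esub> c \<in> carrier (free_module A S)"
proof -
  interpret ring A by fact
  have "supp A S (a \<odot>\<^bsub>free_module A S\<^esub> c) \<subseteq> supp A S c"
    using assms(2) by (auto simp: free_module_smult)
  from finite_subset[OF this] show ?thesis
    using assms(2,3) by (auto simp: free_module_carrier) (auto simp: free_module_def)
qed

lemma free_module_add_closed:
  assumes "ring A" "c \<in> carrier (free_module A S)" "c' \<in> carrier (free_module A S)"
  shows "c \<oplus>\<^bsub>free_module A S\<^esub> c' \<in> carrier (free_module A S)"
proof -
  interpret ring A by fact
  have "supp A S (c \<oplus>\<^bsub>free_module A S\<^esub> c')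
      \<subseteq> supp A S c \<union> supp A S c'"
    by (auto simp: free_module_add)
  from finite_subset[OF this] show ?thesis
    using assms(2,3) by (auto simp: free_module_carrier) (auto simp: free_module_def)
qed

text \<open>An element is assembled from its coordinates one at a time. The step reveals that the
  new coefficient is the one of c, so that a condition on the coefficients of c, such as membership
  in an ideal, stays usable in the induction.\<close>

lemma free_module_induct [consumes 2, case_names zero step]:
  assumes "ring A" "c \<in> carrier (free_module A S)"
    and zero: "W (\<zero>\<^bsub>free_module A S\<^esub>)"
    and step: "\<And>c' a s. \<lbrakk>c' \<in> carrier (free_module A S); a \<in> carrier A; s \<in> S;
        \<And>t. t \<in> S \<Longrightarrow> c' t = c t \<or> c' t = \<zero>\<^bsub>A\<^esub>; a = c s; W c'\<rbrakk>
      \<Longrightarrow> W (c' \<oplus>\<^bsub>free_module A S\<^esub> a \<odot>\<^bsub>free_module A S\<^esub> free_basis A S s)"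
  shows "W c"
proof -
  interpret ring A by fact
  have c: "c \<in> S \<rightarrow>\<^sub>E carrier A" "finite (supp A S c)"
    using assms(2) by (auto simp: free_module_carrier)
  define cut where "cut T = (\<lambda>s\<in>S. if s \<in> T then c s else \<zero>\<^bsub>A\<^esub>)" for T
  have cut: "cut T \<in> carrier (free_module A S)" for T
  proof -
    have "supp A S (cut T) \<subseteq> supp A S c" by (auto simp: cut_def)
    then show ?thesis
      using c finite_subset[OF _ c(2)] by (auto simp: free_module_carrier cut_def)
  qed
  have "W (cut T)" if "finite T" "T \<subseteq> S" for T
    using that
  proof (induction T)
    case empty
    have "cut {} = \<zero>\<^bsub>free_module A S\<^esub>" by (simp add: cut_def free_module_def)
    then show ?case using zero by simp
  next
    case (insert s T)
    have "cut (insert s T) = cut T \<oplus>\<^bsub>free_module A S\<^esub> c s \<odot>\<^bsub>free_module A S\<^esub> free_basis A S s"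
      unfolding cut_def free_module_def using c(1) insert.hyps insert.prems
      by (intro ext) (auto simp: PiE_iff)
    moreover have "W (cut T \<oplus>\<^bsub>free_module A S\<^esub> c s \<odot>\<^bsub>free_module A S\<^esub> free_basis A S s)"
      proof (rule step)
      show "W (cut T)" using insert by blast
    qed (use insert.prems c(1) cut in \<open>auto simp: cut_def PiE_iff\<close>)
    ultimately show ?case by metis
  qed
  moreover have "cut (supp A S c) = c"
    using c by (auto simp: cut_def fun_eq_iff PiE_iff extensional_def)
  ultimately show ?thesis
    using c(2) by (metis (no_types, lifting) mem_Collect_eq subsetI)
qed

text \<open>Additivity compares sums over different supports. Coordinates outside the support
  contribute zero because \<open>\<phi>\<close> preserves zero, so all the sums can be taken over
  one common finite set.\<close>

lemma free_ext_superset: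
  assumes "left_module B N" "ring A" "\<phi> \<in> ring_hom A B" "z \<in> S \<rightarrow> carrier N"
    and "c \<in> carrier (free_module A S)" "finite T" "supp A S c \<subseteq> T" "T \<subseteq> S"
  shows "free_ext A \<phi> S N z c = finsum N (\<lambda>s. \<phi> (c s) \<odot>\<^bsub>N\<^esub> z s) T"
proof -
  interpret left_module B N by fact
  have \<phi>: "\<phi> \<zero>\<^bsub>A\<^esub> = \<zero>\<^bsub>B\<^esub>" "\<And>a. a \<in> carrier A \<Longrightarrow> \<phi> a \<in> carrier B"
    using ring_hom_zero[OF assms(3,2) A.ring_axioms] ring_hom_closed[OF assms(3)] by auto
  have *: "\<And>s. s \<in> S \<Longrightarrow> \<phi> (c s) \<in> carrier B" "\<And>s. s \<in> S \<Longrightarrow> z s \<in> carrier N"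
    using \<phi> assms(4) free_module_coeff[OF assms(5)] by auto
  show ?thesis
    unfolding free_ext_def
    by (rule M.add.finprod_mono_neutral_cong_left)
       (use assms * \<phi> smult_closed in \<open>auto simp: Pi_iff subset_iff\<close>)
qed

lemma free_ext_semilinear:
  assumes "left_module B N" "ring A" and \<phi>: "\<phi> \<in> ring_hom A B" and z: "z \<in> S \<rightarrow> carrier N"
  shows "free_ext A \<phi> S N z \<in> semilinear A \<phi> (free_module A S) N"
proof (rule semilinearI)
  interpret left_module B N by fact
  interpret A: ring A by fact
  let ?F = "free_module A S"
  have zz: "\<And>s. s \<in> S \<Longrightarrow> z s \<in> carrier N" using z by auto
  have \<phi>c: "\<phi> (c s) \<in> carrier B" if "c \<in> carrier ?F" "s \<in> S" for c s
    using that \<phi> free_module_coeff ring_hom_closed by metis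
  note super = free_ext_superset[OF assms]
  have fin: "finite (supp A S c)" if "c \<in> carrier ?F" for c
    using that by (simp add: free_module_carrier)
  show "free_ext A \<phi> S N z c \<in> carrier N" if "c \<in> carrier ?F" for c
    unfolding free_ext_def using that zz \<phi>c by (auto intro!: M.finsum_closed smult_closed)
  show "free_ext A \<phi> S N z (c \<oplus>\<^bsub>?F\<^esub> c') = free_ext A \<phi> S N z c \<oplus>\<^bsub>N\<^esub> free_ext A \<phi> S N z c'"
    if c: "c \<in> carrier ?F" "c' \<in> carrier ?F" for c c'
  proof -
    define T where "T = supp A S c \<union> supp A S c'"
    have T: "finite T" "T \<subseteq> S" using c fin by (auto simp: T_def)
    have sub: "supp A S (c \<oplus>\<^bsub>?F\<^esub> c') \<subseteq> T"
      by (auto simp: T_def free_module_add)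
    have add: "c \<oplus>\<^bsub>?F\<^esub> c' \<in> carrier ?F"
      using free_module_add_closed[OF A.ring_axioms c] .
    have "free_ext A \<phi> S N z (c \<oplus>\<^bsub>?F\<^esub> c')
        = finsum N (\<lambda>s. \<phi> (c s) \<odot>\<^bsub>N\<^esub> z s \<oplus>\<^bsub>N\<^esub> \<phi> (c' s) \<odot>\<^bsub>N\<^esub> z s) T"
      unfolding super[OF add T(1) sub T(2)]
      using T c zz \<phi>c free_module_coeff[OF c(1)] free_module_coeff[OF c(2)]
      by (intro M.finsum_cong')
         (auto simp: free_module_add ring_hom_add[OF \<phi>] smult_l_distr subset_iff smult_closed Pi_iff)
    also have "\<dots> = finsum N (\<lambda>s. \<phi> (c s) \<odot>\<^bsub>N\<^esub> z s) T \<oplus>\<^bsub>N\<^esub> finsum N (\<lambda>s. \<phi> (c' s) \<odot>\<^bsub>N\<^esub> z s) T"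
      using T c zz \<phi>c by (intro M.finsum_addf) (auto intro!: smult_closed)
    finally show ?thesis
      using super[OF c(1) T(1) _ T(2)] super[OF c(2) T(1) _ T(2)] by (simp add: T_def)
  qed
  show "free_ext A \<phi> S N z (a \<odot>\<^bsub>?F\<^esub> c) = \<phi> a \<odot>\<^bsub>N\<^esub> free_ext A \<phi> S N z c"
    if c: "a \<in> carrier A" "c \<in> carrier ?F" for a c
  proof -
    define T where "T = supp A S c"
    have T: "finite T" "T \<subseteq> S" using c fin by (auto simp: T_def)
    have \<phi>a: "\<phi> a \<in> carrier B" using c \<phi> ring_hom_closed by metis
    have sub: "supp A S (a \<odot>\<^bsub>?F\<^esub> c) \<subseteq> T"
      using c by (auto simp: T_def free_module_smult)
    have cl: "a \<odot>\<^bsub>?F\<^esub> c \<in> carrier ?F"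
      using free_module_smult_closed[OF A.ring_axioms c] .
    have "free_ext A \<phi> S N z (a \<odot>\<^bsub>?F\<^esub> c) = finsum N (\<lambda>s. \<phi> a \<odot>\<^bsub>N\<^esub> (\<phi> (c s) \<odot>\<^bsub>N\<^esub> z s)) T"
      unfolding super[OF cl T(1) sub T(2)]
      using T c zz \<phi>c \<phi>a free_module_coeff[OF c(2)]
      by (intro M.finsum_cong')
         (auto simp: free_module_smult ring_hom_mult[OF \<phi>] smult_assoc1 subset_iff smult_closed Pi_iff)
    also have "\<dots> = \<phi> a \<odot>\<^bsub>N\<^esub> finsum N (\<lambda>s. \<phi> (c s) \<odot>\<^bsub>N\<^esub> z s) T"
      using T c zz \<phi>c \<phi>a by (intro smult_finsum[symmetric]) (auto intro!: smult_closed)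
    finally show ?thesis
      using super[OF c(2) T(1) _ T(2)] by (simp add: T_def)
  qed
qed

lemma free_ext_basis:
  assumes "left_module B N" "ring A" and \<phi>: "\<phi> \<in> ring_hom A B" and z: "z \<in> S \<rightarrow> carrier N" and "s \<in> S"
  shows "free_ext A \<phi> S N z (free_basis A S s) = z s"
proof -
  interpret left_module B N by fact
  have *: "\<phi> \<one>\<^bsub>A\<^esub> = \<one>\<^bsub>B\<^esub>" "z s \<in> carrier N" using assms ring_hom_one by (metis, auto)
  have "free_ext A \<phi> S N z (free_basis A S s)
      = finsum N (\<lambda>t. \<phi> (free_basis A S s t) \<odot>\<^bsub>N\<^esub> z t) {s}"
    by (rule free_ext_superset[OF assms(1-4)]) (use assms free_basis_closed in auto)
  also have "\<dots> = z s"
    using * assms(5) by (simp add: smult_one)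
  finally show ?thesis .
qed

subsection \<open>Lifting along maps from projective modules\<close>

definition submod :: "('a, 'x) ring_scheme \<Rightarrow> ('a, 'm) module \<Rightarrow> 'm set \<Rightarrow> bool" where
  "submod A M H \<longleftrightarrow> H \<subseteq> carrier M \<and> \<zero>\<^bsub>M\<^esub> \<in> H \<and> (\<forall>x\<in>H. \<forall>y\<in>H. x \<oplus>\<^bsub>M\<^esub> y \<in> H) \<and>
     (\<forall>a\<in>carrier A. \<forall>x\<in>H. a \<odot>\<^bsub>M\<^esub> x \<in> H)"

text \<open>Stands for equality in M / H. Working with representatives avoids cosets, and maps
  defined on M can be applied to both sides directly. Membership of both sides in the carrier is
  part of the relation.\<close>

definition mcong :: "('a, 'm) module \<Rightarrow> 'm set \<Rightarrow> 'm \<Rightarrow> 'm \<Rightarrow> bool" where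
  "mcong M H x y \<longleftrightarrow> x \<in> carrier M \<and> y \<in> carrier M \<and> x \<ominus>\<^bsub>M\<^esub> y \<in> H"

lemma (in abelian_group) minus_minus_telescope:
  assumes "x \<in> carrier G" "y \<in> carrier G" "z \<in> carrier G"
  shows "(x \<ominus> y) \<oplus> (y \<ominus> z) = x \<ominus> z"
  using assms r_neg2[of y "\<ominus> z"] by (simp add: minus_eq a_assoc r_neg1)

lemma (in abelian_group) add_minus_add:
  assumes "x \<in> carrier G" "y \<in> carrier G" "z \<in> carrier G" "w \<in> carrier G"
  shows "(x \<oplus> y) \<ominus> (z \<oplus> w) = (x \<ominus> z) \<oplus> (y \<ominus> w)"
  using assms by (simp add: minus_eq minus_add a_ac)

lemma (in abelian_group) minus_self: "x \<in> carrier G \<Longrightarrow> x \<ominus> x = \<zero>"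
  by (simp add: minus_eq r_neg)

lemma (in abelian_group) minus_zero_right: "x \<in> carrier G \<Longrightarrow> x \<ominus> \<zero> = x"
  using minus_equality[of \<zero> \<zero>] by (simp add: minus_eq)

lemma (in abelian_group) minus_eq_zeroD:
  assumes "x \<ominus> y = \<zero>" "x \<in> carrier G" "y \<in> carrier G" shows "x = y"
  using assms by (metis minus_eq minus_minus a_inv_closed minus_equality)

lemma (in abelian_group) minus_add_cancel:
  "\<lbrakk>x \<in> carrier G; y \<in> carrier G\<rbrakk> \<Longrightarrow> (x \<ominus> y) \<oplus> y = x"
  by (simp add: minus_eq a_assoc l_neg)

context left_module
begin

lemma submod_minus:
  assumes "submod A M H" "x \<in> H" shows "\<ominus>\<^bsub>M\<^esub> x \<in> H"
proof -
  have "(\<ominus>\<^bsub>A\<^esub> \<one>\<^bsub>A\<^esub>) \<odot>\<^bsub>M\<^esub> x = \<ominus>\<^bsub>M\<^esub> x"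
    using assms smult_l_minus[of "\<one>\<^bsub>A\<^esub>" x] smult_one by (auto simp: submod_def)
  then show ?thesis
    using assms by (metis A.a_inv_closed A.one_closed submod_def)
qed

lemma submod_diff: "\<lbrakk>submod A M H; x \<in> H; y \<in> H\<rbrakk> \<Longrightarrow> x \<ominus>\<^bsub>M\<^esub> y \<in> H"
  using submod_minus by (auto simp: M.minus_eq submod_def)

lemma mcong_refl: "\<lbrakk>submod A M H; x \<in> carrier M\<rbrakk> \<Longrightarrow> mcong M H x x"
  by (simp add: mcong_def M.minus_self submod_def)

lemma mcong_trans [trans]:
  assumes "submod A M H" "mcong M H x y" "mcong M H y z" shows "mcong M H x z"
proof -
  have "(x \<ominus>\<^bsub>M\<^esub> y) \<oplus>\<^bsub>M\<^esub> (y \<ominus>\<^bsub>M\<^esub> z) \<in> H"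
    using assms by (auto simp: mcong_def submod_def)
  then show ?thesis
    using assms M.minus_minus_telescope by (auto simp: mcong_def)
qed

lemma mcong_add:
  assumes "submod A M H" "mcong M H x y" "mcong M H z w"
  shows "mcong M H (x \<oplus>\<^bsub>M\<^esub> z) (y \<oplus>\<^bsub>M\<^esub> w)"
  using assms by (simp add: mcong_def M.add_minus_add submod_def)

lemma mcong_diff:
  assumes "submod A M H" "mcong M H x y" "mcong M H z w"
  shows "mcong M H (x \<ominus>\<^bsub>M\<^esub> z) (y \<ominus>\<^bsub>M\<^esub> w)"
proof -
  have "(x \<ominus>\<^bsub>M\<^esub> z) \<ominus>\<^bsub>M\<^esub> (y \<ominus>\<^bsub>M\<^esub> w) = (x \<ominus>\<^bsub>M\<^esub> y) \<ominus>\<^bsub>M\<^esub> (z \<ominus>\<^bsub>M\<^esub> w)"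
    using assms by (simp add: mcong_def M.minus_eq M.minus_add M.a_ac)
  then show ?thesis
    using assms submod_diff by (auto simp: mcong_def)
qed

lemma mcong_smult:
  assumes "submod A M H" "mcong M H x y" "a \<in> carrier A"
  shows "mcong M H (a \<odot>\<^bsub>M\<^esub> x) (a \<odot>\<^bsub>M\<^esub> y)"
proof -
  have "a \<odot>\<^bsub>M\<^esub> (x \<ominus>\<^bsub>M\<^esub> y) \<in> H" using assms by (auto simp: mcong_def submod_def)
  then show ?thesis
    using assms smult_r_diff[of a x y] smult_closed by (auto simp: mcong_def)
qed

lemma submod_zero: "submod A M {\<zero>\<^bsub>M\<^esub>}"
  by (simp add: submod_def)

lemma mcong_zero: "mcong M {\<zero>\<^bsub>M\<^esub>} x y \<longleftrightarrow> x \<in> carrier M \<and> x = y"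
  using M.minus_eq_zeroD M.minus_self by (auto simp: mcong_def)

end

text \<open>For a submodule H these are the semilinear maps from M to N / H, given by
  representatives in N. The case that matters later is an additive map that respects scalars only up
  to H.\<close>

definition semilinear_mod ::
  "('a, 'x) ring_scheme \<Rightarrow> ('a \<Rightarrow> 'b) \<Rightarrow> ('a, 'm) module \<Rightarrow> ('b, 'n) module \<Rightarrow> 'n set \<Rightarrow> ('m \<Rightarrow> 'n) set" where
  "semilinear_mod A \<phi> M N H = {h \<in> carrier M \<rightarrow> carrier N.
     (\<forall>x\<in>carrier M. \<forall>y\<in>carrier M. mcong N H (h (x \<oplus>\<^bsub>M\<^esub> y)) (h x \<oplus>\<^bsub>N\<^esub> h y)) \<and>
     (\<forall>a\<in>carrier A. \<forall>x\<in>carrier M. mcong N H (h (a \<odot>\<^bsub>M\<^esub> x)) (\<phi> a \<odot>\<^bsub>N\<^esub> h x))}"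

lemma semilinear_imp_mod:
  assumes M: "left_module A M" and N: "left_module B N" and H: "submod B N H" and h: "h \<in> semilinear A \<phi> M N"
  shows "h \<in> semilinear_mod A \<phi> M N H"
proof -
  interpret M: left_module A M by fact
  interpret N: left_module B N by fact
  have cl: "h x \<in> carrier N" if "x \<in> carrier M" for x
    using h that by (rule semilinear_closed)
  have refl: "mcong N H (h x) (h x)" if "x \<in> carrier M" for x
    using N.mcong_refl[OF H cl[OF that]] .
  have "mcong N H (h (x \<oplus>\<^bsub>M\<^esub> y)) (h x \<oplus>\<^bsub>N\<^esub> h y)" if "x \<in> carrier M" "y \<in> carrier M" for x y
    using refl[of "x \<oplus>\<^bsub>M\<^esub> y"] semilinear_add[OF h that] that by simp
  moreover have "mcong N H (h (a \<odot>\<^bsub>M\<^esub> x)) (\<phi> a \<odot>\<^bsub>N\<^esub> h x)" if "a \<in> carrier A" "x \<in> carrier M" for a x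
    using refl[of "a \<odot>\<^bsub>M\<^esub> x"] semilinear_smult[OF h that] M.smult_closed[OF that] by simp
  ultimately show ?thesis
    using cl by (simp add: semilinear_mod_def)
qed

lemma semilinear_mod_diff:
  assumes M: "left_module A M" and N: "left_module B N" and H: "submod B N H"
    and h: "h \<in> semilinear_mod A \<phi> M N H" and k: "k \<in> semilinear_mod A \<phi> M N H"
    and \<phi>: "\<And>a. a \<in> carrier A \<Longrightarrow> \<phi> a \<in> carrier B"
  shows "(\<lambda>x. h x \<ominus>\<^bsub>N\<^esub> k x) \<in> semilinear_mod A \<phi> M N H"
proof -
  interpret N: left_module B N by fact
  have cl: "h x \<in> carrier N" "k x \<in> carrier N" if "x \<in> carrier M" for x
    using h k that by (auto simp: semilinear_mod_def)
  have "mcong N H (h (x \<oplus>\<^bsub>M\<^esub> y) \<ominus>\<^bsub>N\<^esub> k (x \<oplus>\<^bsub>M\<^esub> y)) ((h x \<ominus>\<^bsub>N\<^esub> k x) \<oplus>\<^bsub>N\<^esub> (h y \<ominus>\<^bsub>N\<^esub> k y))"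
    if "x \<in> carrier M" "y \<in> carrier M" for x y
    unfolding N.M.add_minus_add[OF cl(1)[OF that(1)] cl(1)[OF that(2)] cl(2)[OF that(1)] cl(2)[OF that(2)], symmetric]
    using h k that by (intro N.mcong_diff[OF H]) (auto simp: semilinear_mod_def)
  moreover have "mcong N H (h (a \<odot>\<^bsub>M\<^esub> x) \<ominus>\<^bsub>N\<^esub> k (a \<odot>\<^bsub>M\<^esub> x)) (\<phi> a \<odot>\<^bsub>N\<^esub> (h x \<ominus>\<^bsub>N\<^esub> k x))"
    if "a \<in> carrier A" "x \<in> carrier M" for a x
    unfolding N.smult_r_diff[OF \<phi>[OF that(1)] cl(1)[OF that(2)] cl(2)[OF that(2)]]
    using h k that by (intro N.mcong_diff[OF H]) (auto simp: semilinear_mod_def)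
  ultimately show ?thesis
    using cl by (simp add: semilinear_mod_def)
qed

text \<open>The zero vector is its own multiple by the scalar zero, so the argument takes place in N
  and does not pass through the group axioms of the free module.\<close>

lemma semilinear_free_zero:
  assumes "ring A" "left_module B N" "\<phi> \<zero>\<^bsub>A\<^esub> = \<zero>\<^bsub>B\<^esub>" "h \<in> semilinear A \<phi> (free_module A S) N"
  shows "h \<zero>\<^bsub>free_module A S\<^esub> = \<zero>\<^bsub>N\<^esub>"
proof -
  interpret A: ring A by fact
  interpret N: left_module B N by fact
  let ?F = "free_module A S"
  have F0: "\<zero>\<^bsub>?F\<^esub> \<in> carrier ?F" by (simp add: free_module_def)
  have "\<zero>\<^bsub>A\<^esub> \<odot>\<^bsub>?F\<^esub> \<zero>\<^bsub>?F\<^esub> = \<zero>\<^bsub>?F\<^esub>" by (simp add: free_module_def fun_eq_iff)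
  then have "h \<zero>\<^bsub>?F\<^esub> = \<phi> \<zero>\<^bsub>A\<^esub> \<odot>\<^bsub>N\<^esub> h \<zero>\<^bsub>?F\<^esub>"
    using semilinear_smult[OF assms(4) A.zero_closed F0] by simp
  also have "\<dots> = \<zero>\<^bsub>N\<^esub>"
    using assms(3) semilinear_closed[OF assms(4) F0] by simp
  finally show ?thesis .
qed

text \<open>Lifts are chosen on the basis of a free module with retract P, extended semilinearly
  along \<open>\<phi>\<close>, and restricted to P by j. The lift is strictly semilinear although u
  is so only modulo H: the defect of u is absorbed by the congruence. Only the values of u have to
  be liftable, so d need not be surjective.\<close>

lemma projective_lift_mod:
  assumes P: "projective A P" and X: "left_module B X" and Y: "left_module B Y"
    and \<phi>: "\<phi> \<in> ring_hom A B" and d: "d \<in> linear_maps B X Y" and H: "submod B Y H"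
    and u: "u \<in> semilinear_mod A \<phi> P Y H"
    and ex: "\<And>x. x \<in> carrier P \<Longrightarrow> \<exists>z\<in>carrier X. mcong Y H (u x) (d z)"
  shows "\<exists>s\<in>semilinear A \<phi> P X. \<forall>x\<in>carrier P. mcong Y H (u x) (d (s x))"
proof -
  interpret P: left_module A P using P by (simp add: projective_def)
  interpret X: left_module B X by fact
  interpret Y: left_module B Y by fact
  obtain S :: "'c set" and j r where j: "j \<in> linear_maps A P (free_module A S)"
    and r: "r \<in> linear_maps A (free_module A S) P" and rj: "\<forall>x\<in>carrier P. r (j x) = x"
    using P by (auto simp: projective_def)
  let ?F = "free_module A S"
  note basis = free_basis_closed[OF P.A.ring_axioms]
  have "\<forall>s\<in>S. \<exists>z\<in>carrier X. mcong Y H (u (r (free_basis A S s))) (d z)"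
    using ex semilinear_closed[OF r basis] by blast
  then obtain z where z: "\<And>s. s \<in> S \<Longrightarrow> z s \<in> carrier X"
      "\<And>s. s \<in> S \<Longrightarrow> mcong Y H (u (r (free_basis A S s))) (d (z s))"
    by metis
  then have zX: "z \<in> S \<rightarrow> carrier X" by blast
  let ?E = "free_ext A \<phi> S X z"
  have E: "?E \<in> semilinear A \<phi> ?F X"
    by (rule free_ext_semilinear[OF X P.A.ring_axioms \<phi> zX])
  have E_basis: "?E (free_basis A S s) = z s" if "s \<in> S" for s
    by (rule free_ext_basis[OF X P.A.ring_axioms \<phi> zX that])
  have u_add: "mcong Y H (u (x \<oplus>\<^bsub>P\<^esub> y)) (u x \<oplus>\<^bsub>Y\<^esub> u y)" if "x \<in> carrier P" "y \<in> carrier P" for x y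
    using u that by (simp add: semilinear_mod_def)
  have u_smult: "mcong Y H (u (a \<odot>\<^bsub>P\<^esub> x)) (\<phi> a \<odot>\<^bsub>Y\<^esub> u x)" if "a \<in> carrier A" "x \<in> carrier P" for a x
    using u that by (simp add: semilinear_mod_def)
  have u_cl: "u x \<in> carrier Y" if "x \<in> carrier P" for x
    using u that by (auto simp: semilinear_mod_def)
  note \<phi>cl = ring_hom_closed[OF \<phi>]
  have \<phi>0: "\<phi> \<zero>\<^bsub>A\<^esub> = \<zero>\<^bsub>B\<^esub>"
    by (rule ring_hom_zero[OF \<phi> P.A.ring_axioms X.A.ring_axioms])
  have main: "c \<in> carrier ?F \<and> mcong Y H (u (r c)) (d (?E c))" if "c \<in> carrier ?F" for c
    using P.A.ring_axioms that
  proof (induction rule: free_module_induct)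
    case zero
    have F0: "\<zero>\<^bsub>?F\<^esub> \<in> carrier ?F" by (simp add: free_module_def)
    have "r \<zero>\<^bsub>?F\<^esub> = \<zero>\<^bsub>P\<^esub>"
      by (rule semilinear_free_zero[OF P.A.ring_axioms P.left_module_axioms _ r]) simp
    moreover have "?E \<zero>\<^bsub>?F\<^esub> = \<zero>\<^bsub>X\<^esub>"
      by (rule semilinear_free_zero[OF P.A.ring_axioms X \<phi>0 E])
    moreover have "d \<zero>\<^bsub>X\<^esub> = \<zero>\<^bsub>Y\<^esub>"
      using d semilinear_zero X.M.abelian_group_axioms Y.M.abelian_group_axioms by blast
    moreover have "mcong Y H (u \<zero>\<^bsub>P\<^esub>) \<zero>\<^bsub>Y\<^esub>"
      using u_smult[of "\<zero>\<^bsub>A\<^esub>" "\<zero>\<^bsub>P\<^esub>"] u_cl[of "\<zero>\<^bsub>P\<^esub>"] \<phi>0 by simp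
    ultimately show ?case using F0 by simp
  next
    case (step c' a s)
    let ?\<delta> = "free_basis A S s"
    have c': "c' \<in> carrier ?F" "mcong Y H (u (r c')) (d (?E c'))" using step by auto
    have \<delta>: "?\<delta> \<in> carrier ?F" "mcong Y H (u (r ?\<delta>)) (d (?E ?\<delta>))"
      using basis[OF step(3)] z(2)[OF step(3)] E_basis[OF step(3)] by simp_all
    have a\<delta>: "a \<odot>\<^bsub>?F\<^esub> ?\<delta> \<in> carrier ?F"
      by (rule free_module_smult_closed[OF P.A.ring_axioms step(2) \<delta>(1)])
    have sum: "c' \<oplus>\<^bsub>?F\<^esub> a \<odot>\<^bsub>?F\<^esub> ?\<delta> \<in> carrier ?F"
      by (rule free_module_add_closed[OF P.A.ring_axioms c'(1) a\<delta>])
    have r': "r (c' \<oplus>\<^bsub>?F\<^esub> a \<odot>\<^bsub>?F\<^esub> ?\<delta>) = r c' \<oplus>\<^bsub>P\<^esub> a \<odot>\<^bsub>P\<^esub> r ?\<delta>"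
      using semilinear_add[OF r c'(1) a\<delta>] semilinear_smult[OF r step(2) \<delta>(1)] by simp
    have E': "?E (c' \<oplus>\<^bsub>?F\<^esub> a \<odot>\<^bsub>?F\<^esub> ?\<delta>) = ?E c' \<oplus>\<^bsub>X\<^esub> \<phi> a \<odot>\<^bsub>X\<^esub> ?E ?\<delta>"
      using semilinear_add[OF E c'(1) a\<delta>] semilinear_smult[OF E step(2) \<delta>(1)] by simp
    have cl: "?E c' \<in> carrier X" "?E ?\<delta> \<in> carrier X" "r c' \<in> carrier P" "r ?\<delta> \<in> carrier P" "\<phi> a \<in> carrier B"
      using semilinear_closed[OF E] semilinear_closed[OF r] c' \<delta> \<phi>cl step(2) by blast+
    have dE: "d (?E c' \<oplus>\<^bsub>X\<^esub> \<phi> a \<odot>\<^bsub>X\<^esub> ?E ?\<delta>) = d (?E c') \<oplus>\<^bsub>Y\<^esub> \<phi> a \<odot>\<^bsub>Y\<^esub> d (?E ?\<delta>)"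
      using cl semilinear_add[OF d] semilinear_smult[OF d] X.smult_closed by simp
    have "mcong Y H (u (r c' \<oplus>\<^bsub>P\<^esub> a \<odot>\<^bsub>P\<^esub> r ?\<delta>)) (u (r c') \<oplus>\<^bsub>Y\<^esub> u (a \<odot>\<^bsub>P\<^esub> r ?\<delta>))"
      using cl step(2) P.smult_closed by (intro u_add) auto
    moreover have "mcong Y H (u (r c') \<oplus>\<^bsub>Y\<^esub> u (a \<odot>\<^bsub>P\<^esub> r ?\<delta>)) (d (?E c') \<oplus>\<^bsub>Y\<^esub> \<phi> a \<odot>\<^bsub>Y\<^esub> d (?E ?\<delta>))"
      using c' \<delta> cl step(2) u_smult
      by (intro Y.mcong_add[OF H c'(2)] Y.mcong_trans[OF H u_smult Y.mcong_smult[OF H \<delta>(2)]]) auto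
    ultimately show ?case
      unfolding r' E' dE using sum Y.mcong_trans[OF H] by blast
  qed
  show ?thesis
  proof (intro bexI ballI)
    show "(\<lambda>x. ?E (j x)) \<in> semilinear A \<phi> P X"
      using j E by (rule semilinear_comp) auto
    show "mcong Y H (u x) (d (?E (j x)))" if "x \<in> carrier P" for x
      using main[OF semilinear_closed[OF j that]] rj that by simp
  qed
qed

lemma projective_lift:
  assumes M: "projective A M" and X: "left_module B X" and Y: "left_module B Y"
    and \<phi>: "\<phi> \<in> ring_hom A B" and g: "g \<in> linear_maps B X Y"
    and u: "u \<in> semilinear A \<phi> M Y" and ex: "\<And>x. x \<in> carrier M \<Longrightarrow> \<exists>z\<in>carrier X. g z = u x"
  shows "\<exists>f\<in>semilinear A \<phi> M X. \<forall>x\<in>carrier M. g (f x) = u x"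
proof -
  interpret Y: left_module B Y by fact
  have M': "left_module A M" using M by (simp add: projective_def)
  have "\<exists>s\<in>semilinear A \<phi> M X. \<forall>x\<in>carrier M. mcong Y {\<zero>\<^bsub>Y\<^esub>} (u x) (g (s x))"
  proof (rule projective_lift_mod[OF M X Y \<phi> g Y.submod_zero])
    show "u \<in> semilinear_mod A \<phi> M Y {\<zero>\<^bsub>Y\<^esub>}"
      by (rule semilinear_imp_mod[OF M' Y Y.submod_zero u])
    show "\<exists>z\<in>carrier X. mcong Y {\<zero>\<^bsub>Y\<^esub>} (u x) (g z)" if "x \<in> carrier M" for x
      using ex[OF that] semilinear_closed[OF u that] by (metis Y.mcong_zero)
  qed
  then show ?thesis by (auto simp: Y.mcong_zero)
qed

subsection \<open>Comparison of resolutions\<close>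

text \<open>The augmentation plays the role of the differential out of degree 0, so that exactness
  at \<open>P 0\<close> and in positive degrees becomes a single statement.\<close>

definition is_cycle ::
  "('a, 'n) module \<Rightarrow> (nat \<Rightarrow> ('a, 'p) module) \<Rightarrow> (nat \<Rightarrow> 'p \<Rightarrow> 'p) \<Rightarrow> ('p \<Rightarrow> 'n) \<Rightarrow> nat \<Rightarrow> 'p \<Rightarrow> bool" where
  "is_cycle N P d e k x \<longleftrightarrow> (case k of 0 \<Rightarrow> e x = \<zero>\<^bsub>N\<^esub> | Suc m \<Rightarrow> d m x = \<zero>\<^bsub>P m\<^esub>)"

lemma is_cycle_simps [simp]:
  "is_cycle N P d e 0 x \<longleftrightarrow> e x = \<zero>\<^bsub>N\<^esub>"
  "is_cycle N P d e (Suc m) x \<longleftrightarrow> d m x = \<zero>\<^bsub>P m\<^esub>"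
  by (simp_all add: is_cycle_def)

context
  fixes A N P d e
  assumes res: "projective_resolution A N P d e"
begin

lemma resolution_target: "left_module A N"
  and resolution_projective: "projective A (P k)"
  and resolution_d: "d k \<in> linear_maps A (P (Suc k)) (P k)"
  and resolution_e: "e \<in> linear_maps A (P 0) N"
  and resolution_surj: "e ` carrier (P 0) = carrier N"
  and exact_0: "{x \<in> carrier (P 0). e x = \<zero>\<^bsub>N\<^esub>} = d 0 ` carrier (P (Suc 0))"
  and exact_Suc: "{x \<in> carrier (P (Suc k)). d k x = \<zero>\<^bsub>P k\<^esub>} = d (Suc k) ` carrier (P (Suc (Suc k)))"
  using res by (auto simp only: projective_resolution_def)

lemma resolution_module: "left_module A (P k)"
  using resolution_projective by (simp add: projective_def)

lemma resolution_exact: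
  assumes "x \<in> carrier (P k)" "is_cycle N P d e k x"
  shows "\<exists>y\<in>carrier (P (Suc k)). d k y = x"
proof (cases k)
  case 0
  then have "x \<in> {x \<in> carrier (P 0). e x = \<zero>\<^bsub>N\<^esub>}" using assms by simp
  then have "x \<in> d 0 ` carrier (P (Suc 0))" using exact_0 exact_Suc by blast
  then show ?thesis using 0 by auto
next
  case (Suc m)
  then have "x \<in> {x \<in> carrier (P (Suc m)). d m x = \<zero>\<^bsub>P m\<^esub>}" using assms by simp
  then have "x \<in> d (Suc m) ` carrier (P (Suc (Suc m)))" using exact_0 exact_Suc by blast
  then show ?thesis using Suc by auto
qed

lemma resolution_boundary:
  assumes "y \<in> carrier (P (Suc k))" shows "is_cycle N P d e k (d k y)"
proof (cases k)
  case 0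
  have "d 0 y \<in> d 0 ` carrier (P (Suc 0))" using assms 0 by blast
  then have "d 0 y \<in> {x \<in> carrier (P 0). e x = \<zero>\<^bsub>N\<^esub>}" using exact_0 exact_Suc by blast
  then show ?thesis using 0 by simp
next
  case (Suc m)
  have "d (Suc m) y \<in> d (Suc m) ` carrier (P (Suc (Suc m)))" using assms Suc by blast
  then have "d (Suc m) y \<in> {x \<in> carrier (P (Suc m)). d m x = \<zero>\<^bsub>P m\<^esub>}"
    using exact_0 exact_Suc by blast
  then show ?thesis using Suc by simp
qed

end

text \<open>The comparison theorem for projective resolutions, along a change of rings: projectivity
  over A suffices because lifting works against maps of B-modules that are pulled back along
  \<open>\<phi>\<close>.\<close>

lemma chain_lift_exists:
  assumes P: "projective_resolution A N P d e" and Q: "projective_resolution B N' Q d' e'"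
    and \<phi>: "\<phi> \<in> ring_hom A B" and \<beta>: "\<beta> \<in> semilinear A \<phi> N N'"
  shows "\<exists>f. chain_lift A \<phi> \<beta> P d e Q d' e' f"
proof -
  note modP = resolution_module[OF P] note modQ = resolution_module[OF Q]
  \<comment> \<open>The invariant records that f sends boundaries to cycles; exactness of Q then
    provides the pointwise lifts needed in the next degree.\<close>
  define good where "good k f \<longleftrightarrow> f \<in> semilinear A \<phi> (P k) (Q k) \<and>
    (\<forall>x\<in>carrier (P (Suc k)). is_cycle N' Q d' e' k (f (d k x)))" for k f
  define next_ok where "next_ok k f g \<longleftrightarrow> (\<forall>x\<in>carrier (P (Suc k)). d' k (g x) = f (d k x))" for k f g
  have N: "left_module A N" "left_module B N'"
    using resolution_target[OF P] resolution_target[OF Q] .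
  have "\<exists>f\<in>semilinear A \<phi> (P 0) (Q 0). \<forall>x\<in>carrier (P 0). e' (f x) = \<beta> (e x)"
  proof (rule projective_lift[OF resolution_projective[OF P] modQ N(2) \<phi> resolution_e[OF Q]])
    show \<beta>e: "(\<lambda>x. \<beta> (e x)) \<in> semilinear A \<phi> (P 0) N'"
      using resolution_e[OF P] \<beta> by (rule semilinear_comp) auto
    show "\<exists>z\<in>carrier (Q 0). e' z = \<beta> (e x)" if "x \<in> carrier (P 0)" for x
      using resolution_surj[OF Q] semilinear_closed[OF \<beta>e that] by (metis imageE)
  qed
  then obtain f0 where f0: "f0 \<in> semilinear A \<phi> (P 0) (Q 0)" "\<forall>x\<in>carrier (P 0). e' (f0 x) = \<beta> (e x)"
    by blast
  have \<beta>0: "\<beta> \<zero>\<^bsub>N\<^esub> = \<zero>\<^bsub>N'\<^esub>"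
    by (rule semilinear_zero[OF left_module_group[OF N(1)] left_module_group[OF N(2)] \<beta>])
  \<comment> \<open>Dependent choice starts from an arbitrary admissible value. The clause for k = 0
    pins it to \<open>f0\<close>, the only map for which compatibility with the augmentations is
    known.\<close>
  have "\<exists>f. \<forall>k. (good k (f k) \<and> (k = 0 \<longrightarrow> f k = f0)) \<and> next_ok k (f k) (f (Suc k))"
  proof (rule dependent_nat_choice)
    have "e (d 0 x) = \<zero>\<^bsub>N\<^esub>" "d 0 x \<in> carrier (P 0)" if "x \<in> carrier (P (Suc 0))" for x
      using resolution_boundary[OF P that] semilinear_closed[OF resolution_d[OF P] that] by simp_all
    then have "good 0 f0" using f0 \<beta>0 by (simp add: good_def)
    then show "\<exists>f. good 0 f \<and> (0 = (0::nat) \<longrightarrow> f = f0)" by blast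
    fix f k
    assume "good k f \<and> (k = 0 \<longrightarrow> f = f0)"
    then have f: "f \<in> semilinear A \<phi> (P k) (Q k)"
        "\<And>x. x \<in> carrier (P (Suc k)) \<Longrightarrow> is_cycle N' Q d' e' k (f (d k x))"
      by (auto simp: good_def)
    have fd: "(\<lambda>x. f (d k x)) \<in> semilinear A \<phi> (P (Suc k)) (Q k)"
      using resolution_d[OF P] f(1) by (rule semilinear_comp) auto
    have "\<exists>g\<in>semilinear A \<phi> (P (Suc k)) (Q (Suc k)). \<forall>x\<in>carrier (P (Suc k)). d' k (g x) = f (d k x)"
      by (rule projective_lift[OF resolution_projective[OF P] modQ modQ \<phi> resolution_d[OF Q] fd])
         (use resolution_exact[OF Q semilinear_closed[OF fd]] f(2) in blast)
    then obtain g where g: "g \<in> semilinear A \<phi> (P (Suc k)) (Q (Suc k))" "next_ok k f g"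
      by (auto simp: next_ok_def)
    have "d' k (g (d (Suc k) x)) = \<zero>\<^bsub>Q k\<^esub>" if x: "x \<in> carrier (P (Suc (Suc k)))" for x
    proof -
      have "d' k (g (d (Suc k) x)) = f (d k (d (Suc k) x))"
        using g(2) semilinear_closed[OF resolution_d[OF P] x] by (simp add: next_ok_def)
      also have "\<dots> = f \<zero>\<^bsub>P k\<^esub>" using resolution_boundary[OF P x] by simp
      also have "\<dots> = \<zero>\<^bsub>Q k\<^esub>"
        by (rule semilinear_zero[OF left_module_group[OF modP] left_module_group[OF modQ] f(1)])
      finally show ?thesis .
    qed
    then show "\<exists>g. (good (Suc k) g \<and> (Suc k = 0 \<longrightarrow> g = f0)) \<and> next_ok k f g"
      using g by (auto simp: good_def)
  qed
  then show ?thesis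
    using f0 by (auto simp: chain_lift_def good_def next_ok_def)
qed

text \<open>The part \<open>s (d x)\<close> of a homotopy, which is zero in degree zero.\<close>

definition through_d ::
  "('a, 'x) ring_scheme \<Rightarrow> ('a \<Rightarrow> 'b) \<Rightarrow> (nat \<Rightarrow> ('a, 'p) module) \<Rightarrow> (nat \<Rightarrow> 'p \<Rightarrow> 'p) \<Rightarrow>
   (nat \<Rightarrow> ('b, 'q) module) \<Rightarrow> nat \<Rightarrow> ('p \<Rightarrow> 'q) \<Rightarrow> bool" where
  "through_d A \<phi> P d X k p \<longleftrightarrow> (case k of 0 \<Rightarrow> \<forall>x\<in>carrier (P 0). p x = \<zero>\<^bsub>X 0\<^esub>
     | Suc m \<Rightarrow> \<exists>s\<in>semilinear A \<phi> (P m) (X (Suc m)). \<forall>x\<in>carrier (P (Suc m)). p x = s (d m x))"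

text \<open>The usual construction of a null-homotopy, carried out modulo the subcomplex H.
  Subtracting the previous homotopy after d from u leaves elements whose boundary lies in H, and
  \<open>ex\<close>, which is exactness of X modulo H up to degree i, makes this remainder liftable.
  The maps s are strictly semilinear; this is what later lets the term through d be pushed to tensor
  products.\<close>

lemma homotopy_mod:
  assumes P: "projective_resolution A N P d e" and X: "projective_resolution B N' X d' e'"
    and \<phi>: "\<phi> \<in> ring_hom A B"
    and H: "\<And>k. submod B (X k) (H k)" and dH: "\<And>k x. x \<in> H (Suc k) \<Longrightarrow> d' k x \<in> H k"
    and u: "\<And>k. u k \<in> semilinear_mod A \<phi> (P k) (X k) (H k)"
    and du: "\<And>k x. x \<in> carrier (P (Suc k)) \<Longrightarrow> d' k (u (Suc k) x) = u k (d k x)"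
    and eu: "\<And>x. x \<in> carrier (P 0) \<Longrightarrow> e' (u 0 x) = \<zero>\<^bsub>N'\<^esub>"
    and ex: "\<And>k y. \<lbrakk>k \<le> i; y \<in> carrier (X k); case k of 0 \<Rightarrow> e' y = \<zero>\<^bsub>N'\<^esub> | Suc m \<Rightarrow> d' m y \<in> H m\<rbrakk>
      \<Longrightarrow> \<exists>z\<in>carrier (X (Suc k)). mcong (X k) (H k) y (d' k z)"
    and "k \<le> i"
  shows "\<exists>s p. s \<in> semilinear A \<phi> (P k) (X (Suc k)) \<and>
      (\<forall>x\<in>carrier (P k). mcong (X k) (H k) (u k x) (d' k (s x) \<oplus>\<^bsub>X k\<^esub> p x)) \<and>
      through_d A \<phi> P d X k p"
  using \<open>k \<le> i\<close>
proof (induction k)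
  note modP = resolution_module[OF P] note modX = resolution_module[OF X]
  note grpX = left_module_group[OF modX]
  have ucl: "u k x \<in> carrier (X k)" if "x \<in> carrier (P k)" for k x
    using u[of k] that by (auto simp: semilinear_mod_def)
  {
    case 0
    have "\<exists>s\<in>semilinear A \<phi> (P 0) (X (Suc 0)). \<forall>x\<in>carrier (P 0). mcong (X 0) (H 0) (u 0 x) (d' 0 (s x))"
      by (rule projective_lift_mod[OF resolution_projective[OF P] modX modX \<phi> resolution_d[OF X] H u])
         (use ex[of 0] ucl eu in auto)
    then obtain s where s: "s \<in> semilinear A \<phi> (P 0) (X (Suc 0))"
        "\<And>x. x \<in> carrier (P 0) \<Longrightarrow> mcong (X 0) (H 0) (u 0 x) (d' 0 (s x))"
      by blast
    interpret X0: left_module B "X 0" by (rule modX)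
    have "d' 0 (s x) \<oplus>\<^bsub>X 0\<^esub> \<zero>\<^bsub>X 0\<^esub> = d' 0 (s x)" if "x \<in> carrier (P 0)" for x
      using s(2)[OF that] by (simp add: mcong_def)
    then show ?case
      using s by (intro exI[of _ s] exI[of _ "\<lambda>x. \<zero>\<^bsub>X 0\<^esub>"]) (auto simp: through_d_def)
  next
    case (Suc k)
    then obtain s p where s: "s \<in> semilinear A \<phi> (P k) (X (Suc k))"
      and sp: "\<And>x. x \<in> carrier (P k) \<Longrightarrow> mcong (X k) (H k) (u k x) (d' k (s x) \<oplus>\<^bsub>X k\<^esub> p x)"
      and p: "through_d A \<phi> P d X k p"
      by auto
    interpret Xk: left_module B "X k" by (rule modX)
    interpret XS: left_module B "X (Suc k)" by (rule modX)
    have dcl: "d k x \<in> carrier (P k)" if "x \<in> carrier (P (Suc k))" for x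
      using semilinear_closed[OF resolution_d[OF P] that] .
    \<comment> \<open>The term p factors through d, and two consecutive differentials compose to
      zero; hence p does not disturb the boundary of the next remainder.\<close>
    have pd: "p (d k x) = \<zero>\<^bsub>X k\<^esub>" if x: "x \<in> carrier (P (Suc k))" for x
    proof (cases k)
      case 0
      then show ?thesis using p dcl[OF x] by (simp add: through_d_def)
    next
      case (Suc m)
      then obtain t where t: "t \<in> semilinear A \<phi> (P m) (X (Suc m))"
          "\<forall>x\<in>carrier (P (Suc m)). p x = t (d m x)"
        using p by (auto simp: through_d_def)
      have "d m (d k x) = \<zero>\<^bsub>P m\<^esub>" using resolution_boundary[OF P x] Suc by simp
      then show ?thesis
        using t dcl[OF x] Suc semilinear_zero[OF left_module_group[OF modP] grpX t(1)] by simp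
    qed
    define v where "v x = u (Suc k) x \<ominus>\<^bsub>X (Suc k)\<^esub> s (d k x)" for x
    have sd: "(\<lambda>x. s (d k x)) \<in> semilinear A \<phi> (P (Suc k)) (X (Suc k))"
      using resolution_d[OF P] s by (rule semilinear_comp) auto
    have v: "v \<in> semilinear_mod A \<phi> (P (Suc k)) (X (Suc k)) (H (Suc k))"
      unfolding v_def
      by (rule semilinear_mod_diff[OF modP modX H u semilinear_imp_mod[OF modP modX H sd] ring_hom_closed[OF \<phi>]])
    have vH: "d' k (v x) \<in> H k" if x: "x \<in> carrier (P (Suc k))" for x
    proof -
      have "d' k (v x) = u k (d k x) \<ominus>\<^bsub>X k\<^esub> d' k (s (d k x))"
        unfolding v_def using semilinear_diff[OF grpX grpX resolution_d[OF X] ucl[OF x] semilinear_closed[OF sd x]]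
        by (simp add: du[OF x])
      moreover have "d' k (s (d k x)) \<in> carrier (X k)"
        using semilinear_closed[OF resolution_d[OF X] semilinear_closed[OF sd x]] .
      ultimately show ?thesis
        using sp[OF dcl[OF x]] pd[OF x] by (simp add: mcong_def)
    qed
    have "\<exists>r\<in>semilinear A \<phi> (P (Suc k)) (X (Suc (Suc k))).
        \<forall>x\<in>carrier (P (Suc k)). mcong (X (Suc k)) (H (Suc k)) (v x) (d' (Suc k) (r x))"
      by (rule projective_lift_mod[OF resolution_projective[OF P] modX modX \<phi> resolution_d[OF X] H v])
         (use ex[OF Suc.prems] vH v in \<open>auto simp: semilinear_mod_def\<close>)
    then obtain r where r: "r \<in> semilinear A \<phi> (P (Suc k)) (X (Suc (Suc k)))"
        "\<And>x. x \<in> carrier (P (Suc k)) \<Longrightarrow> mcong (X (Suc k)) (H (Suc k)) (v x) (d' (Suc k) (r x))"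
      by blast
    have "mcong (X (Suc k)) (H (Suc k)) (u (Suc k) x) (d' (Suc k) (r x) \<oplus>\<^bsub>X (Suc k)\<^esub> s (d k x))"
      if x: "x \<in> carrier (P (Suc k))" for x
      using XS.mcong_add[OF H r(2)[OF x] XS.mcong_refl[OF H semilinear_closed[OF sd x]]]
        XS.M.minus_add_cancel[OF ucl[OF x] semilinear_closed[OF sd x]] by (simp add: v_def)
    then show ?case
      using r(1) s by (intro exI[of _ r] exI[of _ "\<lambda>x. s (d k x)"]) (auto simp: through_d_def)
  }
qed

section \<open>Maps of quotients\<close>

locale quotient_hom =
  G: comm_group G + G': comm_group G' for G (structure) and G' (structure) +
  fixes H H' f
  assumes H: "subgroup H G" and H': "subgroup H' G'" and f: "f \<in> hom G G'" and fH: "f ` H \<subseteq> H'"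
begin

lemma f_closed: "x \<in> carrier G \<Longrightarrow> f x \<in> carrier G'"
  using f by (auto simp: hom_def)

lemma f_mult: "\<lbrakk>x \<in> carrier G; y \<in> carrier G\<rbrakk> \<Longrightarrow> f (x \<otimes>\<^bsub>G\<^esub> y) = f x \<otimes>\<^bsub>G'\<^esub> f y"
  using f by (auto simp: hom_def)

lemma quotient_map_coset:
  assumes x: "x \<in> carrier G"
  shows "quotient_map G' H' f (H #>\<^bsub>G\<^esub> x) = H' #>\<^bsub>G'\<^esub> f x"
proof -
  have "H' #>\<^bsub>G'\<^esub> f y = H' #>\<^bsub>G'\<^esub> f x" if "y \<in> H #>\<^bsub>G\<^esub> x" for y
  proof -
    obtain h where h: "h \<in> H" "y = h \<otimes>\<^bsub>G\<^esub> x" using \<open>y \<in> _\<close> by (auto simp: r_coset_def)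
    have "h \<in> carrier G" "f h \<in> H'" using h(1) subgroup.mem_carrier[OF H] fH by blast+
    then have "f y \<in> H' #>\<^bsub>G'\<^esub> f x" using h x by (auto simp: r_coset_def f_mult)
    from G'.repr_independence[OF this f_closed[OF x] H'] show ?thesis by simp
  qed
  moreover have "x \<in> H #>\<^bsub>G\<^esub> x" using G.rcos_self[OF x H] .
  ultimately show ?thesis unfolding quotient_map_def by blast
qed

lemma quotient_map_hom: "quotient_map G' H' f \<in> hom (G Mod H) (G' Mod H')"
proof (rule homI)
  interpret N: normal H G using G.subgroup_imp_normal[OF H] .
  interpret N': normal H' G' using G'.subgroup_imp_normal[OF H'] .
  show "quotient_map G' H' f C \<in> carrier (G' Mod H')" if "C \<in> carrier (G Mod H)" for C
    using that f_closed by (auto simp: carrier_FactGroup quotient_map_coset)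
  show "quotient_map G' H' f (C \<otimes>\<^bsub>G Mod H\<^esub> D) = quotient_map G' H' f C \<otimes>\<^bsub>G' Mod H'\<^esub> quotient_map G' H' f D"
    if "C \<in> carrier (G Mod H)" "D \<in> carrier (G Mod H)" for C D
    using that by (auto simp: carrier_FactGroup quotient_map_coset N.rcos_sum N'.rcos_sum f_closed f_mult)
qed

lemma quotient_map_iso:
  assumes inj: "\<And>x. \<lbrakk>x \<in> carrier G; f x \<in> H'\<rbrakk> \<Longrightarrow> x \<in> H"
    and surj: "\<And>y. y \<in> carrier G' \<Longrightarrow> \<exists>x\<in>carrier G. H' #>\<^bsub>G'\<^esub> f x = H' #>\<^bsub>G'\<^esub> y"
  shows "quotient_map G' H' f \<in> iso (G Mod H) (G' Mod H')"
proof -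
  have "C = D" if CD: "C \<in> carrier (G Mod H)" "D \<in> carrier (G Mod H)"
    and eq: "quotient_map G' H' f C = quotient_map G' H' f D" for C D
  proof -
    obtain x y where x: "x \<in> carrier G" "C = H #>\<^bsub>G\<^esub> x" and y: "y \<in> carrier G" "D = H #>\<^bsub>G\<^esub> y"
      using CD by (auto simp: carrier_FactGroup)
    have "H' #>\<^bsub>G'\<^esub> f x = H' #>\<^bsub>G'\<^esub> f y" using eq x y by (simp add: quotient_map_coset)
    then have "f x \<in> H' #>\<^bsub>G'\<^esub> f y" using G'.rcos_self[OF f_closed[OF x(1)] H'] by simp
    then obtain h where h: "h \<in> H'" "f x = h \<otimes>\<^bsub>G'\<^esub> f y" by (auto simp: r_coset_def)
    have "f (x \<otimes>\<^bsub>G\<^esub> inv\<^bsub>G\<^esub> y) = f x \<otimes>\<^bsub>G'\<^esub> inv\<^bsub>G'\<^esub> f y"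
      using x y f group_hom.hom_inv[of G G' f y]
      by (simp add: f_mult group_hom_def group_hom_axioms_def G.is_group G'.is_group)
    also have "\<dots> = h"
      using h(2) f_closed[OF y(1)] subgroup.mem_carrier[OF H' h(1)] by (simp add: G'.m_assoc)
    finally have "x \<otimes>\<^bsub>G\<^esub> inv\<^bsub>G\<^esub> y \<in> H" using inj x y h(1) by simp
    then have "x \<in> H #>\<^bsub>G\<^esub> y"
      using x y by (auto simp: r_coset_def G.m_assoc intro!: bexI[of _ "x \<otimes>\<^bsub>G\<^esub> inv\<^bsub>G\<^esub> y"])
    from G.repr_independence[OF this y(1) H] show ?thesis using x y by simp
  qed
  moreover have "quotient_map G' H' f ` carrier (G Mod H) = carrier (G' Mod H')"
  proof
    show "quotient_map G' H' f ` carrier (G Mod H) \<subseteq> carrier (G' Mod H')"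
      using quotient_map_hom by (auto simp: hom_def)
    show "carrier (G' Mod H') \<subseteq> quotient_map G' H' f ` carrier (G Mod H)"
    proof
      fix C assume "C \<in> carrier (G' Mod H')"
      then obtain y where "y \<in> carrier G'" "C = H' #>\<^bsub>G'\<^esub> y" by (auto simp: carrier_FactGroup)
      then obtain x where "x \<in> carrier G" "C = quotient_map G' H' f (H #>\<^bsub>G\<^esub> x)"
        using surj quotient_map_coset by metis
      then show "C \<in> quotient_map G' H' f ` carrier (G Mod H)" by (auto simp: carrier_FactGroup)
    qed
  qed
  ultimately show ?thesis
    using quotient_map_hom by (auto simp: iso_def bij_betw_def inj_on_def)
qed

end

section \<open>Tensor products and Tor\<close>

lemma frag_extend_hom:
  assumes "\<And>s. s \<in> S \<Longrightarrow> f s \<in> T"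
  shows "frag_extend (\<lambda>s. frag_of (f s)) \<in> hom (free_Abelian_group S) (free_Abelian_group T)"
  using keys_frag_extend[of "\<lambda>s. frag_of (f s)"] assms
  by (intro homI) (fastforce simp: frag_extend_add)+

text \<open>As in the definition of \<open>tensor_relations\<close>, the scalar multiplication of \<open>M\<close> is a right action.\<close>

locale tensor_pair =
  fixes A :: "('a, 'x) ring_scheme" and M :: "('a, 'm) module" and P :: "('a, 'p) module"
  assumes left_P: "left_module A P" and group_M: "abelian_group M"
    and action_closed: "\<lbrakk>a \<in> carrier A; m \<in> carrier M\<rbrakk> \<Longrightarrow> a \<odot>\<^bsub>M\<^esub> m \<in> carrier M"
begin

sublocale P: left_module A P by (rule left_P)
sublocale M: abelian_group M by (rule group_M)

abbreviation FM where "FM \<equiv> free_Abelian_group (carrier M \<times> carrier P)"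

definition gens where "gens =
    {frag_of (m \<oplus>\<^bsub>M\<^esub> m', p) - frag_of (m, p) - frag_of (m', p) | m m' p.
        m \<in> carrier M \<and> m' \<in> carrier M \<and> p \<in> carrier P} \<union>
     {frag_of (m, p \<oplus>\<^bsub>P\<^esub> p') - frag_of (m, p) - frag_of (m, p') | m p p'.
        m \<in> carrier M \<and> p \<in> carrier P \<and> p' \<in> carrier P} \<union>
     {frag_of (a \<odot>\<^bsub>M\<^esub> m, p) - frag_of (m, a \<odot>\<^bsub>P\<^esub> p) | a m p.
        a \<in> carrier A \<and> m \<in> carrier M \<and> p \<in> carrier P}"

lemma relations_eq: "tensor_relations A M P = generate FM gens"
  by (simp add: tensor_relations_def gens_def)

lemma diff_in_FM: "\<lbrakk>x \<in> carrier FM; y \<in> carrier FM\<rbrakk> \<Longrightarrow> x - y \<in> carrier FM"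
  using keys_diff[of x y] by auto

lemma gens_closed: "gens \<subseteq> carrier FM"
  unfolding gens_def
  by (intro Un_least subsetI; clarify; intro diff_in_FM)
     (auto simp: action_closed P.smult_closed)

lemma relations_subgroup: "subgroup (tensor_relations A M P) FM"
  unfolding relations_eq by (rule group.generate_is_subgroup[OF group_free_Abelian_group gens_closed])

lemma gens_relations: "gens \<subseteq> tensor_relations A M P"
  unfolding relations_eq by (auto intro: generate.incl)

sublocale FM: comm_group FM by (rule abelian_free_Abelian_group)

lemma tensor_comm_group: "comm_group (tensor A M P)"
  unfolding tensor_def by (rule FM.abelian_FactGroup[OF relations_subgroup])

sublocale T: comm_group "tensor A M P" by (rule tensor_comm_group)

abbreviation cls where "cls u \<equiv> tensor_relations A M P #>\<^bsub>FM\<^esub> u"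

definition pure :: "'m \<Rightarrow> 'p \<Rightarrow> (('m \<times> 'p) \<Rightarrow>\<^sub>0 int) set" where
  "pure m p = cls (frag_of (m, p))"

lemma pure_closed: "\<lbrakk>m \<in> carrier M; p \<in> carrier P\<rbrakk> \<Longrightarrow> pure m p \<in> carrier (tensor A M P)"
  by (auto simp: tensor_def carrier_FactGroup pure_def)

lemma tensor_mult_cosets:
  assumes "u \<in> carrier FM" "v \<in> carrier FM"
  shows "(cls u) \<otimes>\<^bsub>tensor A M P\<^esub> (cls v)
    = cls (u + v)"
  using assms normal.rcos_sum[OF FM.subgroup_imp_normal[OF relations_subgroup], of u v]
  by (simp add: tensor_def)

lemma coset_eqI:
  assumes "u - v \<in> tensor_relations A M P" "v \<in> carrier FM"
  shows "cls u = cls v"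
proof -
  have "u \<in> cls v"
    using assms by (auto simp: r_coset_def intro!: bexI[of _ "u - v"])
  then show ?thesis
    using FM.repr_independence[OF _ assms(2) relations_subgroup] by simp
qed

lemma pure_add_right:
  assumes "m \<in> carrier M" "p \<in> carrier P" "p' \<in> carrier P"
  shows "pure m (p \<oplus>\<^bsub>P\<^esub> p') = pure m p \<otimes>\<^bsub>tensor A M P\<^esub> pure m p'"
proof -
  have "frag_of (m, p \<oplus>\<^bsub>P\<^esub> p') - (frag_of (m, p) + frag_of (m, p')) \<in> gens"
    using assms unfolding gens_def by (simp add: diff_diff_add[symmetric]) blast
  moreover have "frag_of (m, p) + frag_of (m, p') \<in> carrier FM"
    using assms by (auto simp: FM.m_closed[of "frag_of (m, p)" "frag_of (m, p')", simplified])
  ultimately show ?thesis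
    using assms tensor_mult_cosets[of "frag_of (m, p)" "frag_of (m, p')"]
      coset_eqI gens_relations by (auto simp: pure_def)
qed

lemma pure_add_left:
  assumes "m \<in> carrier M" "m' \<in> carrier M" "p \<in> carrier P"
  shows "pure (m \<oplus>\<^bsub>M\<^esub> m') p = pure m p \<otimes>\<^bsub>tensor A M P\<^esub> pure m' p"
proof -
  have "frag_of (m \<oplus>\<^bsub>M\<^esub> m', p) - (frag_of (m, p) + frag_of (m', p)) \<in> gens"
    using assms unfolding gens_def by (simp add: diff_diff_add[symmetric]) blast
  moreover have "frag_of (m, p) + frag_of (m', p) \<in> carrier FM"
    using assms by (auto simp: FM.m_closed[of "frag_of (m, p)" "frag_of (m', p)", simplified])
  ultimately show ?thesis
    using assms tensor_mult_cosets[of "frag_of (m, p)" "frag_of (m', p)"]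
      coset_eqI gens_relations by (auto simp: pure_def)
qed

lemma pure_balanced:
  assumes "a \<in> carrier A" "m \<in> carrier M" "p \<in> carrier P"
  shows "pure (a \<odot>\<^bsub>M\<^esub> m) p = pure m (a \<odot>\<^bsub>P\<^esub> p)"
proof -
  have "frag_of (a \<odot>\<^bsub>M\<^esub> m, p) - frag_of (m, a \<odot>\<^bsub>P\<^esub> p) \<in> gens"
    using assms unfolding gens_def by blast
  then show ?thesis
    using assms P.smult_closed coset_eqI gens_relations by (auto simp: pure_def)
qed

lemma pure_hom: "m \<in> carrier M \<Longrightarrow> pure m \<in> hom (add_monoid P) (tensor A M P)"
  by (intro homI) (auto simp: pure_closed pure_add_right)

lemma pure_zero_right: "m \<in> carrier M \<Longrightarrow> pure m \<zero>\<^bsub>P\<^esub> = \<one>\<^bsub>tensor A M P\<^esub>"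
  using hom_one[OF pure_hom] P.M.a_group T.is_group by fastforce

lemma pure_a_inv:
  "\<lbrakk>m \<in> carrier M; p \<in> carrier P\<rbrakk> \<Longrightarrow> pure m (\<ominus>\<^bsub>P\<^esub> p) = inv\<^bsub>tensor A M P\<^esub> pure m p"
  using group_hom.hom_inv[of "add_monoid P" "tensor A M P" "pure m" p]
  by (simp add: group_hom_def group_hom_axioms_def P.M.a_group T.is_group pure_hom a_inv_def)

lemma pure_zero_left: "p \<in> carrier P \<Longrightarrow> pure \<zero>\<^bsub>M\<^esub> p = \<one>\<^bsub>tensor A M P\<^esub>"
  using pure_add_left[of "\<zero>\<^bsub>M\<^esub>" "\<zero>\<^bsub>M\<^esub>" p] pure_closed[of "\<zero>\<^bsub>M\<^esub>" p] T.l_cancel_one by fastforce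

text \<open>Over a cyclic right module a scalar can always be moved across, (m0 a) \<otimes> p = m0
  \<otimes> a p, and tensors with the common left factor m0 add up to a pure tensor.\<close>

lemma tensor_cyclic:
  assumes m0: "m0 \<in> carrier M" and gen: "\<And>m. m \<in> carrier M \<Longrightarrow> \<exists>a\<in>carrier A. m = a \<odot>\<^bsub>M\<^esub> m0"
  shows "carrier (tensor A M P) = pure m0 ` carrier P"
proof
  show "pure m0 ` carrier P \<subseteq> carrier (tensor A M P)" using m0 pure_closed by blast
  have "cls u \<in> pure m0 ` carrier P" if "Poly_Mapping.keys u \<subseteq> carrier M \<times> carrier P" for u
    using that
  proof (induction rule: free_Abelian_group_induct[consumes 1, case_names 1 2 3])
    case 1
    have "cls 0 = \<one>\<^bsub>tensor A M P\<^esub>"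
      using FM.coset_mult_one[of "tensor_relations A M P"] subgroup.subset[OF relations_subgroup]
      by (simp add: tensor_def)
    also have "\<dots> = pure m0 \<zero>\<^bsub>P\<^esub>" using m0 by (simp add: pure_zero_right)
    finally show ?case by simp
  next
    case (2 u v)
    then obtain p q where pq: "p \<in> carrier P" "q \<in> carrier P"
      "cls u = pure m0 p" "cls v = pure m0 q"
      by blast
    \<comment> \<open>The induction rule works with differences, so the class of u - v is found by
      solving an equation for it.\<close>
    have "(cls (u - v)) \<otimes>\<^bsub>tensor A M P\<^esub> pure m0 q = pure m0 p"
      using 2 pq diff_in_FM[of u v] tensor_mult_cosets[of "u - v" v] by simp
    moreover have "cls (u - v) \<in> carrier (tensor A M P)"
      using 2 diff_in_FM[of u v] unfolding tensor_def carrier_FactGroup by (intro imageI) simp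
    ultimately have "cls (u - v) = pure m0 p \<otimes>\<^bsub>tensor A M P\<^esub> inv\<^bsub>tensor A M P\<^esub> pure m0 q"
      using pq m0 pure_closed T.inv_solve_right by metis
    also have "\<dots> = pure m0 (p \<oplus>\<^bsub>P\<^esub> \<ominus>\<^bsub>P\<^esub> q)"
      using pq m0 by (simp add: pure_add_right pure_a_inv)
    finally show ?case using pq by simp
  next
    case (3 mp)
    then obtain m p a where "mp = (m, p)" "p \<in> carrier P" "a \<in> carrier A" "m = a \<odot>\<^bsub>M\<^esub> m0"
      using gen by blast
    then have "cls (frag_of mp) = pure m0 (a \<odot>\<^bsub>P\<^esub> p)"
      using m0 pure_balanced pure_def by metis
    then show ?case using \<open>a \<in> _\<close> \<open>p \<in> _\<close> P.smult_closed by blast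
  qed
  then show "carrier (tensor A M P) \<subseteq> pure m0 ` carrier P"
    by (auto simp: tensor_def carrier_FactGroup)
qed

end

locale tensor_morphism =
  S: tensor_pair A M P + S': tensor_pair B M' P' for A M P B M' P' +
  fixes \<phi> \<alpha> h
  assumes \<phi>: "\<And>a. a \<in> carrier A \<Longrightarrow> \<phi> a \<in> carrier B"
    and \<alpha>: "\<alpha> \<in> semilinear A \<phi> M M'" and h: "h \<in> semilinear A \<phi> P P'"
begin

abbreviation F where "F \<equiv> frag_extend (\<lambda>(m, p). frag_of (\<alpha> m, h p))"

lemma \<alpha>_closed: "m \<in> carrier M \<Longrightarrow> \<alpha> m \<in> carrier M'" and h_closed: "p \<in> carrier P \<Longrightarrow> h p \<in> carrier P'"
  using \<alpha> h by (auto simp: semilinear_def)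

lemma F_hom: "F \<in> hom S.FM S'.FM"
  using frag_extend_hom[of "carrier M \<times> carrier P" "\<lambda>(m, p). (\<alpha> m, h p)" "carrier M' \<times> carrier P'"]
  by (auto simp: \<alpha>_closed h_closed case_prod_unfold)

lemma F_gens: "F ` S.gens \<subseteq> S'.gens"
proof (intro subsetI, elim imageE)
  fix v u assume v: "v = F u" and "u \<in> S.gens"
  then consider (1) m m' p where "u = frag_of (m \<oplus>\<^bsub>M\<^esub> m', p) - frag_of (m, p) - frag_of (m', p)"
        "m \<in> carrier M" "m' \<in> carrier M" "p \<in> carrier P"
    | (2) m p p' where "u = frag_of (m, p \<oplus>\<^bsub>P\<^esub> p') - frag_of (m, p) - frag_of (m, p')"
        "m \<in> carrier M" "p \<in> carrier P" "p' \<in> carrier P"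
    | (3) a m p where "u = frag_of (a \<odot>\<^bsub>M\<^esub> m, p) - frag_of (m, a \<odot>\<^bsub>P\<^esub> p)"
        "a \<in> carrier A" "m \<in> carrier M" "p \<in> carrier P"
    unfolding S.gens_def by blast
  then show "v \<in> S'.gens"
  proof cases
    case 1
    have "v = frag_of (\<alpha> m \<oplus>\<^bsub>M'\<^esub> \<alpha> m', h p) - frag_of (\<alpha> m, h p) - frag_of (\<alpha> m', h p)"
      using 1 v by (simp add: frag_extend_diff semilinear_add[OF \<alpha>])
    then show ?thesis unfolding S'.gens_def using 1 \<alpha>_closed h_closed by blast
  next
    case 2
    have "v = frag_of (\<alpha> m, h p \<oplus>\<^bsub>P'\<^esub> h p') - frag_of (\<alpha> m, h p) - frag_of (\<alpha> m, h p')"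
      using 2 v by (simp add: frag_extend_diff semilinear_add[OF h])
    then show ?thesis unfolding S'.gens_def using 2 \<alpha>_closed h_closed by blast
  next
    case 3
    have "v = frag_of (\<phi> a \<odot>\<^bsub>M'\<^esub> \<alpha> m, h p) - frag_of (\<alpha> m, \<phi> a \<odot>\<^bsub>P'\<^esub> h p)"
      using 3 v by (simp add: frag_extend_diff semilinear_smult[OF h] semilinear_smult[OF \<alpha>])
    then show ?thesis unfolding S'.gens_def using 3 \<alpha>_closed h_closed \<phi> by blast
  qed
qed

sublocale Q: quotient_hom S.FM S'.FM "tensor_relations A M P" "tensor_relations B M' P'" F
proof (intro quotient_hom.intro quotient_hom_axioms.intro S.FM.comm_group_axioms S'.FM.comm_group_axioms
    S.relations_subgroup S'.relations_subgroup F_hom)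
  interpret gh: group_hom S.FM S'.FM F by unfold_locales (rule F_hom)
  show "F ` tensor_relations A M P \<subseteq> tensor_relations B M' P'"
    unfolding S.relations_eq S'.relations_eq gh.generate_img[OF S.gens_closed, symmetric]
    by (rule S'.FM.mono_generate[OF F_gens])
qed

lemma tensor_map_hom: "tensor_map B M' P' \<alpha> h \<in> hom (tensor A M P) (tensor B M' P')"
  unfolding tensor_map_def tensor_def by (rule Q.quotient_map_hom)

lemma tensor_map_pure:
  "\<lbrakk>m \<in> carrier M; p \<in> carrier P\<rbrakk> \<Longrightarrow> tensor_map B M' P' \<alpha> h (S.pure m p) = S'.pure (\<alpha> m) (h p)"
  unfolding tensor_map_def S.pure_def S'.pure_def by (subst Q.quotient_map_coset) auto

end


subsection \<open>Homology of the tensored complex\<close>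

text \<open>The generator m0 of the right module is fixed once and for all. Every chain of the
  tensored complex then has the form m0 \<otimes> x, and homology can be described by elements x of
  the resolution.\<close>

locale tensor_complex =
  fixes A :: "('a, 'x) ring_scheme" and M :: "('a, 'm) module" and m0 :: 'm
    and P :: "nat \<Rightarrow> ('a, 'p) module" and d :: "nat \<Rightarrow> 'p \<Rightarrow> 'p"
  assumes module_P: "left_module A (P k)" and module_M: "abelian_group M"
    and action: "\<lbrakk>a \<in> carrier A; m \<in> carrier M\<rbrakk> \<Longrightarrow> a \<odot>\<^bsub>M\<^esub> m \<in> carrier M"
    and d: "d k \<in> linear_maps A (P (Suc k)) (P k)"
    and dd: "x \<in> carrier (P (Suc (Suc k))) \<Longrightarrow> d k (d (Suc k) x) = \<zero>\<^bsub>P k\<^esub>"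
    and m0: "m0 \<in> carrier M" and m0_gen: "m \<in> carrier M \<Longrightarrow> \<exists>a\<in>carrier A. m = a \<odot>\<^bsub>M\<^esub> m0"
begin

lemma pair: "tensor_pair A M (P k)"
  by (intro tensor_pair.intro module_P module_M action)

lemma morphism_d: "tensor_morphism A M (P (Suc k)) A M (P k) (\<lambda>a. a) (\<lambda>m. m) (d k)"
  by (intro tensor_morphism.intro tensor_morphism_axioms.intro pair d) (auto simp: semilinear_def)

abbreviation cycs where "cycs \<equiv> tensor_cycles A M P d"
abbreviation bds where "bds \<equiv> tensor_boundaries A M P d"
abbreviation pu where "pu k \<equiv> tensor_pair.pure A M (P k) m0"

text \<open>Concerns the tensored complex: m0 \<otimes> x is a cycle there. This is weaker than
  being a cycle of P itself, since d x need only die after tensoring.\<close>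

definition cyc where "cyc k x \<longleftrightarrow> (case k of 0 \<Rightarrow> True | Suc j \<Rightarrow> pu j (d j x) = \<one>\<^bsub>tensor A M (P j)\<^esub>)"

lemma d_closed: "x \<in> carrier (P (Suc k)) \<Longrightarrow> d k x \<in> carrier (P k)"
  using d by (rule semilinear_closed)

lemma carrier_eq: "carrier (tensor A M (P k)) = pu k ` carrier (P k)"
  by (rule tensor_pair.tensor_cyclic[OF pair m0 m0_gen])

lemma tensor_map_d: "x \<in> carrier (P (Suc k)) \<Longrightarrow> tensor_map A M (P k) (\<lambda>m. m) (d k) (pu (Suc k) x) = pu k (d k x)"
  by (rule tensor_morphism.tensor_map_pure[OF morphism_d m0])

lemma cycles_eq: "cycs k = pu k ` {x \<in> carrier (P k). cyc k x}"
proof (cases k)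
  case (Suc j)
  then show ?thesis
    using tensor_map_d by (auto simp: kernel_def carrier_eq cyc_def)
qed (auto simp: cyc_def carrier_eq)

lemma boundaries_eq: "bds k = pu k ` d k ` carrier (P (Suc k))"
  using tensor_map_d by (force simp: tensor_boundaries_def carrier_eq image_image)

lemma group_hom_d: "group_hom (tensor A M (P (Suc k))) (tensor A M (P k)) (tensor_map A M (P k) (\<lambda>m. m) (d k))"
  by (intro group_hom.intro group_hom_axioms.intro tensor_morphism.tensor_map_hom[OF morphism_d]
      comm_group.axioms(2) tensor_pair.tensor_comm_group[OF pair])

lemma group_tensor: "comm_group (tensor A M (P k))"
  by (rule tensor_pair.tensor_comm_group[OF pair])

lemma cycles_subgroup: "subgroup (cycs k) (tensor A M (P k))"
proof (cases k)
  case 0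
  then show ?thesis using group.subgroup_self[OF comm_group.axioms(2)[OF group_tensor]] by simp
next
  case (Suc j)
  then show ?thesis using group_hom.subgroup_kernel[OF group_hom_d] by simp
qed

lemma boundaries_subgroup: "subgroup (bds k) (tensor A M (P k))"
  unfolding tensor_boundaries_def by (rule group_hom.img_is_subgroup[OF group_hom_d])

lemma cyc_d: "x \<in> carrier (P (Suc k)) \<Longrightarrow> cyc k (d k x)"
  using dd m0 tensor_pair.pure_zero_right[OF pair] by (auto simp: cyc_def split: nat.split)

lemma boundaries_cycles: "bds k \<subseteq> cycs k"
  using cyc_d d_closed by (auto simp: cycles_eq boundaries_eq)

abbreviation Z where "Z k \<equiv> (tensor A M (P k))\<lparr>carrier := cycs k\<rparr>"

lemma Z_comm_group: "comm_group (Z k)"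
proof -
  interpret T: comm_group "tensor A M (P k)" by (rule group_tensor)
  show ?thesis
    using T.m_comm subgroup.mem_carrier[OF cycles_subgroup]
    by (intro group.group_comm_groupI subgroup.subgroup_is_group[OF cycles_subgroup T.is_group]) simp
qed

lemma boundaries_subgroup_Z: "subgroup (bds k) (Z k)"
  by (rule group.subgroup_incl[OF comm_group.axioms(2)[OF group_tensor] boundaries_subgroup cycles_subgroup
      boundaries_cycles])

lemma carrier_Tor:
  "carrier (Tor A M P d k) = (\<lambda>c. bds k #>\<^bsub>tensor A M (P k)\<^esub> c) ` cycs k"
  by (simp add: Tor_def carrier_FactGroup r_coset_def)

end

section \<open>Chain maps and the induced maps on Tor\<close>

locale tensor_chain_map =
  S: tensor_complex A M m0 P d + S': tensor_complex B M' m0' Q d'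
  for A M m0 P d B M' m0' Q d' +
  fixes \<phi> \<alpha> f
  assumes \<phi>: "\<And>a. a \<in> carrier A \<Longrightarrow> \<phi> a \<in> carrier B"
    and \<alpha>: "\<alpha> \<in> semilinear A \<phi> M M'" and f: "\<And>k. f k \<in> semilinear A \<phi> (P k) (Q k)"
    and fd: "\<And>k x. x \<in> carrier (P (Suc k)) \<Longrightarrow> d' k (f (Suc k) x) = f k (d k x)"
begin

abbreviation F where "F k \<equiv> tensor_map B M' (Q k) \<alpha> (f k)"

lemma morphism_f: "tensor_morphism A M (P k) B M' (Q k) \<phi> \<alpha> (f k)"
  by (intro tensor_morphism.intro tensor_morphism_axioms.intro S.pair S'.pair \<phi> \<alpha> f)

lemma f_closed: "x \<in> carrier (P k) \<Longrightarrow> f k x \<in> carrier (Q k)"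
  using f by (rule semilinear_closed)

lemma tensor_map_f:
  "\<lbrakk>m \<in> carrier M; x \<in> carrier (P k)\<rbrakk> \<Longrightarrow>
    F k (tensor_pair.pure A M (P k) m x) = tensor_pair.pure B M' (Q k) (\<alpha> m) (f k x)"
  by (rule tensor_morphism.tensor_map_pure[OF morphism_f])

lemma group_hom_f: "group_hom (tensor A M (P k)) (tensor B M' (Q k)) (F k)"
  by (intro group_hom.intro group_hom_axioms.intro tensor_morphism.tensor_map_hom[OF morphism_f]
      comm_group.axioms(2) S.group_tensor S'.group_tensor)

lemma tensor_map_boundary:
  assumes "x \<in> carrier (P (Suc k))"
  shows "F k (S.pu k (d k x))
    = tensor_map B M' (Q k) (\<lambda>m. m) (d' k) (F (Suc k) (S.pu (Suc k) x))"
proof -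
  have "\<alpha> m0 \<in> carrier M'" using \<alpha> S.m0 by (rule semilinear_closed)
  then show ?thesis
    using assms tensor_map_f[OF S.m0] S.d_closed f_closed fd
      tensor_morphism.tensor_map_pure[OF S'.morphism_d] by simp
qed

lemma tensor_map_cycles:
  assumes "c \<in> S.cycs k"
  shows "F k c \<in> S'.cycs k"
proof -
  obtain x where x: "x \<in> carrier (P k)" "c = S.pu k x" "S.cyc k x"
    using assms by (auto simp: S.cycles_eq)
  have closed: "F k c \<in> carrier (tensor B M' (Q k))"
    using x group_hom.hom_closed[OF group_hom_f] by (auto simp: S.carrier_eq)
  show ?thesis
  proof (cases k)
    case 0
    then show ?thesis using closed by simp
  next
    case (Suc j)
    have "tensor_map B M' (Q j) (\<lambda>m. m) (d' j) (F k c)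
        = F j (S.pu j (d j x))"
      using tensor_map_boundary x Suc by simp
    also have "\<dots> = \<one>\<^bsub>tensor B M' (Q j)\<^esub>"
      using x(3) Suc group_hom.hom_one[OF group_hom_f] by (simp add: S.cyc_def)
    finally show ?thesis using closed Suc by (simp add: kernel_def)
  qed
qed

lemma tensor_map_boundaries:
  assumes "c \<in> S.bds k"
  shows "F k c \<in> S'.bds k"
proof -
  obtain x where x: "x \<in> carrier (P (Suc k))" "c = S.pu k (d k x)"
    using assms by (auto simp: S.boundaries_eq)
  have "F (Suc k) (S.pu (Suc k) x) \<in> carrier (tensor B M' (Q (Suc k)))"
    using x group_hom.hom_closed[OF group_hom_f] by (auto simp: S.carrier_eq)
  then show ?thesis
    using x tensor_map_boundary by (auto simp: tensor_boundaries_def)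
qed

lemma quotient_hom_f:
  "quotient_hom (S.Z k) (S'.Z k) (S.bds k) (S'.bds k)
    (F k)"
proof (intro quotient_hom.intro quotient_hom_axioms.intro S.Z_comm_group S'.Z_comm_group
    S.boundaries_subgroup_Z S'.boundaries_subgroup_Z)
  show "F k \<in> hom (S.Z k) (S'.Z k)"
    using tensor_map_cycles group_hom.hom_mult[OF group_hom_f] subgroup.mem_carrier[OF S.cycles_subgroup]
    by (auto simp: hom_def)
qed (use tensor_map_boundaries in blast)

text \<open>Restricting the carrier to the cycles leaves the multiplication unchanged and therefore
  also the cosets, so the quotient may be taken inside the group of cycles.\<close>

lemma Tor_map_eq:
  "Tor_map B M' Q d' k \<alpha> f = quotient_map (S'.Z k) (S'.bds k) (F k)"
  by (simp add: Tor_map_def quotient_map_def r_coset_def fun_eq_iff)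

lemma Tor_map_coset:
  assumes "c \<in> S.cycs k"
  shows "Tor_map B M' Q d' k \<alpha> f (S.bds k #>\<^bsub>tensor A M (P k)\<^esub> c)
    = S'.bds k #>\<^bsub>tensor B M' (Q k)\<^esub> F k c"
  using quotient_hom.quotient_map_coset[OF quotient_hom_f, of c] assms
  by (simp add: Tor_map_eq r_coset_def)

text \<open>As all tensors are pure with left factor m0, bijectivity can be tested on elements of
  the resolutions: injectivity on those that become boundaries, surjectivity up to a
  boundary.\<close>

lemma Tor_map_iso:
  assumes \<alpha>m0: "\<alpha> m0 = m0'"
    and inj: "\<And>x y. \<lbrakk>x \<in> carrier (P k); S.cyc k x; y \<in> carrier (Q (Suc k)); S'.pu k (f k x) = S'.pu k (d' k y)\<rbrakk>
      \<Longrightarrow> \<exists>z\<in>carrier (P (Suc k)). S.pu k x = S.pu k (d k z)"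
    and surj: "\<And>y. \<lbrakk>y \<in> carrier (Q k); S'.cyc k y\<rbrakk>
      \<Longrightarrow> \<exists>x\<in>carrier (P k). S.cyc k x \<and>
        (\<exists>z\<in>carrier (Q (Suc k)). S'.pu k (f k x) = S'.pu k (d' k z) \<otimes>\<^bsub>tensor B M' (Q k)\<^esub> S'.pu k y)"
  shows "Tor_map B M' Q d' k \<alpha> f \<in> iso (Tor A M P d k) (Tor B M' Q d' k)"
  unfolding Tor_map_eq Tor_def
proof (rule quotient_hom.quotient_map_iso[OF quotient_hom_f])
  fix c assume c: "c \<in> carrier (S.Z k)" "F k c \<in> S'.bds k"
  then obtain x where x: "x \<in> carrier (P k)" "c = S.pu k x" "S.cyc k x"
    by (auto simp: S.cycles_eq)
  then obtain y where "y \<in> carrier (Q (Suc k))" "S'.pu k (f k x) = S'.pu k (d' k y)"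
    using c(2) tensor_map_f[OF S.m0] \<alpha>m0 by (auto simp: S'.boundaries_eq)
  then obtain z where "z \<in> carrier (P (Suc k))" "S.pu k x = S.pu k (d k z)"
    using inj x by blast
  then show "c \<in> S.bds k"
    using x(2) by (simp add: S.boundaries_eq)
next
  fix c assume "c \<in> carrier (S'.Z k)"
  then obtain y where y: "y \<in> carrier (Q k)" "c = S'.pu k y" "S'.cyc k y"
    by (auto simp: S'.cycles_eq)
  then obtain x z where x: "x \<in> carrier (P k)" "S.cyc k x" and z: "z \<in> carrier (Q (Suc k))"
    and eq: "S'.pu k (f k x) = S'.pu k (d' k z) \<otimes>\<^bsub>tensor B M' (Q k)\<^esub> S'.pu k y"
    using surj by blast
  have cyc: "S.pu k x \<in> carrier (S.Z k)" using x by (auto simp: S.cycles_eq)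
  have "S'.pu k (f k x) \<in> S'.bds k #>\<^bsub>S'.Z k\<^esub> c"
    using z eq y(2) by (auto simp: r_coset_def S'.boundaries_eq)
  then have "S'.bds k #>\<^bsub>S'.Z k\<^esub> c = S'.bds k #>\<^bsub>S'.Z k\<^esub> S'.pu k (f k x)"
    by (rule group.repr_independence[OF comm_group.axioms(2)[OF S'.Z_comm_group] _ \<open>c \<in> _\<close> S'.boundaries_subgroup_Z])
  then show "\<exists>a\<in>carrier (S.Z k). S'.bds k #>\<^bsub>S'.Z k\<^esub> F k a
      = S'.bds k #>\<^bsub>S'.Z k\<^esub> c"
    using cyc x tensor_map_f[OF S.m0] \<alpha>m0 by (intro bexI[OF _ cyc]) simp
qed

end

section \<open>Multiples of a right ideal\<close>

definition right_ideal :: "('a, 'x) ring_scheme \<Rightarrow> 'a set \<Rightarrow> bool" where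
  "right_ideal A V \<longleftrightarrow> V \<subseteq> carrier A \<and> \<zero>\<^bsub>A\<^esub> \<in> V \<and> (\<forall>v\<in>V. \<forall>w\<in>V. v \<oplus>\<^bsub>A\<^esub> w \<in> V) \<and>
     (\<forall>v\<in>V. \<forall>a\<in>carrier A. v \<otimes>\<^bsub>A\<^esub> a \<in> V)"

text \<open>The subgroup V M, which for a right ideal V is the image of V \<otimes> M in M. Closing
  under the addition of single products is enough, as negatives are obtained from - (v q) = v (-
  q).\<close>

inductive_set multiples :: "'a set \<Rightarrow> ('a, 'm) module \<Rightarrow> 'm set" for V M where
  zero: "\<zero>\<^bsub>M\<^esub> \<in> multiples V M"
| step: "\<lbrakk>x \<in> multiples V M; v \<in> V; q \<in> carrier M\<rbrakk> \<Longrightarrow> x \<oplus>\<^bsub>M\<^esub> v \<odot>\<^bsub>M\<^esub> q \<in> multiples V M"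

context left_module
begin

context
  fixes V assumes V: "V \<subseteq> carrier A"
begin

lemma multiples_closed: "x \<in> multiples V M \<Longrightarrow> x \<in> carrier M"
  by (induction rule: multiples.induct) (use V in \<open>auto intro!: smult_closed\<close>)

lemma multiplesI:
  assumes "v \<in> V" "q \<in> carrier M" shows "v \<odot>\<^bsub>M\<^esub> q \<in> multiples V M"
proof -
  have "\<zero>\<^bsub>M\<^esub> \<oplus>\<^bsub>M\<^esub> v \<odot>\<^bsub>M\<^esub> q \<in> multiples V M"
    by (rule multiples.step[OF multiples.zero assms])
  then show ?thesis using assms V smult_closed by (simp add: subset_iff)
qed

lemma multiples_add:
  assumes "y \<in> multiples V M" "x \<in> multiples V M" shows "x \<oplus>\<^bsub>M\<^esub> y \<in> multiples V M"
  using assms(1)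
proof (induction rule: multiples.induct)
  case zero
  then show ?case using assms(2) multiples_closed by simp
next
  case (step y v q)
  have "x \<oplus>\<^bsub>M\<^esub> (y \<oplus>\<^bsub>M\<^esub> v \<odot>\<^bsub>M\<^esub> q) = (x \<oplus>\<^bsub>M\<^esub> y) \<oplus>\<^bsub>M\<^esub> v \<odot>\<^bsub>M\<^esub> q"
    using step V assms(2) multiples_closed smult_closed by (simp add: M.a_assoc subset_iff)
  then show ?case using step multiples.step by metis
qed

lemma multiples_minus:
  assumes "x \<in> multiples V M" shows "\<ominus>\<^bsub>M\<^esub> x \<in> multiples V M"
  using assms
proof (induction rule: multiples.induct)
  case zero
  have "\<ominus>\<^bsub>M\<^esub> \<zero>\<^bsub>M\<^esub> = \<zero>\<^bsub>M\<^esub>" by (rule M.minus_equality) simp_all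
  then show ?case using multiples.zero[of M V] by (simp only:)
next
  case (step x v q)
  have "\<ominus>\<^bsub>M\<^esub> (x \<oplus>\<^bsub>M\<^esub> v \<odot>\<^bsub>M\<^esub> q) = \<ominus>\<^bsub>M\<^esub> x \<oplus>\<^bsub>M\<^esub> v \<odot>\<^bsub>M\<^esub> (\<ominus>\<^bsub>M\<^esub> q)"
    using step V multiples_closed smult_closed by (simp add: M.minus_add smult_r_minus subset_iff)
  then show ?case using multiples.step[OF step(4,2), of "\<ominus>\<^bsub>M\<^esub> q"] step(3) by simp
qed

lemma multiples_diff:
  "\<lbrakk>x \<in> multiples V M; y \<in> multiples V M\<rbrakk> \<Longrightarrow> x \<ominus>\<^bsub>M\<^esub> y \<in> multiples V M"
  by (simp add: M.minus_eq multiples_add multiples_minus)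

lemma multiples_left_mult:
  assumes "x \<in> multiples V M" "a \<in> carrier A" "W \<subseteq> carrier A" "\<And>v. v \<in> V \<Longrightarrow> a \<otimes>\<^bsub>A\<^esub> v \<in> W"
  shows "a \<odot>\<^bsub>M\<^esub> x \<in> multiples W M"
  using assms(1)
proof (induction rule: multiples.induct)
  case zero
  then show ?case using assms(2) by (simp add: multiples.zero)
next
  case (step x v q)
  have "a \<odot>\<^bsub>M\<^esub> (x \<oplus>\<^bsub>M\<^esub> v \<odot>\<^bsub>M\<^esub> q) = a \<odot>\<^bsub>M\<^esub> x \<oplus>\<^bsub>M\<^esub> (a \<otimes>\<^bsub>A\<^esub> v) \<odot>\<^bsub>M\<^esub> q"
    using step V assms(2) multiples_closed smult_closed
    by (simp add: smult_r_distr smult_assoc1 subset_iff)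
  then show ?case using step assms(4) multiples.step by metis
qed

lemma multiples_fixed:
  assumes "x \<in> multiples V M" "a \<in> carrier A" "\<And>v. v \<in> V \<Longrightarrow> a \<otimes>\<^bsub>A\<^esub> v = v"
  shows "a \<odot>\<^bsub>M\<^esub> x = x"
  using assms(1)
proof (induction rule: multiples.induct)
  case zero
  then show ?case using assms(2) by simp
next
  case (step x v q)
  then show ?case
    using V assms(2,3) multiples_closed smult_closed smult_assoc1[of a v q]
    by (simp add: smult_r_distr subset_iff)
qed

lemma multiples_null:
  assumes "x \<in> multiples V M" "\<And>v q. \<lbrakk>v \<in> V; q \<in> carrier M\<rbrakk> \<Longrightarrow> v \<odot>\<^bsub>M\<^esub> q = \<zero>\<^bsub>M\<^esub>"
  shows "x = \<zero>\<^bsub>M\<^esub>"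
  using assms(1) by (induction rule: multiples.induct) (simp_all add: assms(2))

end

lemma multiples_sum:
  assumes "x \<in> multiples V M" "V1 \<subseteq> carrier A" "V2 \<subseteq> carrier A"
    and V12: "\<And>v. v \<in> V \<Longrightarrow> \<exists>v1\<in>V1. \<exists>v2\<in>V2. v = v1 \<oplus>\<^bsub>A\<^esub> v2"
  shows "\<exists>y\<in>multiples V1 M. \<exists>z\<in>multiples V2 M. x = y \<oplus>\<^bsub>M\<^esub> z"
  using assms(1)
proof (induction rule: multiples.induct)
  case zero
  have "\<zero>\<^bsub>M\<^esub> = \<zero>\<^bsub>M\<^esub> \<oplus>\<^bsub>M\<^esub> \<zero>\<^bsub>M\<^esub>" by simp
  then show ?case using multiples.zero by blast
next
  case (step x v q)
  then obtain y z where yz: "y \<in> multiples V1 M" "z \<in> multiples V2 M" "x = y \<oplus>\<^bsub>M\<^esub> z" by blast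
  obtain v1 v2 where v: "v1 \<in> V1" "v2 \<in> V2" "v = v1 \<oplus>\<^bsub>A\<^esub> v2" using V12[OF step(2)] by blast
  have cl: "y \<in> carrier M" "z \<in> carrier M"
    using multiples_closed[OF assms(2) yz(1)] multiples_closed[OF assms(3) yz(2)] .
  have "v1 \<in> carrier A" "v2 \<in> carrier A" using v assms(2,3) by blast+
  then have "x \<oplus>\<^bsub>M\<^esub> v \<odot>\<^bsub>M\<^esub> q = (y \<oplus>\<^bsub>M\<^esub> v1 \<odot>\<^bsub>M\<^esub> q) \<oplus>\<^bsub>M\<^esub> (z \<oplus>\<^bsub>M\<^esub> v2 \<odot>\<^bsub>M\<^esub> q)"
    using yz(3) v(3) cl step(3) smult_closed by (simp add: smult_l_distr M.a_ac)
  then show ?case using multiples.step[OF yz(1) v(1) step(3)] multiples.step[OF yz(2) v(2) step(3)] by blast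
qed

lemma multiples_mono:
  assumes "V \<subseteq> W" "x \<in> multiples V M" shows "x \<in> multiples W M"
  using assms(2)
proof (induction rule: multiples.induct)
  case (step x v q)
  then show ?case using assms(1) multiples.step[of x W M v q] by blast
qed (rule multiples.zero)

end

lemma multiples_semilinear:
  assumes "left_module A M" "left_module B N" "h \<in> semilinear A \<phi> M N" "V \<subseteq> carrier A"
    and "\<And>v. v \<in> V \<Longrightarrow> \<phi> v \<in> W" and "x \<in> multiples V M"
  shows "h x \<in> multiples W N"
  using assms(6)
proof (induction rule: multiples.induct)
  case zero
  then show ?case
    using semilinear_zero[OF left_module_group[OF assms(1)] left_module_group[OF assms(2)] assms(3)]
    by (simp add: multiples.zero)
next
  case (step x v q)
  have "h (x \<oplus>\<^bsub>M\<^esub> v \<odot>\<^bsub>M\<^esub> q) = h x \<oplus>\<^bsub>N\<^esub> \<phi> v \<odot>\<^bsub>N\<^esub> h q"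
    using step assms(4) left_module.multiples_closed[OF assms(1,4)] left_module.smult_closed[OF assms(1)]
    by (simp add: semilinear_add[OF assms(3)] semilinear_smult[OF assms(3)] subset_iff)
  then show ?case
    using step multiples.step assms(5) semilinear_closed[OF assms(3)] by metis
qed

text \<open>In a free module F, the vectors in V F are those with all coefficients in V. This is the
  inclusion for which V has to absorb multiplication from the right.\<close>

lemma free_multiples_coeff:
  assumes "ring A" "right_ideal A V" "x \<in> multiples V (free_module A S)" "s \<in> S"
  shows "x s \<in> V"
  using assms(3)
proof (induction rule: multiples.induct)
  case zero
  then show ?case using assms by (simp add: free_module_zero right_ideal_def)
next
  case (step x v q)
  then show ?case
    using assms free_module_coeff[OF step(3) assms(4)]
    by (simp add: free_module_add free_module_smult right_ideal_def)
qed

text \<open>The converse inclusion, combined with a linear map out of F: a vector with coefficients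
  in V is a sum of V-multiples of basis elements.\<close>

lemma multiples_free_semilinear:
  assumes "left_module A M" "r \<in> linear_maps A (free_module A S) M" "V \<subseteq> carrier A"
    and "c \<in> carrier (free_module A S)" "\<And>s. s \<in> S \<Longrightarrow> c s \<in> V" "\<zero>\<^bsub>A\<^esub> \<in> V"
  shows "r c \<in> multiples V M"
proof -
  interpret left_module A M by fact
  let ?F = "free_module A S"
  have "c \<in> carrier ?F \<and> r c \<in> multiples V M"
    using A.ring_axioms assms(4)
  proof (induction rule: free_module_induct)
    case zero
    have "r \<zero>\<^bsub>?F\<^esub> = \<zero>\<^bsub>M\<^esub>"
      by (rule semilinear_free_zero[OF A.ring_axioms left_module_axioms _ assms(2)]) simp
    moreover have "\<zero>\<^bsub>?F\<^esub> \<in> carrier ?F" by (simp add: free_module_def)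
    ultimately show ?case using multiples.zero[of M V] by simp
  next
    case (step c' a s)
    have av: "a \<in> V" using step assms(5) by simp
    have \<delta>: "free_basis A S s \<in> carrier ?F" using free_basis_closed[OF A.ring_axioms step(3)] .
    have a\<delta>: "a \<odot>\<^bsub>?F\<^esub> free_basis A S s \<in> carrier ?F"
      by (rule free_module_smult_closed[OF A.ring_axioms step(2) \<delta>])
    have "c' \<oplus>\<^bsub>?F\<^esub> a \<odot>\<^bsub>?F\<^esub> free_basis A S s \<in> carrier ?F"
      by (rule free_module_add_closed[OF A.ring_axioms step(1) a\<delta>])
    moreover have "r (c' \<oplus>\<^bsub>?F\<^esub> a \<odot>\<^bsub>?F\<^esub> free_basis A S s) = r c' \<oplus>\<^bsub>M\<^esub> a \<odot>\<^bsub>M\<^esub> r (free_basis A S s)"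
      using semilinear_add[OF assms(2) step(1) a\<delta>] semilinear_smult[OF assms(2) step(2) \<delta>] by simp
    ultimately show ?case
      using multiples.step[OF _ av semilinear_closed[OF assms(2) \<delta>]] step by metis
  qed
  then show ?thesis by simp
qed

text \<open>This is flatness of \<open>M\<close>, applied to the inclusions of the two ideals into \<open>A\<close>.\<close>

lemma multiples_Int:
  assumes P: "projective A M" and V: "right_ideal A V" and W: "right_ideal A W"
    and x: "x \<in> multiples V M" "x \<in> multiples W M"
  shows "x \<in> multiples (V \<inter> W) M"
proof -
  have M: "left_module A M" using P by (simp add: projective_def)
  interpret left_module A M by (rule M)
  obtain S :: "'c set" and j r where j: "j \<in> linear_maps A M (free_module A S)"
    and r: "r \<in> linear_maps A (free_module A S) M" and rj: "\<forall>x\<in>carrier M. r (j x) = x"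
    using P by (auto simp: projective_def)
  have "j y \<in> multiples U (free_module A S)" if "right_ideal A U" "y \<in> multiples U M" for U y
    using that(2)
  proof (induction rule: multiples.induct)
    case zero
    let ?F = "free_module A S"
    have "j \<zero>\<^bsub>M\<^esub> = \<zero>\<^bsub>A\<^esub> \<odot>\<^bsub>?F\<^esub> j \<zero>\<^bsub>M\<^esub>"
      using semilinear_smult[OF j A.zero_closed M.zero_closed] by simp
    also have "\<dots> = \<zero>\<^bsub>?F\<^esub>"
      using free_module_coeff[OF semilinear_closed[OF j M.zero_closed]]
      by (auto simp: free_module_def fun_eq_iff)
    finally show ?case by (simp add: multiples.zero)
  next
    case (step y v q)
    have "v \<in> carrier A" "y \<in> carrier M"
      using that(1) step multiples_closed by (auto simp: right_ideal_def)
    then show ?case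
      using step semilinear_add[OF j] semilinear_smult[OF j] smult_closed
      by (auto intro!: multiples.step semilinear_closed[OF j])
  qed
  \<comment> \<open>In a free module the claim about intersections is checked coordinate by
    coordinate; the retraction r then brings it back to M.\<close>
  then have c: "j x s \<in> V \<inter> W" if "s \<in> S" for s
    using free_multiples_coeff[OF A.ring_axioms _ _ that] V W x by blast
  have "x \<in> carrier M" using multiples_closed[OF _ x(1)] V by (auto simp: right_ideal_def)
  moreover have "r (j x) \<in> multiples (V \<inter> W) M"
    by (rule multiples_free_semilinear[OF M r _ semilinear_closed[OF j \<open>x \<in> carrier M\<close>] c])
       (use V W in \<open>auto simp: right_ideal_def\<close>)
  ultimately show ?thesis using rj by simp
qed

subsection \<open>Acyclic ideals\<close>

text \<open>Exactness in degree k of the subcomplex V Q, with the augmentation as last map. When V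
  annihilates N the augmentation vanishes on V Q, and in degree 0 the condition says that V Q has no
  homology there.\<close>

definition acyclic_at ::
  "('a, 'n) module \<Rightarrow> (nat \<Rightarrow> ('a, 'p) module) \<Rightarrow> (nat \<Rightarrow> 'p \<Rightarrow> 'p) \<Rightarrow> ('p \<Rightarrow> 'n) \<Rightarrow> 'a set \<Rightarrow> nat \<Rightarrow> bool" where
  "acyclic_at N Q d e V k \<longleftrightarrow>
    (\<forall>x\<in>multiples V (Q k). is_cycle N Q d e k x \<longrightarrow> (\<exists>w\<in>multiples V (Q (Suc k)). d k w = x))"

definition annihilates :: "'a set \<Rightarrow> ('a, 'n) module \<Rightarrow> bool" where
  "annihilates V N \<longleftrightarrow> (\<forall>v\<in>V. \<forall>x\<in>carrier N. v \<odot>\<^bsub>N\<^esub> x = \<zero>\<^bsub>N\<^esub>)"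

context
  fixes A N Q d e
  assumes res: "projective_resolution A N Q d e"
begin

lemma multiples_d:
  assumes "V \<subseteq> carrier A" "x \<in> multiples V (Q (Suc k))" shows "d k x \<in> multiples V (Q k)"
  by (rule multiples_semilinear[OF resolution_module[OF res] resolution_module[OF res] resolution_d[OF res] assms(1) _ assms(2)])

lemma annihilated_augmentation:
  assumes "V \<subseteq> carrier A" "annihilates V N" "x \<in> multiples V (Q 0)" shows "e x = \<zero>\<^bsub>N\<^esub>"
proof -
  interpret N: left_module A N by (rule resolution_target[OF res])
  have "e x \<in> multiples V N"
    by (rule multiples_semilinear[OF resolution_module[OF res] N.left_module_axioms resolution_e[OF res] assms(1) _ assms(3)])
  then show ?thesis
    by (rule N.multiples_null[OF assms(1)]) (use assms(2) in \<open>simp add: annihilates_def\<close>)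
qed

text \<open>A filling of the cycle exists in the exact complex Q. Multiplying it by u moves it into
  V Q, while the cycle itself is fixed by u.\<close>

lemma acyclic_if_left_unit:
  assumes V: "right_ideal A V" and "u \<in> V" and u: "\<And>v. v \<in> V \<Longrightarrow> u \<otimes>\<^bsub>A\<^esub> v = v"
  shows "acyclic_at N Q d e V k"
  unfolding acyclic_at_def
proof (intro ballI impI)
  interpret Q: left_module A "Q k" by (rule resolution_module[OF res])
  interpret QS: left_module A "Q (Suc k)" by (rule resolution_module[OF res])
  have VA: "V \<subseteq> carrier A" "u \<in> carrier A" using V \<open>u \<in> V\<close> by (auto simp: right_ideal_def)
  fix x assume x: "x \<in> multiples V (Q k)" "is_cycle N Q d e k x"
  then obtain y where y: "y \<in> carrier (Q (Suc k))" "d k y = x"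
    using resolution_exact[OF res Q.multiples_closed[OF VA(1)]] by blast
  have "d k (u \<odot>\<^bsub>Q (Suc k)\<^esub> y) = u \<odot>\<^bsub>Q k\<^esub> x"
    using semilinear_smult[OF resolution_d[OF res] VA(2) y(1)] y(2) by simp
  also have "\<dots> = x" by (rule Q.multiples_fixed[OF VA(1) x(1) VA(2) u])
  finally show "\<exists>w\<in>multiples V (Q (Suc k)). d k w = x"
    using QS.multiplesI[OF VA(1) \<open>u \<in> V\<close> y(1)] by blast
qed

text \<open>The Mayer--Vietoris argument for the sum of two right ideals.\<close>

lemma acyclic_sum:
  assumes V: "right_ideal A V" and W: "right_ideal A W" and U: "U \<subseteq> carrier A"
    and sum: "\<And>u. u \<in> U \<Longrightarrow> \<exists>v\<in>V. \<exists>w\<in>W. u = v \<oplus>\<^bsub>A\<^esub> w" and sub: "V \<subseteq> U" "W \<subseteq> U"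
    and ann: "annihilates V N" "annihilates W N"
    and acyc: "acyclic_at N Q d e V k" "acyclic_at N Q d e W k"
    and inter: "\<And>m. k = Suc m \<Longrightarrow> acyclic_at N Q d e (V \<inter> W) m"
  shows "acyclic_at N Q d e U k"
  unfolding acyclic_at_def
proof (intro ballI impI)
  interpret Q: left_module A "Q k" by (rule resolution_module[OF res])
  interpret QS: left_module A "Q (Suc k)" by (rule resolution_module[OF res])
  have VA: "V \<subseteq> carrier A" and WA: "W \<subseteq> carrier A" and VWA: "V \<inter> W \<subseteq> carrier A"
    using V W by (auto simp: right_ideal_def)
  fix x assume x: "x \<in> multiples U (Q k)" "is_cycle N Q d e k x"
  obtain y z where y: "y \<in> multiples V (Q k)" and z: "z \<in> multiples W (Q k)" and xyz: "x = y \<oplus>\<^bsub>Q k\<^esub> z"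
    using Q.multiples_sum[OF x(1) VA WA sum] by blast
  have cl: "y \<in> carrier (Q k)" "z \<in> carrier (Q k)"
    using Q.multiples_closed[OF VA y] Q.multiples_closed[OF WA z] .
  \<comment> \<open>The summands y and z of a cycle need not be cycles. They are corrected by an
    element w of the intersection complex, which is subtracted from one and added to the other, so
    that the sum stays x.\<close>
  have "\<exists>w\<in>multiples (V \<inter> W) (Q k). is_cycle N Q d e k (y \<ominus>\<^bsub>Q k\<^esub> w) \<and> is_cycle N Q d e k (z \<oplus>\<^bsub>Q k\<^esub> w)"
  proof (cases k)
    case 0
    \<comment> \<open>In degree 0 both summands lie in the kernel of the augmentation, since V and W
      annihilate N; the correction is zero.\<close>
    have "is_cycle N Q d e k (y \<ominus>\<^bsub>Q k\<^esub> \<zero>\<^bsub>Q k\<^esub>) \<and> is_cycle N Q d e k (z \<oplus>\<^bsub>Q k\<^esub> \<zero>\<^bsub>Q k\<^esub>)"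
      using annihilated_augmentation[OF VA ann(1)] annihilated_augmentation[OF WA ann(2)] y z 0
        Q.multiples_diff[OF VA y multiples.zero] Q.multiples_add[OF WA multiples.zero z] by simp
    then show ?thesis using multiples.zero by blast
  next
    case (Suc m)
    interpret Qm: left_module A "Q m" by (rule resolution_module[OF res])
    have d: "d m \<in> linear_maps A (Q k) (Q m)" using resolution_d[OF res, of m] Suc by simp
    have dcl: "d m y \<in> carrier (Q m)" "d m z \<in> carrier (Q m)" using semilinear_closed[OF d] cl by auto
    have "d m y \<oplus>\<^bsub>Q m\<^esub> d m z = \<zero>\<^bsub>Q m\<^esub>"
      using x(2) Suc xyz semilinear_add[OF d cl] by simp
    then have dy: "d m y = \<ominus>\<^bsub>Q m\<^esub> d m z"
      using dcl Qm.M.minus_equality by metis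
    have "d m y \<in> multiples V (Q m)" using multiples_d[OF VA] y Suc by simp
    moreover have "d m y \<in> multiples W (Q m)"
      unfolding dy using multiples_d[OF WA] z Suc Qm.multiples_minus[OF WA] by simp
    \<comment> \<open>The boundaries of y and z are opposite, so they lie in V Q and in W Q;
      projectivity of \<open>Q m\<close> puts them into the multiples of the intersection.\<close>
    ultimately have "d m y \<in> multiples (V \<inter> W) (Q m)"
      by (rule multiples_Int[OF resolution_projective[OF res] V W])
    moreover have "is_cycle N Q d e m (d m y)"
      using resolution_boundary[OF res] cl Suc by simp
    ultimately obtain w where w: "w \<in> multiples (V \<inter> W) (Q k)" "d m w = d m y"
      using inter[OF Suc] Suc by (auto simp: acyclic_at_def)
    have wcl: "w \<in> carrier (Q k)" using Q.multiples_closed[OF VWA w(1)] .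
    have "d m (y \<ominus>\<^bsub>Q k\<^esub> w) = \<zero>\<^bsub>Q m\<^esub>"
      using semilinear_diff[OF Q.M.abelian_group_axioms Qm.M.abelian_group_axioms d cl(1) wcl] w(2) dcl
      by (simp add: Qm.M.minus_self)
    moreover have "d m (z \<oplus>\<^bsub>Q k\<^esub> w) = \<zero>\<^bsub>Q m\<^esub>"
      using semilinear_add[OF d cl(2) wcl] w(2) dy dcl by (simp add: Qm.M.r_neg)
    ultimately show ?thesis using w(1) Suc by auto
  qed
  then obtain w where w: "w \<in> multiples (V \<inter> W) (Q k)" "is_cycle N Q d e k (y \<ominus>\<^bsub>Q k\<^esub> w)"
      "is_cycle N Q d e k (z \<oplus>\<^bsub>Q k\<^esub> w)"
    by blast
  have wV: "w \<in> multiples V (Q k)" and wW: "w \<in> multiples W (Q k)"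
    using Q.multiples_mono[OF _ w(1)] by blast+
  have wcl: "w \<in> carrier (Q k)" using Q.multiples_closed[OF VA wV] .
  obtain y' where y': "y' \<in> multiples V (Q (Suc k))" "d k y' = y \<ominus>\<^bsub>Q k\<^esub> w"
    using acyc(1) Q.multiples_diff[OF VA y wV] w(2) by (auto simp: acyclic_at_def)
  obtain z' where z': "z' \<in> multiples W (Q (Suc k))" "d k z' = z \<oplus>\<^bsub>Q k\<^esub> w"
    using acyc(2) Q.multiples_add[OF WA wW z] w(3) by (auto simp: acyclic_at_def)
  have "d k (y' \<oplus>\<^bsub>Q (Suc k)\<^esub> z') = (y \<ominus>\<^bsub>Q k\<^esub> w) \<oplus>\<^bsub>Q k\<^esub> (z \<oplus>\<^bsub>Q k\<^esub> w)"
    using semilinear_add[OF resolution_d[OF res] QS.multiples_closed[OF VA y'(1)] QS.multiples_closed[OF WA z'(1)]]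
      y'(2) z'(2) by simp
  also have "\<dots> = (y \<ominus>\<^bsub>Q k\<^esub> w) \<oplus>\<^bsub>Q k\<^esub> w \<oplus>\<^bsub>Q k\<^esub> z"
    using cl wcl by (simp add: Q.M.a_ac)
  also have "\<dots> = x"
    using cl wcl xyz Q.M.minus_add_cancel by simp
  finally show "\<exists>w\<in>multiples U (Q (Suc k)). d k w = x"
    using QS.multiples_add[OF U QS.multiples_mono[OF sub(2) z'(1)] QS.multiples_mono[OF sub(1) y'(1)]] by blast
qed

text \<open>From the long exact sequence of V Q, Q and Q / V Q: a cycle modulo V Q has its boundary
  in V Q, and filling that boundary in V Q one degree lower corrects it to a genuine cycle of Q.
  Hence the shift by one between the degree k and the acyclicity that is assumed.\<close>

lemma exact_mod_multiples:
  assumes V: "V \<subseteq> carrier A" "annihilates V N" and acyc: "\<And>m. k = Suc m \<Longrightarrow> acyclic_at N Q d e V m"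
    and H: "submod A (Q k) (multiples V (Q k))"
    and y: "y \<in> carrier (Q k)" "case k of 0 \<Rightarrow> e y = \<zero>\<^bsub>N\<^esub> | Suc m \<Rightarrow> d m y \<in> multiples V (Q m)"
  shows "\<exists>z\<in>carrier (Q (Suc k)). mcong (Q k) (multiples V (Q k)) y (d k z)"
proof -
  interpret Q: left_module A "Q k" by (rule resolution_module[OF res])
  have "\<exists>w\<in>multiples V (Q k). is_cycle N Q d e k (y \<ominus>\<^bsub>Q k\<^esub> w)"
  proof (cases k)
    case 0
    then have "is_cycle N Q d e k (y \<ominus>\<^bsub>Q k\<^esub> \<zero>\<^bsub>Q k\<^esub>)"
      using y Q.M.minus_zero_right[OF y(1)] by simp
    then show ?thesis using multiples.zero by blast
  next
    case (Suc m)
    interpret Qm: left_module A "Q m" by (rule resolution_module[OF res])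
    have d: "d m \<in> linear_maps A (Q k) (Q m)" using resolution_d[OF res, of m] Suc by simp
    have "d m y \<in> multiples V (Q m)" "is_cycle N Q d e m (d m y)"
      using y Suc resolution_boundary[OF res] by simp_all
    then obtain w where w: "w \<in> multiples V (Q k)" "d m w = d m y"
      using acyc[OF Suc] Suc by (auto simp: acyclic_at_def)
    have "d m (y \<ominus>\<^bsub>Q k\<^esub> w) = \<zero>\<^bsub>Q m\<^esub>"
      using semilinear_diff[OF Q.M.abelian_group_axioms Qm.M.abelian_group_axioms d y(1) Q.multiples_closed[OF V(1) w(1)]]
        w(2) semilinear_closed[OF d y(1)] by (simp add: Qm.M.minus_self)
    then show ?thesis using w Suc by auto
  qed
  then obtain w where w: "w \<in> multiples V (Q k)" "is_cycle N Q d e k (y \<ominus>\<^bsub>Q k\<^esub> w)" by blast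
  have wcl: "w \<in> carrier (Q k)" using Q.multiples_closed[OF V(1) w(1)] .
  obtain z where z: "z \<in> carrier (Q (Suc k))" "d k z = y \<ominus>\<^bsub>Q k\<^esub> w"
    using resolution_exact[OF res _ w(2)] y(1) wcl by auto
  have "y \<ominus>\<^bsub>Q k\<^esub> (y \<ominus>\<^bsub>Q k\<^esub> w) = w"
    using y(1) wcl by (simp add: Q.M.minus_eq Q.M.minus_add Q.M.r_neg2)
  then have "mcong (Q k) (multiples V (Q k)) y (d k z)"
    using z(2) w(1) y(1) wcl by (simp add: mcong_def)
  then show ?thesis using z(1) by blast
qed

end

section \<open>Comparison along a split surjection of rings\<close>

lemma projective_resolution_tensor_complex:
  assumes res: "projective_resolution A N P d e"
    and "m0 \<in> carrier N" "\<And>m. m \<in> carrier N \<Longrightarrow> \<exists>a\<in>carrier A. m = a \<odot>\<^bsub>N\<^esub> m0"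
  shows "tensor_complex A N m0 P d"
proof (rule tensor_complex.intro)
  show "d k (d (Suc k) x) = \<zero>\<^bsub>P k\<^esub>" if "x \<in> carrier (P (Suc (Suc k)))" for k x
    using resolution_boundary[OF res that] by simp
qed (use assms left_module_group[OF resolution_target[OF res]] resolution_module[OF res] resolution_d[OF res]
       left_module.smult_closed[OF resolution_target[OF res]] in auto)

lemma (in tensor_morphism) pure_cong:
  assumes "m \<in> carrier M" "x \<in> carrier P" "y \<in> carrier P" "S.pure m x = S.pure m y"
  shows "S'.pure (\<alpha> m) (h x) = S'.pure (\<alpha> m) (h y)"
  using assms tensor_map_pure by metis

lemma (in tensor_morphism) pure_one_cong:
  assumes "m \<in> carrier M" "x \<in> carrier P" "S.pure m x = \<one>\<^bsub>tensor A M P\<^esub>"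
  shows "S'.pure (\<alpha> m) (h x) = \<one>\<^bsub>tensor B M' P'\<^esub>"
proof -
  have "S.pure m x = S.pure m \<zero>\<^bsub>P\<^esub>" using assms by (simp add: S.pure_zero_right)
  then have "S'.pure (\<alpha> m) (h x) = S'.pure (\<alpha> m) (h \<zero>\<^bsub>P\<^esub>)"
    using assms by (intro pure_cong) auto
  also have "h \<zero>\<^bsub>P\<^esub> = \<zero>\<^bsub>P'\<^esub>"
    by (rule semilinear_zero[OF S.P.M.abelian_group_axioms S'.P.M.abelian_group_axioms h])
  finally show ?thesis using assms(1) \<alpha>_closed by (simp add: S'.pure_zero_right)
qed

lemma id_semilinear: "(\<lambda>x. x) \<in> semilinear A (\<lambda>a. a) M M"
  by (simp add: semilinear_def)

lemma id_ring_hom': "(\<lambda>a. a) \<in> ring_hom A A"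
  by (simp add: ring_hom_def)

text \<open>For multiplication by a scalar on both coefficient modules this becomes the R-linearity
  of the comparison map. Both sides agree already on pure tensors of chains.\<close>

lemma (in tensor_chain_map) Tor_map_commute:
  assumes \<mu>: "\<mu> \<in> linear_maps A M M" and \<mu>': "\<mu>' \<in> linear_maps B M' M'"
    and comm: "\<And>m. m \<in> carrier M \<Longrightarrow> \<alpha> (\<mu> m) = \<mu>' (\<alpha> m)"
    and C: "C \<in> carrier (Tor A M P d k)"
  shows "Tor_map B M' Q d' k \<alpha> f (Tor_map A M P d k \<mu> (\<lambda>k x. x) C)
    = Tor_map B M' Q d' k \<mu>' (\<lambda>k x. x) (Tor_map B M' Q d' k \<alpha> f C)"
proof -
  interpret U: tensor_chain_map A M m0 P d A M m0 P d "\<lambda>a. a" \<mu> "\<lambda>k x. x"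
    using \<mu> id_semilinear
    by (intro tensor_chain_map.intro tensor_chain_map_axioms.intro S.tensor_complex_axioms) auto
  interpret U': tensor_chain_map B M' m0' Q d' B M' m0' Q d' "\<lambda>a. a" \<mu>' "\<lambda>k x. x"
    using \<mu>' id_semilinear
    by (intro tensor_chain_map.intro tensor_chain_map_axioms.intro S'.tensor_complex_axioms) auto
  obtain c where c: "c \<in> S.cycs k"
      "C = S.bds k #>\<^bsub>tensor A M (P k)\<^esub> c"
    using C by (auto simp: S.carrier_Tor)
  then obtain x where x: "x \<in> carrier (P k)" "c = S.pu k x"
    by (auto simp: S.cycles_eq)
  have cl: "\<mu> m0 \<in> carrier M" "\<alpha> m0 \<in> carrier M'"
    using semilinear_closed[OF \<mu> S.m0] semilinear_closed[OF \<alpha> S.m0] .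
  have "F k (tensor_map A M (P k) \<mu> (\<lambda>x. x) c)
      = tensor_map B M' (Q k) \<mu>' (\<lambda>x. x) (F k c)"
    using x cl S.m0 comm f_closed[OF x(1)] tensor_map_f U.tensor_map_f U'.tensor_map_f by simp
  then show ?thesis
    using c U.tensor_map_cycles tensor_map_cycles Tor_map_coset U.Tor_map_coset U'.Tor_map_coset by simp
qed

text \<open>On a cycle m0 \<otimes> d x = 0. A linear map t induces a map of tensor products, which
  sends this zero to m0 \<otimes> t (d x).\<close>

lemma (in tensor_complex) pure_through_d:
  assumes x: "x \<in> carrier (P k)" "cyc k x" and p: "through_d A (\<lambda>a. a) P d P k p"
  shows "p x \<in> carrier (P k) \<and> pu k (p x) = \<one>\<^bsub>tensor A M (P k)\<^esub>"
proof (cases k)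
  case 0
  then show ?thesis
    using x p tensor_pair.pure_zero_right[OF pair m0, of 0] left_module_group[OF module_P, of 0]
    by (simp add: through_d_def abelian_group_def abelian_monoid.zero_closed)
next
  case (Suc m)
  then obtain t where t: "t \<in> linear_maps A (P m) (P (Suc m))" "p x = t (d m x)"
    using p x(1) by (auto simp: through_d_def)
  interpret t: tensor_morphism A M "P m" A M "P (Suc m)" "\<lambda>a. a" "\<lambda>x. x" t
    by (intro tensor_morphism.intro tensor_morphism_axioms.intro pair id_semilinear t) simp
  have dx: "d m x \<in> carrier (P m)" "pu m (d m x) = \<one>\<^bsub>tensor A M (P m)\<^esub>"
    using x Suc d_closed by (simp_all add: cyc_def)
  then show ?thesis
    using t.pure_one_cong[OF m0 dx] t.h_closed t(2) Suc by simp
qed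

text \<open>The homological core, free of diagrams: G is a retract of A with kernel I, and the two
  trivial modules are one group on which A acts through \<open>\<pi>\<close>. The ideal I enters
  only through acyclicity of I Q below degree i.\<close>

locale split_comparison =
  fixes G :: "('g, 'y) ring_scheme" and A :: "('a, 'x) ring_scheme" and \<iota> \<pi>
    and N :: "('g, 'n) module" and N' :: "('a, 'n) module" and m0 :: 'n
    and P :: "nat \<Rightarrow> ('g, 'p) module" and d e and Q :: "nat \<Rightarrow> ('a, 'q) module" and d' e' and I and i :: nat
  assumes resP: "projective_resolution G N P d e" and resQ: "projective_resolution A N' Q d' e'"
    and \<iota>: "\<iota> \<in> ring_hom G A" and \<pi>: "\<pi> \<in> ring_hom A G" and \<pi>\<iota>: "\<And>g. g \<in> carrier G \<Longrightarrow> \<pi> (\<iota> g) = g"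
    and id_\<iota>: "(\<lambda>x. x) \<in> semilinear G \<iota> N N'" and id_\<pi>: "(\<lambda>x. x) \<in> semilinear A \<pi> N' N"
    and I: "I = {a \<in> carrier A. \<pi> a = \<zero>\<^bsub>G\<^esub>}"
    and m0: "m0 \<in> carrier N" and m0_gen: "\<And>m. m \<in> carrier N \<Longrightarrow> \<exists>a\<in>carrier G. m = a \<odot>\<^bsub>N\<^esub> m0"
    and acyc: "\<And>k. k < i \<Longrightarrow> acyclic_at N' Q d' e' I k"
begin

sublocale N: left_module G N by (rule resolution_target[OF resP])
sublocale N': left_module A N' by (rule resolution_target[OF resQ])

lemma carrier_N: "carrier N' = carrier N"
  using id_\<iota> id_\<pi> by (auto simp: semilinear_def)

lemma zero_N: "\<zero>\<^bsub>N'\<^esub> = \<zero>\<^bsub>N\<^esub>"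
  using semilinear_zero[OF N'.M.abelian_group_axioms N.M.abelian_group_axioms id_\<pi>] .

sublocale TP: tensor_complex G N m0 P d
  by (rule projective_resolution_tensor_complex[OF resP m0 m0_gen])

lemma smult_\<iota>: "\<lbrakk>g \<in> carrier G; x \<in> carrier N\<rbrakk> \<Longrightarrow> \<iota> g \<odot>\<^bsub>N'\<^esub> x = g \<odot>\<^bsub>N\<^esub> x"
  using semilinear_smult[OF id_\<iota>] by metis

lemma smult_\<pi>: "\<lbrakk>a \<in> carrier A; x \<in> carrier N\<rbrakk> \<Longrightarrow> a \<odot>\<^bsub>N'\<^esub> x = \<pi> a \<odot>\<^bsub>N\<^esub> x"
  using semilinear_smult[OF id_\<pi>] carrier_N by metis

lemma m0_gen': "m \<in> carrier N' \<Longrightarrow> \<exists>a\<in>carrier A. m = a \<odot>\<^bsub>N'\<^esub> m0"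
  using m0_gen smult_\<iota> m0 carrier_N ring_hom_closed[OF \<iota>] by metis

sublocale TQ: tensor_complex A N' m0 Q d'
  using m0 carrier_N by (intro projective_resolution_tensor_complex[OF resQ _ m0_gen']) auto

lemma I_A: "I \<subseteq> carrier A" by (auto simp: I)

lemma I_annihilates: "annihilates I N'"
  using smult_\<pi> carrier_N zero_N by (auto simp: annihilates_def I)

text \<open>As a kernel, I is also a left ideal, so I Q is stable under A; multiples of a right
  ideal form in general only a subgroup.\<close>

lemma submod_IQ: "submod A (Q k) (multiples I (Q k))"
proof -
  interpret Q: left_module A "Q k" by (rule resolution_module[OF resQ])
  have "a \<otimes>\<^bsub>A\<^esub> v \<in> I" if "a \<in> carrier A" "v \<in> I" for a v
    using that ring_hom_mult[OF \<pi>] ring_hom_closed[OF \<pi>] by (auto simp: I)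
  then have "a \<odot>\<^bsub>Q k\<^esub> x \<in> multiples I (Q k)" if "a \<in> carrier A" "x \<in> multiples I (Q k)" for a x
    using Q.multiples_left_mult[OF I_A that(2,1) I_A] that(1) by blast
  then show ?thesis
    unfolding submod_def using Q.multiples_closed[OF I_A] Q.multiples_add[OF I_A] multiples.zero by blast
qed

text \<open>m0 \<otimes> v q = (m0 v) \<otimes> q, and v in I acts as zero on the trivial
  module.\<close>

lemma pure_IQ:
  assumes "x \<in> multiples I (Q k)" shows "TQ.pu k x = \<one>\<^bsub>tensor A N' (Q k)\<^esub>"
proof -
  interpret T: tensor_pair A N' "Q k" by (rule TQ.pair)
  show ?thesis
    using assms
  proof (induction rule: multiples.induct)
    case zero
    then show ?case by (rule T.pure_zero_right[OF TQ.m0])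
  next
    case (step x v q)
    have v: "v \<in> carrier A" using step(2) I_A by blast
    have "T.pure m0 (v \<odot>\<^bsub>Q k\<^esub> q) = T.pure (v \<odot>\<^bsub>N'\<^esub> m0) q"
      using T.pure_balanced[OF v TQ.m0 step(3)] by simp
    also have "v \<odot>\<^bsub>N'\<^esub> m0 = \<zero>\<^bsub>N'\<^esub>"
      using I_annihilates step(2) TQ.m0 by (simp add: annihilates_def)
    finally have "T.pure m0 (v \<odot>\<^bsub>Q k\<^esub> q) = \<one>\<^bsub>tensor A N' (Q k)\<^esub>"
      using T.pure_zero_left[OF step(3)] by simp
    then show ?case
      using step T.pure_add_right[OF TQ.m0 T.P.multiples_closed[OF I_A step(1)] T.P.smult_closed[OF v step(3)]] by simp
  qed
qed

lemma retraction_exists: "\<exists>h. chain_lift A \<pi> (\<lambda>x. x) Q d' e' P d e h"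
  by (rule chain_lift_exists[OF resQ resP \<pi> id_\<pi>])

context
  fixes f assumes f: "chain_lift G \<iota> (\<lambda>x. x) P d e Q d' e' f"
begin

lemma chain_map_f: "tensor_chain_map G N m0 P d A N' m0 Q d' \<iota> (\<lambda>x. x) f"
  using f ring_hom_closed[OF \<iota>] id_\<iota>
  by (intro tensor_chain_map.intro tensor_chain_map_axioms.intro TP.tensor_complex_axioms TQ.tensor_complex_axioms)
     (auto simp: chain_lift_def)

lemma Tor_map_comparison_iso: "Tor_map A N' Q d' i (\<lambda>x. x) f \<in> iso (Tor G N P d i) (Tor A N' Q d' i)"
proof -
  interpret F: tensor_chain_map G N m0 P d A N' m0 Q d' \<iota> "\<lambda>x. x" f by (rule chain_map_f)
  obtain h where lift_h: "chain_lift A \<pi> (\<lambda>x. x) Q d' e' P d e h" using retraction_exists by blast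
  interpret H: tensor_chain_map A N' m0 Q d' G N m0 P d \<pi> "\<lambda>x. x" h
    using lift_h ring_hom_closed[OF \<pi>] id_\<pi>
    by (intro tensor_chain_map.intro tensor_chain_map_axioms.intro TP.tensor_complex_axioms TQ.tensor_complex_axioms)
       (auto simp: chain_lift_def)
  have ef: "e' (f 0 x) = e x" if "x \<in> carrier (P 0)" for x
    using f that by (simp add: chain_lift_def)
  have eh: "e (h 0 x) = e' x" if "x \<in> carrier (Q 0)" for x
    using lift_h that by (simp add: chain_lift_def)
  interpret Pi: left_module G "P i" by (rule resolution_module[OF resP])
  interpret PSi: left_module G "P (Suc i)" by (rule resolution_module[OF resP])
  interpret Qi: left_module A "Q i" by (rule resolution_module[OF resQ])
  interpret tP: tensor_pair G N "P i" by (rule TP.pair)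
  interpret tQ: tensor_pair A N' "Q i" by (rule TQ.pair)
  note modP = resolution_module[OF resP] and modQ = resolution_module[OF resQ]
  note grpP = left_module_group[OF modP] and grpQ = left_module_group[OF modQ]

  \<comment> \<open>The deviation of h f from the identity of P. Since
    \<open>\<pi> (\<iota> g)\<close> is g, the composite is honestly G-linear, and the homotopy
    lemma is used with the zero submodule.\<close>
  define u where "u k x = h k (f k x) \<ominus>\<^bsub>P k\<^esub> x" for k x
  have hf: "(\<lambda>x. h k (f k x)) \<in> linear_maps G (P k) (P k)" for k
    by (rule semilinear_comp[OF F.f H.f F.\<phi>]) (simp_all add: \<pi>\<iota>)
  have hf_cl: "h k (f k x) \<in> carrier (P k)" if "x \<in> carrier (P k)" for k x
    using hf that by (rule semilinear_closed)
  have "\<exists>s p. s \<in> linear_maps G (P i) (P (Suc i)) \<and>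
      (\<forall>x\<in>carrier (P i). mcong (P i) {\<zero>\<^bsub>P i\<^esub>} (u i x) (d i (s x) \<oplus>\<^bsub>P i\<^esub> p x)) \<and>
      through_d G (\<lambda>a. a) P d P i p"
  proof (rule homotopy_mod[OF resP resP id_ring_hom', where H = "\<lambda>k. {\<zero>\<^bsub>P k\<^esub>}" and i = i])
    show "submod G (P k) {\<zero>\<^bsub>P k\<^esub>}" for k using left_module.submod_zero[OF modP] .
    then show "u k \<in> semilinear_mod G (\<lambda>a. a) (P k) (P k) {\<zero>\<^bsub>P k\<^esub>}" for k
      unfolding u_def
      by (intro semilinear_mod_diff[OF modP modP] semilinear_imp_mod[OF modP modP] hf id_semilinear)
    show "d k x \<in> {\<zero>\<^bsub>P k\<^esub>}" if "x \<in> {\<zero>\<^bsub>P (Suc k)\<^esub>}" for k x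
      using that semilinear_zero[OF grpP grpP resolution_d[OF resP]] by simp
    show "d k (u (Suc k) x) = u k (d k x)" if "x \<in> carrier (P (Suc k))" for k x
      unfolding u_def
      using semilinear_diff[OF grpP grpP resolution_d[OF resP] hf_cl[OF that] that] H.fd F.fd F.f_closed that
      by simp
    show "e (u 0 x) = \<zero>\<^bsub>N\<^esub>" if "x \<in> carrier (P 0)" for x
      unfolding u_def
      using semilinear_diff[OF grpP N.M.abelian_group_axioms resolution_e[OF resP] hf_cl[OF that] that]
        eh[OF F.f_closed[OF that]] ef[OF that] semilinear_closed[OF resolution_e[OF resP] that]
      by (simp add: N.M.minus_self)
    show "\<exists>z\<in>carrier (P (Suc k)). mcong (P k) {\<zero>\<^bsub>P k\<^esub>} y (d k z)"
      if "y \<in> carrier (P k)" "case k of 0 \<Rightarrow> e y = \<zero>\<^bsub>N\<^esub> | Suc m \<Rightarrow> d m y \<in> {\<zero>\<^bsub>P m\<^esub>}" for k y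
    proof -
      have "is_cycle N P d e k y" using that(2) by (cases k) simp_all
      then show ?thesis
        using resolution_exact[OF resP that(1)] that(1) left_module.mcong_zero[OF modP] by metis
    qed
  qed simp
  then obtain s p where s: "s \<in> linear_maps G (P i) (P (Suc i))"
    and sp: "\<And>x. x \<in> carrier (P i) \<Longrightarrow> u i x = d i (s x) \<oplus>\<^bsub>P i\<^esub> p x"
    and p: "through_d G (\<lambda>a. a) P d P i p"
    by (auto simp: left_module.mcong_zero[OF modP])
  have p_pure: "p x \<in> carrier (P i) \<and> TP.pu i (p x) = \<one>\<^bsub>tensor G N (P i)\<^esub>"
    if "x \<in> carrier (P i)" "TP.cyc i x" for x
    by (rule TP.pure_through_d[OF that p])
  \<comment> \<open>If f x is homologous to zero after tensoring, so is h (f x), and the homotopy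
    shows that h (f x) is homologous to x.\<close>
  have inj: "\<exists>z\<in>carrier (P (Suc i)). TP.pu i x = TP.pu i (d i z)"
    if x: "x \<in> carrier (P i)" "TP.cyc i x" and y: "y \<in> carrier (Q (Suc i))" "TQ.pu i (f i x) = TQ.pu i (d' i y)" for x y
  proof -
    have sx: "s x \<in> carrier (P (Suc i))" "d i (s x) \<in> carrier (P i)"
      using semilinear_closed[OF s x(1)] TP.d_closed by auto
    have hy: "h (Suc i) y \<in> carrier (P (Suc i))" "d i (h (Suc i) y) \<in> carrier (P i)"
      using H.f_closed[OF y(1)] TP.d_closed by auto
    have "TP.pu i (h i (f i x)) = TP.pu i (h i (d' i y))"
      by (rule tensor_morphism.pure_cong[OF H.morphism_f TQ.m0 F.f_closed[OF x(1)] TQ.d_closed[OF y(1)] y(2)])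
    then have 1: "TP.pu i (h i (f i x)) = TP.pu i (d i (h (Suc i) y))"
      using H.fd[OF y(1)] by simp
    have "h i (f i x) = (d i (s x) \<oplus>\<^bsub>P i\<^esub> p x) \<oplus>\<^bsub>P i\<^esub> x"
      using sp[OF x(1)] Pi.M.minus_add_cancel[OF hf_cl[OF x(1)] x(1)] by (simp add: u_def)
    then have "TP.pu i (h i (f i x)) = TP.pu i (d i (s x)) \<otimes>\<^bsub>tensor G N (P i)\<^esub> TP.pu i x"
      using sx p_pure[OF x] x(1) tP.pure_add_right[OF m0] tP.pure_closed[OF m0] by simp
    then have "TP.pu i x = TP.pu i (d i (h (Suc i) y)) \<otimes>\<^bsub>tensor G N (P i)\<^esub> inv\<^bsub>tensor G N (P i)\<^esub> TP.pu i (d i (s x))"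
      using 1 sx hy x(1) tP.pure_closed[OF m0] tP.T.inv_solve_right tP.T.m_comm by metis
    also have "\<dots> = TP.pu i (d i (h (Suc i) y) \<ominus>\<^bsub>P i\<^esub> d i (s x))"
      using sx hy tP.pure_add_right[OF m0] tP.pure_a_inv[OF m0] by (simp add: Pi.M.minus_eq)
    also have "\<dots> = TP.pu i (d i (h (Suc i) y \<ominus>\<^bsub>P (Suc i)\<^esub> s x))"
      using semilinear_diff[OF grpP grpP resolution_d[OF resP] hy(1) sx(1)] by simp
    finally show ?thesis using hy sx PSi.M.minus_closed by blast
  qed

  define w where "w k x = f k (h k x) \<ominus>\<^bsub>Q k\<^esub> x" for k x
  have fh: "(\<lambda>x. f k (h k x)) \<in> semilinear A (\<lambda>a. \<iota> (\<pi> a)) (Q k) (Q k)" for k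
    by (rule semilinear_comp[OF H.f F.f H.\<phi>]) simp_all
  have fh_cl: "f k (h k x) \<in> carrier (Q k)" if "x \<in> carrier (Q k)" for k x
    using fh that by (rule semilinear_closed)
  \<comment> \<open>A scalar a comes out of f h as \<open>\<iota> (\<pi> a)\<close>. Applying
    \<open>\<pi>\<close> shows that this differs from a by an element of I, hence the linearity
    modulo I Q.\<close>
  have fh_mod: "(\<lambda>x. f k (h k x)) \<in> semilinear_mod A (\<lambda>a. a) (Q k) (Q k) (multiples I (Q k))" for k
  proof -
    interpret Qk: left_module A "Q k" by (rule modQ)
    have "mcong (Q k) (multiples I (Q k)) (f k (h k (a \<odot>\<^bsub>Q k\<^esub> x))) (a \<odot>\<^bsub>Q k\<^esub> f k (h k x))"
      if "a \<in> carrier A" "x \<in> carrier (Q k)" for a x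
    proof -
      have a': "\<iota> (\<pi> a) \<in> carrier A" using that(1) F.\<phi> H.\<phi> by simp
      have "\<pi> (\<iota> (\<pi> a) \<ominus>\<^bsub>A\<^esub> a) = \<pi> (\<iota> (\<pi> a)) \<oplus>\<^bsub>G\<^esub> \<pi> (\<ominus>\<^bsub>A\<^esub> a)"
        using that(1) a' ring_hom_add[OF \<pi>] by (simp add: N'.A.minus_eq)
      also have "\<dots> = \<pi> a \<oplus>\<^bsub>G\<^esub> \<pi> (\<ominus>\<^bsub>A\<^esub> a)" using that(1) H.\<phi> \<pi>\<iota> by simp
      also have "\<dots> = \<pi> (a \<oplus>\<^bsub>A\<^esub> \<ominus>\<^bsub>A\<^esub> a)" using that(1) ring_hom_add[OF \<pi>] by simp
      also have "\<dots> = \<zero>\<^bsub>G\<^esub>"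
        using that(1) ring_hom_zero[OF \<pi> N'.A.ring_axioms N.A.ring_axioms] by (simp add: N'.A.r_neg)
      finally have "\<iota> (\<pi> a) \<ominus>\<^bsub>A\<^esub> a \<in> I" using that(1) a' by (simp add: I)
      then have "(\<iota> (\<pi> a) \<ominus>\<^bsub>A\<^esub> a) \<odot>\<^bsub>Q k\<^esub> f k (h k x) \<in> multiples I (Q k)"
        using Qk.multiplesI[OF I_A _ fh_cl[OF that(2)]] by blast
      then show ?thesis
        using that a' fh_cl[OF that(2)] Qk.smult_closed Qk.smult_l_diff[OF a' that(1)] semilinear_smult[OF fh that]
        by (simp add: mcong_def)
    qed
    moreover have "mcong (Q k) (multiples I (Q k)) (f k (h k (x \<oplus>\<^bsub>Q k\<^esub> y))) (f k (h k x) \<oplus>\<^bsub>Q k\<^esub> f k (h k y))"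
      if "x \<in> carrier (Q k)" "y \<in> carrier (Q k)" for x y
      using semilinear_add[OF fh that] Qk.mcong_refl[OF submod_IQ] fh_cl that by simp
    ultimately show ?thesis using fh_cl by (simp add: semilinear_mod_def)
  qed
  have "\<exists>s p. s \<in> linear_maps A (Q i) (Q (Suc i)) \<and>
      (\<forall>x\<in>carrier (Q i). mcong (Q i) (multiples I (Q i)) (w i x) (d' i (s x) \<oplus>\<^bsub>Q i\<^esub> p x)) \<and>
      through_d A (\<lambda>a. a) Q d' Q i p"
  proof (rule homotopy_mod[OF resQ resQ id_ring_hom', where H = "\<lambda>k. multiples I (Q k)" and i = i])
    show "submod A (Q k) (multiples I (Q k))" for k by (rule submod_IQ)
    show "w k \<in> semilinear_mod A (\<lambda>a. a) (Q k) (Q k) (multiples I (Q k))" for k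
      unfolding w_def
      by (intro semilinear_mod_diff[OF modQ modQ] semilinear_imp_mod[OF modQ modQ] fh_mod id_semilinear submod_IQ)
    show "d' k x \<in> multiples I (Q k)" if "x \<in> multiples I (Q (Suc k))" for k x
      by (rule multiples_d[OF resQ I_A that])
    show "d' k (w (Suc k) x) = w k (d' k x)" if "x \<in> carrier (Q (Suc k))" for k x
      unfolding w_def
      using semilinear_diff[OF grpQ grpQ resolution_d[OF resQ] fh_cl[OF that] that] H.fd F.fd H.f_closed that
      by simp
    show "e' (w 0 x) = \<zero>\<^bsub>N'\<^esub>" if "x \<in> carrier (Q 0)" for x
      unfolding w_def
      using semilinear_diff[OF grpQ N'.M.abelian_group_axioms resolution_e[OF resQ] fh_cl[OF that] that]
        ef[OF H.f_closed[OF that]] eh[OF that] semilinear_closed[OF resolution_e[OF resQ] that]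
      by (simp add: N'.M.minus_self)
    \<comment> \<open>Exactness of Q modulo I in degree k uses acyclicity of I Q in degree k - 1, so
      degrees up to i require the assumption only below i.\<close>
    show "\<exists>z\<in>carrier (Q (Suc k)). mcong (Q k) (multiples I (Q k)) y (d' k z)"
      if "k \<le> i" "y \<in> carrier (Q k)" "case k of 0 \<Rightarrow> e' y = \<zero>\<^bsub>N'\<^esub> | Suc m \<Rightarrow> d' m y \<in> multiples I (Q m)" for k y
      by (rule exact_mod_multiples[OF resQ I_A I_annihilates _ submod_IQ that(2,3)]) (use acyc that(1) in auto)
  qed simp
  then obtain s' p' where s': "s' \<in> linear_maps A (Q i) (Q (Suc i))"
    and sp': "\<And>x. x \<in> carrier (Q i) \<Longrightarrow> mcong (Q i) (multiples I (Q i)) (w i x) (d' i (s' x) \<oplus>\<^bsub>Q i\<^esub> p' x)"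
    and p': "through_d A (\<lambda>a. a) Q d' Q i p'"
    by auto
  have p'_pure: "p' x \<in> carrier (Q i) \<and> TQ.pu i (p' x) = \<one>\<^bsub>tensor A N' (Q i)\<^esub>"
    if "x \<in> carrier (Q i)" "TQ.cyc i x" for x
    by (rule TQ.pure_through_d[OF that p'])
  \<comment> \<open>The preimage of y is h y. The difference of f (h y) and y consists of a
    boundary, a term through the differential that dies on cycles, and an element of I Q that
    tensors to zero.\<close>
  have surj: "\<exists>x\<in>carrier (P i). TP.cyc i x \<and>
      (\<exists>z\<in>carrier (Q (Suc i)). TQ.pu i (f i x) = TQ.pu i (d' i z) \<otimes>\<^bsub>tensor A N' (Q i)\<^esub> TQ.pu i y)"
    if y: "y \<in> carrier (Q i)" "TQ.cyc i y" for y
  proof -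
    have cyc: "TP.cyc i (h i y)"
    proof (cases i)
      case (Suc m)
      have "TQ.pu m (d' m y) = \<one>\<^bsub>tensor A N' (Q m)\<^esub>" "d' m y \<in> carrier (Q m)" "y \<in> carrier (Q (Suc m))"
        using y Suc TQ.d_closed by (simp_all add: TQ.cyc_def)
      then have "TP.pu m (h m (d' m y)) = \<one>\<^bsub>tensor G N (P m)\<^esub>"
        using tensor_morphism.pure_one_cong[OF H.morphism_f TQ.m0] by simp
      then show ?thesis using H.fd \<open>y \<in> carrier (Q (Suc m))\<close> Suc by (simp add: TP.cyc_def)
    qed (simp add: TP.cyc_def)
    have sy: "s' y \<in> carrier (Q (Suc i))" "d' i (s' y) \<in> carrier (Q i)"
      using semilinear_closed[OF s' y(1)] TQ.d_closed by auto
    let ?b = "d' i (s' y) \<oplus>\<^bsub>Q i\<^esub> p' y"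
    have b: "?b \<in> carrier (Q i)" "TQ.pu i ?b = TQ.pu i (d' i (s' y))"
      using sy p'_pure[OF y] tQ.pure_add_right[OF TQ.m0] tQ.pure_closed[OF TQ.m0] by simp_all
    have w: "w i y \<in> carrier (Q i)" "w i y \<ominus>\<^bsub>Q i\<^esub> ?b \<in> multiples I (Q i)"
      using sp'[OF y(1)] by (simp_all add: mcong_def)
    have "w i y = (w i y \<ominus>\<^bsub>Q i\<^esub> ?b) \<oplus>\<^bsub>Q i\<^esub> ?b"
      using Qi.M.minus_add_cancel[OF w(1) b(1)] by simp
    then have "TQ.pu i (w i y) = TQ.pu i (w i y \<ominus>\<^bsub>Q i\<^esub> ?b) \<otimes>\<^bsub>tensor A N' (Q i)\<^esub> TQ.pu i ?b"
      using tQ.pure_add_right[OF TQ.m0 Qi.M.minus_closed[OF w(1) b(1)] b(1)] by simp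
    then have "TQ.pu i (w i y) = TQ.pu i (d' i (s' y))"
      using pure_IQ[OF w(2)] b sy tQ.pure_closed[OF TQ.m0] by simp
    moreover have "f i (h i y) = w i y \<oplus>\<^bsub>Q i\<^esub> y"
      using Qi.M.minus_add_cancel[OF fh_cl[OF y(1)] y(1)] by (simp add: w_def)
    ultimately have "TQ.pu i (f i (h i y)) = TQ.pu i (d' i (s' y)) \<otimes>\<^bsub>tensor A N' (Q i)\<^esub> TQ.pu i y"
      using tQ.pure_add_right[OF TQ.m0 w(1) y(1)] by simp
    then show ?thesis using cyc sy H.f_closed[OF y(1)] by blast
  qed
  show ?thesis
    by (rule F.Tor_map_iso[OF refl inj surj])
qed

end

end

section \<open>Composition of Brauer diagrams\<close>

lemma nodes_iff: "x \<in> nodes n \<longleftrightarrow> x \<noteq> 0 \<and> \<bar>x\<bar> \<le> int n"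
  by (auto simp: nodes_def)

lemma finite_nodes: "finite (nodes n)"
  by (simp add: nodes_def)

lemma finite_diagrams: "finite (diagrams n)"
proof (rule finite_subset)
  show "diagrams n \<subseteq> Pow (Pow (nodes n))" by (auto simp: diagrams_def partition_on_def)
qed (simp add: finite_nodes)

context
  fixes n b assumes b: "b \<in> diagrams n"
begin

lemma diagram_arc:
  assumes "E \<in> b" obtains x y where "E = {x, y}" "x \<noteq> y" "x \<in> nodes n" "y \<in> nodes n"
proof -
  have "card E = 2" "E \<subseteq> nodes n" using assms b by (auto simp: diagrams_def partition_on_def)
  then show ?thesis using that by (auto simp: card_2_iff)
qed

lemma diagram_disjoint: "\<lbrakk>E \<in> b; F \<in> b; x \<in> E; x \<in> F\<rbrakk> \<Longrightarrow> E = F"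
  using b unfolding diagrams_def partition_on_def disjoint_def by blast

lemma diagram_nodes: "{x, y} \<in> b \<Longrightarrow> x \<in> nodes n \<and> y \<in> nodes n \<and> x \<noteq> y"
  by (erule diagram_arc) (auto simp: doubleton_eq_iff)

lemma diagram_partner: assumes "x \<in> nodes n" obtains y where "{x, y} \<in> b"
proof -
  obtain E where E: "E \<in> b" "x \<in> E" using b assms by (auto simp: diagrams_def partition_on_def)
  then obtain u v where "E = {u, v}" using diagram_arc by metis
  then show ?thesis using E that by (cases "x = u") (auto simp: insert_commute)
qed

lemma diagram_partner_unique: "\<lbrakk>{x, y} \<in> b; {x, z} \<in> b\<rbrakk> \<Longrightarrow> y = z"
  using diagram_disjoint[of "{x, y}" "{x, z}" x] diagram_nodes by (auto simp: doubleton_eq_iff)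

end

definition arc :: "int set set \<Rightarrow> int \<Rightarrow> int set" where
  "arc b x = (THE E. E \<in> b \<and> x \<in> E)"

lemma arc_eq: "\<lbrakk>b \<in> diagrams n; E \<in> b; x \<in> E\<rbrakk> \<Longrightarrow> arc b x = E"
  unfolding arc_def using diagram_disjoint by (intro the_equality) blast+

lemma arc_mem:
  assumes "b \<in> diagrams n" "x \<in> nodes n" shows "arc b x \<in> b \<and> x \<in> arc b x"
proof -
  obtain E where E: "E \<in> b" "x \<in> E" using assms by (auto simp: diagrams_def partition_on_def)
  then show ?thesis using arc_eq[OF assms(1) E] by simp
qed

lemma arc_doubleton:
  assumes "b \<in> diagrams n" "{x, y} \<in> b" shows "arc b x = {x, y}" "arc b y = {x, y}"
  using arc_eq[OF assms] by simp_all

text \<open>Perfect matchings are the same as fixed-point-free involutions. In this form partners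
  are values of a function, and membership of an arc becomes an equation.\<close>

lemma diagram_of_involution:
  assumes "\<And>x. x \<in> nodes n \<Longrightarrow> \<tau> x \<in> nodes n" "\<And>x. x \<in> nodes n \<Longrightarrow> \<tau> (\<tau> x) = x"
    "\<And>x. x \<in> nodes n \<Longrightarrow> \<tau> x \<noteq> x"
  shows "(\<lambda>x. {x, \<tau> x}) ` nodes n \<in> diagrams n"
    and "{x, y} \<in> (\<lambda>x. {x, \<tau> x}) ` nodes n \<longleftrightarrow> x \<in> nodes n \<and> y = \<tau> x"
proof -
  have "{x, \<tau> x} = {y, \<tau> y}" if "x \<in> nodes n" "y \<in> nodes n" "z \<in> {x, \<tau> x}" "z \<in> {y, \<tau> y}" for x y z
    using that assms(2) by (auto simp: doubleton_eq_iff) metis+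
  then have "disjoint ((\<lambda>x. {x, \<tau> x}) ` nodes n)" unfolding disjoint_def by blast
  moreover have "card {x, \<tau> x} = 2" if "x \<in> nodes n" for x
    using assms(3)[OF that] by (metis card_2_iff)
  ultimately show "(\<lambda>x. {x, \<tau> x}) ` nodes n \<in> diagrams n"
    using assms(1) by (auto simp: diagrams_def partition_on_def)
  show "{x, y} \<in> (\<lambda>x. {x, \<tau> x}) ` nodes n \<longleftrightarrow> x \<in> nodes n \<and> y = \<tau> x"
    using assms(1,2) by (auto simp: doubleton_eq_iff)
qed

section \<open>Gluing two diagrams: components, products and loops\<close>

lemma glued_sym:
  assumes "(u, v) \<in> glued b1 b2" shows "(v, u) \<in> glued b1 b2"
proof -
  consider x y where "{x, y} \<in> b1" "u = place1 x" "v = place1 y" | x y where "{x, y} \<in> b2" "u = place2 x" "v = place2 y"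
    using assms unfolding glued_def by blast
  then show ?thesis
  proof cases
    case 1
    then have "{y, x} \<in> b1" by (simp add: insert_commute)
    then show ?thesis using 1 unfolding glued_def by blast
  next
    case 2
    then have "{y, x} \<in> b2" by (simp add: insert_commute)
    then show ?thesis using 2 unfolding glued_def by blast
  qed
qed

lemma glued_rtrancl_sym: "(u, v) \<in> (glued b1 b2)\<^sup>* \<Longrightarrow> (v, u) \<in> (glued b1 b2)\<^sup>*"
  by (rule symD[OF sym_rtrancl[OF symI[OF glued_sym]]])

lemma glued1: "{x, y} \<in> b1 \<Longrightarrow> (place1 x, place1 y) \<in> (glued b1 b2)\<^sup>*"
  unfolding glued_def by blast

lemma glued2: "{x, y} \<in> b2 \<Longrightarrow> (place2 x, place2 y) \<in> (glued b1 b2)\<^sup>*"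
  unfolding glued_def by blast

text \<open>The connected components of the glued picture are recognised by a labelling of its vertices
  with the arcs of the expected product.\<close>

lemma diagram_comp_eqI:
  assumes b: "b \<in> diagrams n"
    and edge1: "\<And>x y. {x, y} \<in> b1 \<Longrightarrow> l (place1 x) = l (place1 y)"
    and edge2: "\<And>x y. {x, y} \<in> b2 \<Longrightarrow> l (place2 x) = l (place2 y)"
    and outer: "\<And>x. x \<in> nodes n \<Longrightarrow> l (place_outer x) = arc b x"
    and reach: "\<And>x y. {x, y} \<in> b \<Longrightarrow> (place_outer x, place_outer y) \<in> (glued b1 b2)\<^sup>*"
  shows "diagram_comp n b1 b2 = b"
proof -
  have inv: "l u = l v" if "(u, v) \<in> (glued b1 b2)\<^sup>*" for u v
    using that by (induction rule: rtrancl_induct) (use edge1 edge2 in \<open>auto simp: glued_def\<close>)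
  have "{x, y} \<in> b" if "x \<in> nodes n" "y \<in> nodes n" "x \<noteq> y" "(place_outer x, place_outer y) \<in> (glued b1 b2)\<^sup>*" for x y
  proof -
    have "arc b x = arc b y" using inv[OF that(4)] outer that(1,2) by simp
    then have E: "arc b x \<in> b" "x \<in> arc b x" "y \<in> arc b x" using arc_mem[OF b] that(1,2) by auto
    obtain u v where "arc b x = {u, v}" using diagram_arc[OF b E(1)] by metis
    then have "arc b x = {x, y}" using E(2,3) that(3) by auto
    then show ?thesis using E(1) by simp
  qed
  moreover have "\<exists>x y. E = {x, y} \<and> x \<in> nodes n \<and> y \<in> nodes n \<and> x \<noteq> y \<and> (place_outer x, place_outer y) \<in> (glued b1 b2)\<^sup>*"
    if "E \<in> b" for E
    using diagram_arc[OF b that] reach that by metis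
  ultimately show ?thesis unfolding diagram_comp_def by blast
qed

text \<open>A component that reaches the left or right column is not contained in the middle one, so
  it is not a closed loop.\<close>

lemma loops_eq_0I:
  assumes "\<And>j. j \<in> {1..int n} \<Longrightarrow> \<exists>x. ((1, j), place_outer x) \<in> (glued b1 b2)\<^sup>*"
  shows "loops n b1 b2 = 0"
proof -
  have "{C. \<exists>j\<in>{1..int n}. C = (glued b1 b2)\<^sup>* `` {(1, j)} \<and> C \<subseteq> {1} \<times> {1..int n}} = {}"
  proof -
    have "\<not> (glued b1 b2)\<^sup>* `` {(1, j)} \<subseteq> {1} \<times> {1..int n}" if "j \<in> {1..int n}" for j
      using assms[OF that] by (force simp: place_outer_def split: if_splits)
    then show ?thesis by blast
  qed
  then show ?thesis unfolding loops_def by (simp only: card.empty)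
qed

text \<open>Such an arc lies entirely in the left column of the glued picture, away from the
  vertices at which the diagrams are identified.\<close>

lemma left_arc_persists:
  assumes "{x, y} \<in> b1" "x < 0" "y < 0" "b1 \<in> diagrams n" shows "{x, y} \<in> diagram_comp n b1 b2"
proof -
  have "(place_outer x, place_outer y) \<in> (glued b1 b2)\<^sup>*"
    using glued1[OF assms(1)] assms(2,3) by (simp add: place1_def place_outer_def)
  then show ?thesis using diagram_nodes[OF assms(4,1)] unfolding diagram_comp_def by blast
qed

lemma right_arc_persists:
  assumes "{x, y} \<in> b2" "x > 0" "y > 0" "b2 \<in> diagrams n" shows "{x, y} \<in> diagram_comp n b1 b2"
proof -
  have "(place_outer x, place_outer y) \<in> (glued b1 b2)\<^sup>*"
    using glued2[OF assms(1), of b1] assms(2,3) by (simp add: place2_def place_outer_def)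
  then show ?thesis using diagram_nodes[OF assms(4,1)] unfolding diagram_comp_def by blast
qed

subsection \<open>Permutation diagrams\<close>

lemma perm_diagram_eq_involution:
  assumes "g permutes {1..n}"
  shows "perm_diagram n g = (\<lambda>x. {x, if x > 0 then - int (g (nat x)) else int (inv_into UNIV g (nat (- x)))}) ` nodes n"
    (is "_ = (\<lambda>x. {x, ?\<tau> x}) ` nodes n")
proof
  have "{- int (g i), int i} = {int i, ?\<tau> (int i)}" "int i \<in> nodes n" if "i \<in> {1..n}" for i
    using that by (auto simp: nodes_iff)
  then show "perm_diagram n g \<subseteq> (\<lambda>x. {x, ?\<tau> x}) ` nodes n"
    unfolding perm_diagram_def by blast
  show "(\<lambda>x. {x, ?\<tau> x}) ` nodes n \<subseteq> perm_diagram n g"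
  proof (intro subsetI, elim imageE)
    fix E x assume x: "E = {x, ?\<tau> x}" "x \<in> nodes n"
    show "E \<in> perm_diagram n g"
    proof (cases "x > 0")
      case True
      then have "E = {- int (g (nat x)), int (nat x)}" "nat x \<in> {1..n}" using x by (auto simp: nodes_iff)
      then show ?thesis unfolding perm_diagram_def by blast
    next
      case False
      let ?i = "inv_into UNIV g (nat (- x))"
      have "nat (- x) \<in> {1..n}" using x False by (auto simp: nodes_iff)
      then have i: "?i \<in> {1..n}" using assms permutes_in_image permutes_inv by metis
      have "g ?i = nat (- x)" using assms permutes_inverses(1) by metis
      then have "E = {- int (g ?i), int ?i}" using x False by auto
      then show ?thesis using i unfolding perm_diagram_def by blast
    qed
  qed
qed

lemma
  assumes "g permutes {1..n}"
  shows perm_diagram_in_diagrams: "perm_diagram n g \<in> diagrams n"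
    and perm_diagram_iff: "{x, y} \<in> perm_diagram n g \<longleftrightarrow>
      x \<in> nodes n \<and> y = (if x > 0 then - int (g (nat x)) else int (inv_into UNIV g (nat (- x))))"
proof -
  let ?\<tau> = "\<lambda>x. if x > 0 then - int (g (nat x)) else int (inv_into UNIV g (nat (- x)))"
  have g: "g i \<in> {1..n}" "inv_into UNIV g i \<in> {1..n}" if "i \<in> {1..n}" for i
    using that assms permutes_in_image permutes_inv by metis+
  have range: "?\<tau> x \<in> nodes n \<and> (?\<tau> x > 0 \<longleftrightarrow> x < 0)" if "x \<in> nodes n" for x
  proof (cases "x > 0")
    case True
    then have "nat x \<in> {1..n}" using that by (auto simp: nodes_iff)
    then show ?thesis using g(1)[of "nat x"] True by (auto simp: nodes_iff)
  next
    case False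
    then have "nat (- x) \<in> {1..n}" "x < 0" using that by (auto simp: nodes_iff)
    then show ?thesis using g(2)[of "nat (- x)"] False by (auto simp: nodes_iff)
  qed
  have invol: "?\<tau> (?\<tau> x) = x" if "x \<in> nodes n" for x
  proof (cases "x > 0")
    case True
    then show ?thesis using range[OF that] permutes_inverses(2)[OF assms] by simp
  next
    case False
    then show ?thesis using range[OF that] permutes_inverses(1)[OF assms] that by (auto simp: nodes_iff)
  qed
  have nofix: "?\<tau> x \<noteq> x" if "x \<in> nodes n" for x
  proof
    assume eq: "?\<tau> x = x"
    have "x > 0 \<longleftrightarrow> x < 0" using conjunct2[OF range[OF that]] unfolding eq .
    then show False using that by (auto simp: nodes_iff)
  qed
  note D = diagram_of_involution[of n ?\<tau>, OF _ invol nofix]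
  show "perm_diagram n g \<in> diagrams n"
    unfolding perm_diagram_eq_involution[OF assms] using range by (intro D(1)) auto
  show "{x, y} \<in> perm_diagram n g \<longleftrightarrow> x \<in> nodes n \<and> y = ?\<tau> x"
    unfolding perm_diagram_eq_involution[OF assms] using range by (intro D(2)) auto
qed

lemma perm_diagram_arcI: "i \<in> {1..n} \<Longrightarrow> {- int (g i), int i} \<in> perm_diagram n g"
  by (simp add: perm_diagram_def)

lemma perm_diagram_cases:
  assumes "{x, y} \<in> perm_diagram n g"
  obtains i where "i \<in> {1..n}" "x = - int (g i)" "y = int i" | i where "i \<in> {1..n}" "y = - int (g i)" "x = int i"
  using assms unfolding perm_diagram_def by (auto simp: doubleton_eq_iff)

lemma perm_diagram_no_side_arc:
  assumes "{x, y} \<in> perm_diagram n g" shows "\<not> (x < 0 \<and> y < 0)" "\<not> (x > 0 \<and> y > 0)"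
  using assms by (auto elim!: perm_diagram_cases)

lemma perm_diagram_inj: "inj_on (perm_diagram n) {g. g permutes {1..n}}"
proof (intro inj_onI ext)
  fix g h i assume g: "g \<in> {g. g permutes {1..n}}" and h: "h \<in> {g. g permutes {1..n}}"
    and eq: "perm_diagram n g = perm_diagram n h"
  show "g i = h i"
  proof (cases "i \<in> {1..n}")
    case True
    then have "{int i, - int (g i)} \<in> perm_diagram n h"
      using perm_diagram_arcI[OF True, of g] eq by (simp add: insert_commute)
    then show ?thesis using h True by (simp add: perm_diagram_iff)
  next
    case False
    then show ?thesis using g h by (simp add: permutes_not_in)
  qed
qed

text \<open>The line from right node i runs to the middle vertex k i and on to the left node - h (k
  i). Placing the image of a permutation on the left is what makes composition come out in this
  order.\<close>

lemma perm_diagram_comp: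
  assumes h: "h permutes {1..n}" and k: "k permutes {1..n}"
  shows "diagram_comp n (perm_diagram n h) (perm_diagram n k) = perm_diagram n (h \<circ> k)"
    and "loops n (perm_diagram n h) (perm_diagram n k) = 0"
proof -
  let ?b = "perm_diagram n (h \<circ> k)"
  let ?glued = "(glued (perm_diagram n h) (perm_diagram n k))\<^sup>*"
  have hk: "?b \<in> diagrams n" using perm_diagram_in_diagrams permutes_compose[OF k h] .
  have pos: "h i \<ge> 1" "k i \<ge> 1" "h i \<in> {1..n}" "k i \<in> {1..n}" if "i \<in> {1..n}" for i
    using that permutes_in_image[OF h] permutes_in_image[OF k] by fastforce+
  have left: "((0, int (h i)), (1, int i)) \<in> ?glued" if "i \<in> {1..n}" for i
    using glued1[OF perm_diagram_arcI[OF that], of h] pos[OF that] that by (simp add: place1_def)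
  have right: "((1, int (k i)), (2, int i)) \<in> ?glued" if "i \<in> {1..n}" for i
    using glued2[OF perm_diagram_arcI[OF that], of k] pos[OF that] that by (simp add: place2_def)
  have through: "((0, int (h (k i))), (2, int i)) \<in> ?glued" if "i \<in> {1..n}" for i
    using left[OF pos(4)[OF that]] right[OF that] by (rule rtrancl_trans)
  \<comment> \<open>The middle vertex j is joined to the left node - h j, and so it gets the label
    of that node's arc.\<close>
  define l where "l u = (case u of (c, j) \<Rightarrow> if c = (0::nat) then arc ?b (- j) else if c = 1 then arc ?b (- int (h (nat j)))
      else arc ?b j)" for u
  show "diagram_comp n (perm_diagram n h) (perm_diagram n k) = ?b"
  proof (rule diagram_comp_eqI[OF hk, where l = l])
    show "l (place1 x) = l (place1 y)" if "{x, y} \<in> perm_diagram n h" for x y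
      using that
    proof (cases rule: perm_diagram_cases)
      case (1 i)
      then show ?thesis using pos[OF 1(1)] by (simp add: l_def place1_def)
    next
      case (2 i)
      then show ?thesis using pos[OF 2(1)] by (simp add: l_def place1_def)
    qed
    have arc: "arc ?b (- int (h (k i))) = arc ?b (int i)" if "i \<in> {1..n}" for i
      using arc_doubleton[OF hk perm_diagram_arcI[OF that, of "h \<circ> k"]] by simp
    show "l (place2 x) = l (place2 y)" if "{x, y} \<in> perm_diagram n k" for x y
      using that
    proof (cases rule: perm_diagram_cases)
      case (1 i)
      then show ?thesis using pos[OF 1(1)] arc by (simp add: l_def place2_def)
    next
      case (2 i)
      then show ?thesis using pos[OF 2(1)] arc by (simp add: l_def place2_def)
    qed
    show "l (place_outer x) = arc ?b x" for x
      by (simp add: l_def place_outer_def)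
    show "(place_outer x, place_outer y) \<in> ?glued" if "{x, y} \<in> ?b" for x y
      using that
    proof (cases rule: perm_diagram_cases)
      case (1 i)
      then show ?thesis using pos(3)[OF pos(4)[OF 1(1)]] through by (simp add: place_outer_def)
    next
      case (2 i)
      then show ?thesis using pos(3)[OF pos(4)[OF 2(1)]] glued_rtrancl_sym[OF through] by (simp add: place_outer_def)
    qed
  qed
  show "loops n (perm_diagram n h) (perm_diagram n k) = 0"
  proof (rule loops_eq_0I)
    fix j assume "j \<in> {1..int n}"
    then have j: "nat j \<in> {1..n}" "int (nat j) = j" by auto
    have "((1, j), place_outer (- int (h (nat j)))) \<in> ?glued"
      using glued_rtrancl_sym[OF left[OF j(1)]] j(2) pos(1)[OF j(1)] by (simp add: place_outer_def)
    then show "\<exists>x. ((1, j), place_outer x) \<in> ?glued" by blast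
  qed
qed

text \<open>Every right node is matched with a left node. Distinct nodes have distinct partners, so
  an injection of a finite set into itself arises, that is, a permutation.\<close>

lemma diagram_without_right_arc:
  assumes b: "b \<in> diagrams n" and no_arc: "\<And>x y. \<lbrakk>x > 0; y > 0\<rbrakk> \<Longrightarrow> {x, y} \<notin> b"
  shows "b \<in> perm_diagram n ` {g. g permutes {1..n}}"
proof -
  have "\<exists>j\<in>{1..n}. {- int j, int i} \<in> b" if "i \<in> {1..n}" for i
  proof -
    have "int i \<in> nodes n" using that by (simp add: nodes_iff)
    then obtain y where y: "{int i, y} \<in> b" using diagram_partner[OF b] by blast
    then have "y \<in> nodes n" "\<not> y > 0" using diagram_nodes[OF b y] no_arc[of "int i" y] that by auto
    then have "nat (- y) \<in> {1..n}" "- int (nat (- y)) = y" by (auto simp: nodes_iff)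
    then show ?thesis using y by (metis insert_commute)
  qed
  then obtain g0 where g0: "\<And>i. i \<in> {1..n} \<Longrightarrow> g0 i \<in> {1..n} \<and> {- int (g0 i), int i} \<in> b" by metis
  define g where "g i = (if i \<in> {1..n} then g0 i else i)" for i
  have g: "g i \<in> {1..n}" "{- int (g i), int i} \<in> b" if "i \<in> {1..n}" for i
    using g0[OF that] that by (simp_all add: g_def)
  have inj: "inj_on g {1..n}"
  proof (rule inj_onI)
    fix i k assume ik: "i \<in> {1..n}" "k \<in> {1..n}" "g i = g k"
    have "{- int (g i), int i} \<in> b" "{- int (g i), int k} \<in> b"
      using g(2)[OF ik(1)] g(2)[OF ik(2)] ik(3) by simp_all
    from diagram_partner_unique[OF b this] show "i = k" by simp
  qed
  have "g ` {1..n} = {1..n}" using g(1) inj by (intro endo_inj_surj) auto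
  with inj have "bij_betw g {1..n} {1..n}" by (rule bij_betw_imageI)
  then have perm: "g permutes {1..n}" by (rule bij_imp_permutes) (auto simp: g_def)
  have sub: "perm_diagram n g \<subseteq> b" using g(2) by (auto simp: perm_diagram_def)
  have "b \<subseteq> perm_diagram n g"
  proof
    fix E assume E: "E \<in> b"
    then obtain x y where xy: "E = {x, y}" "x \<in> nodes n" using diagram_arc[OF b] by metis
    obtain z where "{x, z} \<in> perm_diagram n g"
      using diagram_partner[OF perm_diagram_in_diagrams[OF perm] xy(2)] .
    then show "E \<in> perm_diagram n g"
      using diagram_disjoint[OF b E, of "{x, z}" x] sub xy by auto
  qed
  then have "b = perm_diagram n g" using sub by blast
  then show ?thesis using perm by blast
qed

text \<open>If every left node is matched to the right, then by counting these partners exhaust the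
  right nodes, and none are left over for an arc on the right. This reduces the claim to the
  preceding one.\<close>

lemma diagram_without_left_arc:
  assumes b: "b \<in> diagrams n" and no_arc: "\<And>x y. \<lbrakk>x < 0; y < 0\<rbrakk> \<Longrightarrow> {x, y} \<notin> b"
  shows "b \<in> perm_diagram n ` {g. g permutes {1..n}}"
proof (rule diagram_without_right_arc[OF b])
  have "\<exists>j\<in>{1..n}. {- int i, int j} \<in> b" if "i \<in> {1..n}" for i
  proof -
    have "- int i \<in> nodes n" using that by (simp add: nodes_iff)
    then obtain y where y: "{- int i, y} \<in> b" using diagram_partner[OF b] by blast
    then have "y \<in> nodes n" "\<not> y < 0" using diagram_nodes[OF b y] no_arc[of "- int i" y] that by auto
    then have "nat y \<in> {1..n}" "int (nat y) = y" by (auto simp: nodes_iff)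
    then show ?thesis using y by metis
  qed
  then obtain g where g: "\<And>i. i \<in> {1..n} \<Longrightarrow> g i \<in> {1..n}" "\<And>i. i \<in> {1..n} \<Longrightarrow> {- int i, int (g i)} \<in> b"
    by metis
  have inj: "inj_on g {1..n}"
  proof (rule inj_onI)
    fix i k assume ik: "i \<in> {1..n}" "k \<in> {1..n}" "g i = g k"
    have "{int (g i), - int i} \<in> b" "{int (g i), - int k} \<in> b"
      using g(2)[OF ik(1)] g(2)[OF ik(2)] ik(3) by (simp_all add: insert_commute)
    from diagram_partner_unique[OF b this] show "i = k" by simp
  qed
  have "g ` {1..n} = {1..n}" using g(1) inj by (intro endo_inj_surj) auto
  fix x y :: int assume xy: "x > 0" "y > 0"
  show "{x, y} \<notin> b"
  proof
    assume arc: "{x, y} \<in> b"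
    then have "nat x \<in> {1..n}" using diagram_nodes[OF b arc] xy by (auto simp: nodes_iff)
    then obtain i where i: "i \<in> {1..n}" "nat x = g i" using \<open>g ` {1..n} = {1..n}\<close> by (metis imageE)
    then have "{x, - int i} \<in> b" using g(2)[OF i(1)] xy(1) by (simp add: insert_commute flip: i(2))
    from diagram_partner_unique[OF b arc this] show False using xy(2) by simp
  qed
qed

subsection \<open>Diagrams acting as the identity on diagrams with a given left arc\<close>

text \<open>In \<open>hook n p q v\<close>, the arcs \<open>{- p, - q}\<close>, \<open>{- v, p}\<close> and \<open>{q, v}\<close> replace three horizontal ones. If
  it is followed by a diagram that contains the arc \<open>{- p, - q}\<close>, then the zigzag through \<open>p\<close>, \<open>q\<close>
  and \<open>v\<close> straightens to a line from the left node \<open>- v\<close>.\<close>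

definition hook_partner :: "int \<Rightarrow> int \<Rightarrow> int \<Rightarrow> int \<Rightarrow> int" where
  "hook_partner p q v x =
    (if x = - p then - q else if x = - q then - p else if x = - v then p else if x = p then - v
     else if x = q then v else if x = v then q else - x)"

definition hook :: "nat \<Rightarrow> int \<Rightarrow> int \<Rightarrow> int \<Rightarrow> int set set" where
  "hook n p q v = (\<lambda>x. {x, hook_partner p q v x}) ` nodes n"

context
  fixes n :: nat and p q v :: int
  assumes pqv: "p \<in> {1..int n}" "q \<in> {1..int n}" "v \<in> {1..int n}" and distinct: "p \<noteq> q" "p \<noteq> v" "q \<noteq> v"
begin

lemma pos: "p > 0" "q > 0" "v > 0"
  using pqv by simp_all

lemma hook_partner_simps:
  "hook_partner p q v (- p) = - q" "hook_partner p q v (- q) = - p" "hook_partner p q v (- v) = p"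
  "hook_partner p q v p = - v" "hook_partner p q v q = v" "hook_partner p q v v = q"
  using pos distinct by (simp_all add: hook_partner_def)

lemma hook_partner_other:
  "x \<notin> {- p, - q, - v, p, q, v} \<Longrightarrow> hook_partner p q v x = - x"
  by (simp add: hook_partner_def)

lemma hook_nodes: "{- p, - q, - v, p, q, v} \<subseteq> nodes n"
  using pqv by (simp add: nodes_iff)

lemma hook_cases:
  obtains "x = - p" | "x = - q" | "x = - v" | "x = p" | "x = q" | "x = v" | "x \<notin> {- p, - q, - v, p, q, v}"
  by blast

lemma hook_diagram: "hook n p q v \<in> diagrams n"
  and hook_iff: "{x, y} \<in> hook n p q v \<longleftrightarrow> x \<in> nodes n \<and> y = hook_partner p q v x"
proof -
  have *: "hook_partner p q v x \<in> nodes n \<and> hook_partner p q v (hook_partner p q v x) = x \<and> hook_partner p q v x \<noteq> x"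
    if x: "x \<in> nodes n" for x
  proof (cases x rule: hook_cases)
    case 7
    then have "- x \<notin> {- p, - q, - v, p, q, v}" by auto
    then show ?thesis using x hook_partner_other[OF 7] hook_partner_other[of "- x"] by (simp add: nodes_iff)
  qed (use hook_nodes pos distinct in \<open>simp_all add: hook_partner_simps\<close>)
  show "hook n p q v \<in> diagrams n"
    unfolding hook_def by (rule diagram_of_involution(1)) (use * in auto)
  show "{x, y} \<in> hook n p q v \<longleftrightarrow> x \<in> nodes n \<and> y = hook_partner p q v x"
    unfolding hook_def by (rule diagram_of_involution(2)) (use * in auto)
qed

lemma hook_arcs:
  "{- p, - q} \<in> hook n p q v" "{- v, p} \<in> hook n p q v" "{q, v} \<in> hook n p q v"
  using hook_nodes by (simp_all add: hook_iff hook_partner_simps)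

lemma hook_straight_arc:
  assumes "j \<in> {1..int n}" "j \<noteq> p" "j \<noteq> q" "j \<noteq> v" shows "{- j, j} \<in> hook n p q v"
proof -
  have "- j \<in> nodes n" "- j \<notin> {- p, - q, - v, p, q, v}" using assms pos by (simp_all add: nodes_iff)
  then show ?thesis using hook_partner_other[of "- j"] by (simp add: hook_iff)
qed

lemma hook_comp_arc: "{- p, - q} \<in> diagram_comp n (hook n p q v) b"
  using left_arc_persists[OF hook_arcs(1) _ _ hook_diagram] pqv by simp

lemma hook_straight:
  assumes "j \<in> {1..int n}" "j \<noteq> p" "j \<noteq> q" "j \<noteq> v"
  shows "((0, j), (1, j)) \<in> (glued (hook n p q v) b)\<^sup>*"
  using glued1[OF hook_straight_arc[OF assms]] assms(1) by (simp add: place1_def)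

text \<open>Away from p, q and v the hook consists of straight lines, which extend the arc of b to
  the outer left column. Arcs collected by earlier hooks thus survive multiplication by a further
  one.\<close>

lemma hook_comp_other_arc:
  assumes b: "b \<in> diagrams n" "{x, y} \<in> b" and "x < 0" "y < 0"
    and "{x, y} \<inter> {- p, - q, - v} = {}"
  shows "{x, y} \<in> diagram_comp n (hook n p q v) b"
proof -
  let ?glued = "(glued (hook n p q v) b)\<^sup>*"
  have xy: "x \<in> nodes n" "y \<in> nodes n" "x \<noteq> y" using diagram_nodes[OF b] by auto
  have "((0, - z), (1, - z)) \<in> ?glued" if "z \<in> nodes n" "z < 0" "z \<notin> {- p, - q, - v}" for z
    by (rule hook_straight) (use that in \<open>auto simp: nodes_iff\<close>)
  from this[of x] this[of y] have "((0, - x), (1, - x)) \<in> ?glued" "((0, - y), (1, - y)) \<in> ?glued"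
    using xy(1,2) assms(3-5) by blast+
  moreover have "((1, - x), (1, - y)) \<in> ?glued"
    using glued2[OF b(2)] assms(3,4) by (simp add: place2_def)
  ultimately have "((0, - x), (0, - y)) \<in> ?glued"
    by (meson glued_rtrancl_sym rtrancl_trans)
  then show ?thesis
    using xy assms(3,4) unfolding diagram_comp_def by (fastforce simp: place_outer_def)
qed

text \<open>The diagram with arcs \<open>{- p, - q}\<close> and \<open>{p, q}\<close> would close a
  loop with b and produce a factor \<open>\<delta>\<close>. Diverting the line of a spare node v
  through p and q avoids the loop, so the coefficient is one whatever \<open>\<delta>\<close>
  is.\<close>

lemma hook_comp_fixed:
  assumes b: "b \<in> diagrams n" and pq: "{- p, - q} \<in> b"
  shows "diagram_comp n (hook n p q v) b = b" and "loops n (hook n p q v) b = 0"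
proof -
  let ?glued = "(glued (hook n p q v) b)\<^sup>*"
  have vp: "((0, v), (1, p)) \<in> ?glued"
    using glued1[OF hook_arcs(2)] pqv by (simp add: place1_def)
  have qv: "((1, q), (1, v)) \<in> ?glued"
    using glued1[OF hook_arcs(3)] pqv by (simp add: place1_def)
  have pq': "((1, p), (1, q)) \<in> ?glued"
    using glued2[OF pq] pqv by (simp add: place2_def)
  have vv: "((0, v), (1, v)) \<in> ?glued"
    using vp pq' qv by (meson rtrancl_trans)
  have to_place2: "(place_outer x, place2 x) \<in> ?glued" if "x \<in> nodes n" "x \<noteq> - p" "x \<noteq> - q" for x
  proof (cases "x > 0")
    case True
    then show ?thesis by (simp add: place_outer_def place2_def)
  next
    case False
    then have "- x \<in> {1..int n}" "x < 0" using that by (auto simp: nodes_iff)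
    then show ?thesis
      using hook_straight[of "- x"] vv that by (cases "x = - v") (auto simp: place_outer_def place2_def)
  qed
  have other: "x \<noteq> - p" "x \<noteq> - q" "y \<noteq> - p" "y \<noteq> - q" if "{x, y} \<in> b" "{x, y} \<noteq> {- p, - q}" for x y
    using diagram_disjoint[OF b that(1) pq] that(2) by blast+
  \<comment> \<open>The middle vertices p and q lie on the zigzag that starts at the left node - v,
    so they carry its label; any other middle vertex j carries the label of - j.\<close>
  define l where "l u = (case u of (c, j) \<Rightarrow> if c = (0::nat) then arc b (- j)
      else if c = 1 then (if j = p \<or> j = q then arc b (- v) else arc b (- j)) else arc b j)" for u
  show "diagram_comp n (hook n p q v) b = b"
  proof (rule diagram_comp_eqI[OF b, where l = l])
    show "l (place1 x) = l (place1 y)" if "{x, y} \<in> hook n p q v" for x y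
    proof -
      have y: "y = hook_partner p q v x" using that by (simp add: hook_iff)
      have arc: "arc b (- p) = arc b (- q)" using arc_doubleton[OF b pq] by simp
      show ?thesis
      proof (cases x rule: hook_cases)
        case 7
        then have "y = - x" using y hook_partner_other by simp
        then show ?thesis using 7 by (auto simp: l_def place1_def)
      qed (use y arc pos distinct in \<open>simp_all add: hook_partner_simps l_def place1_def\<close>)
    qed
    show "l (place2 x) = l (place2 y)" if xy: "{x, y} \<in> b" for x y
    proof (cases "{x, y} = {- p, - q}")
      case True
      then have "x \<in> {- p, - q}" "y \<in> {- p, - q}" by blast+
      then show ?thesis using pos by (auto simp: l_def place2_def)
    next
      case False
      then show ?thesis
        using other[OF xy False] arc_doubleton[OF b xy] diagram_nodes[OF b xy]
        by (auto simp: l_def place2_def)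
    qed
    show "l (place_outer x) = arc b x" for x
      by (simp add: l_def place_outer_def)
    show "(place_outer x, place_outer y) \<in> ?glued" if xy: "{x, y} \<in> b" for x y
    proof (cases "{x, y} = {- p, - q}")
      case True
      have outer_pq: "(place_outer (- p), place_outer (- q)) \<in> ?glued"
        using glued1[OF hook_arcs(1)] pqv by (simp add: place1_def place_outer_def)
      then show ?thesis using True outer_pq glued_rtrancl_sym[OF outer_pq] by (auto simp: doubleton_eq_iff)
    next
      case False
      have "(place_outer x, place2 x) \<in> ?glued" "(place_outer y, place2 y) \<in> ?glued"
        using to_place2 other[OF xy False] diagram_nodes[OF b xy] by auto
      then show ?thesis using glued2[OF xy] by (meson glued_rtrancl_sym rtrancl_trans)
    qed
  qed
  show "loops n (hook n p q v) b = 0"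
  proof (rule loops_eq_0I)
    fix j assume j: "j \<in> {1..int n}"
    have "((1, j), place_outer (if j = p \<or> j = q then - v else - j)) \<in> ?glued"
    proof -
      have "((0, j), (1, j)) \<in> ?glued" if "j \<noteq> p" "j \<noteq> q"
        using hook_straight[OF j that] vv by (cases "j = v") auto
      moreover have "((0, v), (1, q)) \<in> ?glued" using vp pq' by (rule rtrancl_trans)
      ultimately show ?thesis
        using vp j pqv glued_rtrancl_sym by (auto simp: place_outer_def)
    qed
    then show "\<exists>x. ((1, j), place_outer x) \<in> ?glued" by blast
  qed
qed

end

section \<open>Twisted algebras\<close>

lemma (in abelian_monoid) finsum_single:
  assumes "finite A" "i \<in> A" "f i \<in> carrier G" "\<And>j. \<lbrakk>j \<in> A; j \<noteq> i\<rbrakk> \<Longrightarrow> f j = \<zero>"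
  shows "finsum G f A = f i"
proof -
  have "f j \<in> carrier G" if "j \<in> A" for j using assms(3) assms(4)[of j] that by (cases "j = i") auto
  then have "finsum G f A = finsum G f {i}"
    using assms by (intro add.finprod_mono_neutral_cong_right) auto
  then show ?thesis using assms(3) by simp
qed

locale twisted = R: cring R for R (structure) +
  fixes B :: "'b set" and m c u
  assumes finite_B: "finite B" and c_closed: "c x y \<in> carrier R"
    and ring_twisted: "ring (twisted_algebra R B m c u)"
begin

abbreviation TA where "TA \<equiv> twisted_algebra R B m c u"

sublocale TA: ring TA by (rule ring_twisted)

lemma carrier_TA: "a \<in> carrier TA \<longleftrightarrow> a \<in> B \<rightarrow>\<^sub>E carrier R"
  by (simp add: twisted_algebra_def)

lemma coeff_closed [simp]: "\<lbrakk>a \<in> carrier TA; x \<in> B\<rbrakk> \<Longrightarrow> a x \<in> carrier R"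
  by (auto simp: carrier_TA)

lemma TA_ext: "\<lbrakk>a \<in> carrier TA; b \<in> carrier TA; \<And>x. x \<in> B \<Longrightarrow> a x = b x\<rbrakk> \<Longrightarrow> a = b"
  unfolding carrier_TA by (rule PiE_ext) auto

lemma mult_coeff:
  "z \<in> B \<Longrightarrow> (v \<otimes>\<^bsub>TA\<^esub> w) z = finsum R (\<lambda>(x, y). c x y \<otimes> (v x \<otimes> w y)) {(x, y) \<in> B \<times> B. m x y = z}"
  by (simp add: twisted_algebra_def)

lemma add_coeff: "z \<in> B \<Longrightarrow> (v \<oplus>\<^bsub>TA\<^esub> w) z = v z \<oplus> w z"
  by (simp add: twisted_algebra_def)

lemma zero_coeff: "z \<in> B \<Longrightarrow> \<zero>\<^bsub>TA\<^esub> z = \<zero>"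
  by (simp add: twisted_algebra_def)

lemma finite_pairs: "finite {(x, y) \<in> B \<times> B. m x y = z}"
  by (rule finite_subset[of _ "B \<times> B"]) (auto simp: finite_B)

definition basis :: "'b \<Rightarrow> 'b \<Rightarrow> 'a" where
  "basis b = (\<lambda>z\<in>B. if z = b then \<one> else \<zero>)"

definition spanned :: "'b set \<Rightarrow> ('b \<Rightarrow> 'a) set" where
  "spanned D = {a \<in> carrier TA. \<forall>b\<in>B - D. a b = \<zero>}"

lemma basis_closed: "basis b \<in> carrier TA"
  by (auto simp: basis_def carrier_TA)

lemma spanned_closed: "spanned D \<subseteq> carrier TA"
  by (auto simp: spanned_def)

lemma spanned_B: "spanned B = carrier TA"
  by (auto simp: spanned_def)

lemma zero_spanned: "\<zero>\<^bsub>TA\<^esub> \<in> spanned D"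
  by (simp add: spanned_def zero_coeff)

lemma spanned_empty: "spanned {} = {\<zero>\<^bsub>TA\<^esub>}"
  using zero_spanned by (auto simp: spanned_def zero_coeff intro!: TA_ext)

lemma spanned_mono: "D \<subseteq> D' \<Longrightarrow> spanned D \<subseteq> spanned D'"
  by (auto simp: spanned_def)

lemma spanned_Int: "spanned D \<inter> spanned D' = spanned (D \<inter> D')"
  by (auto simp: spanned_def)

lemma spanned_Un:
  assumes a: "a \<in> spanned (D \<union> D')" shows "\<exists>x\<in>spanned D. \<exists>y\<in>spanned D'. a = x \<oplus>\<^bsub>TA\<^esub> y"
proof -
  let ?x = "\<lambda>z\<in>B. if z \<in> D then a z else \<zero>" and ?y = "\<lambda>z\<in>B. if z \<in> D then \<zero> else a z"
  have aB: "a \<in> carrier TA" "\<And>z. z \<in> B \<Longrightarrow> a z \<in> carrier R" using a by (auto simp: spanned_def)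
  have xy: "?x \<in> carrier TA" "?y \<in> carrier TA" using aB(2) by (auto simp: carrier_TA)
  then have "?x \<in> spanned D" "?y \<in> spanned D'" using a by (auto simp: spanned_def)
  moreover have "a = ?x \<oplus>\<^bsub>TA\<^esub> ?y"
    using aB xy by (intro TA_ext) (auto simp: add_coeff)
  ultimately show ?thesis by blast
qed

text \<open>Pairs whose product falls outside B enter no coefficient, which is why D has to be
  closed only under products in B.\<close>

lemma spanned_right_ideal:
  assumes "\<And>x y. \<lbrakk>x \<in> D; x \<in> B; y \<in> B; m x y \<in> B\<rbrakk> \<Longrightarrow> m x y \<in> D"
  shows "right_ideal TA (spanned D)"
  unfolding right_ideal_def
proof (intro conjI ballI spanned_closed zero_spanned)
  show "v \<oplus>\<^bsub>TA\<^esub> w \<in> spanned D" if "v \<in> spanned D" "w \<in> spanned D" for v w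
    using that by (simp add: spanned_def add_coeff)
  show "v \<otimes>\<^bsub>TA\<^esub> a \<in> spanned D" if v: "v \<in> spanned D" and a: "a \<in> carrier TA" for v a
  proof -
    have "(v \<otimes>\<^bsub>TA\<^esub> a) z = \<zero>" if z: "z \<in> B - D" for z
    proof -
      have "c x y \<otimes> (v x \<otimes> a y) = \<zero>" if xy: "x \<in> B" "y \<in> B" "m x y = z" for x y
      proof -
        have "v x = \<zero>" using xy z v assms[of x y] by (auto simp: spanned_def)
        then show ?thesis using xy a c_closed by simp
      qed
      then show ?thesis using z by (subst mult_coeff) (auto intro!: R.add.finprod_one_eqI)
    qed
    then show ?thesis using v a by (simp add: spanned_def)
  qed
qed

lemma basis_mult_spanned:
  assumes D: "\<And>y. \<lbrakk>y \<in> D; y \<in> B; m b y \<in> B\<rbrakk> \<Longrightarrow> m b y \<in> D'" and w: "w \<in> spanned D"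
  shows "basis b \<otimes>\<^bsub>TA\<^esub> w \<in> spanned D'"
proof -
  have "(basis b \<otimes>\<^bsub>TA\<^esub> w) z = \<zero>" if z: "z \<in> B - D'" for z
  proof -
    have "c x y \<otimes> (basis b x \<otimes> w y) = \<zero>" if xy: "x \<in> B" "y \<in> B" "m x y = z" for x y
    proof (cases "x = b \<and> y \<in> D")
      case True
      then show ?thesis using D[of y] xy z by simp
    next
      case False
      then have "basis b x = \<zero> \<or> w y = \<zero>" using w xy by (auto simp: basis_def spanned_def)
      then show ?thesis using c_closed xy w spanned_closed basis_closed[of b] by (auto simp: subset_iff)
    qed
    then show ?thesis using z by (subst mult_coeff) (auto intro!: R.add.finprod_one_eqI)
  qed
  then show ?thesis using w basis_closed spanned_closed by (auto simp: spanned_def)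
qed

lemma basis_mult_fixed:
  assumes b: "b \<in> B" and D: "\<And>y. y \<in> D \<Longrightarrow> y \<in> B \<Longrightarrow> m b y = y \<and> c b y = \<one>" and w: "w \<in> spanned D"
  shows "basis b \<otimes>\<^bsub>TA\<^esub> w = w"
proof (rule TA_ext)
  have wA: "w \<in> carrier TA" using w spanned_closed by blast
  show "basis b \<otimes>\<^bsub>TA\<^esub> w \<in> carrier TA" "w \<in> carrier TA" using wA basis_closed by auto
  fix z assume z: "z \<in> B"
  let ?f = "\<lambda>(x, y). c x y \<otimes> (basis b x \<otimes> w y)" and ?I = "{(x, y) \<in> B \<times> B. m x y = z}"
  have zero: "?f (x, y) = \<zero>" if "x \<in> B" "y \<in> B" "x \<noteq> b \<or> y \<notin> D" for x y
  proof -
    have "basis b x = \<zero> \<or> w y = \<zero>" using that w by (auto simp: basis_def spanned_def)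
    then show ?thesis using that c_closed wA basis_closed[of b] by auto
  qed
  show "(basis b \<otimes>\<^bsub>TA\<^esub> w) z = w z"
  proof (cases "z \<in> D")
    case True
    have fbz: "?f (b, z) = w z" using True z D b wA by (simp add: basis_def)
    have "finsum R ?f ?I = ?f (b, z)"
    proof (rule R.finsum_single[OF finite_pairs])
      show "(b, z) \<in> ?I" using True z b D by simp
      show "?f (b, z) \<in> carrier R" using fbz z wA by simp
      fix p assume p: "p \<in> ?I" "p \<noteq> (b, z)"
      then obtain x y where xy: "p = (x, y)" "x \<in> B" "y \<in> B" "m x y = z" by blast
      then have "x \<noteq> b \<or> y \<notin> D" using p(2) D[of y] by auto
      then show "?f p = \<zero>" using zero xy by blast
    qed
    then show ?thesis using fbz z by (simp add: mult_coeff)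
  next
    case False
    have "?f p = \<zero>" if p: "p \<in> ?I" for p
    proof -
      obtain x y where xy: "p = (x, y)" "x \<in> B" "y \<in> B" "m x y = z" using p by blast
      then have "x \<noteq> b \<or> y \<notin> D" using False D[of y] by auto
      then show ?thesis using zero xy by blast
    qed
    then have "finsum R ?f ?I = \<zero>" by (rule R.add.finprod_one_eqI)
    moreover have "w z = \<zero>" using False z w by (simp add: spanned_def)
    ultimately show ?thesis using z by (simp add: mult_coeff)
  qed
qed

end

section \<open>The Brauer algebra and the symmetric group\<close>

locale brauer = R: cring R for R (structure) +
  fixes \<delta> and n :: nat
  assumes \<delta>: "\<delta> \<in> carrier R" and ring_brauer: "ring (brauer_algebra R \<delta> n)"
begin

abbreviation "Br \<equiv> brauer_algebra R \<delta> n"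
abbreviation "RS \<equiv> group_ring R (sym_group n)"
abbreviation "Sn \<equiv> carrier (sym_group n)"
abbreviation "perms \<equiv> perm_diagram n ` Sn"

sublocale twisted R "diagrams n" "diagram_comp n" "\<lambda>b1 b2. \<delta> [^]\<^bsub>R\<^esub> loops n b1 b2" "perm_diagram n id"
  using \<delta> ring_brauer
  by (intro twisted.intro twisted_axioms.intro R.is_cring) (simp_all add: finite_diagrams brauer_algebra_def)

lemma Br_eq: "Br = TA"
  by (simp add: brauer_algebra_def)

lemma Sn_eq: "Sn = {g. g permutes {1..n}}"
  by (auto simp: sym_group_carrier)

lemma perm_inj: "inj_on (perm_diagram n) Sn"
  using perm_diagram_inj by (simp add: Sn_eq)

lemma perms_diagrams: "perms \<subseteq> diagrams n"
  using perm_diagram_in_diagrams by (auto simp: sym_group_carrier)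

lemma finite_Sn: "finite Sn"
  by (simp add: Sn_eq finite_permutations)

text \<open>A left arc of the first factor or a right arc of the second survives in the product, and
  a permutation diagram has neither. Hence the diagrams that are not permutations span a two-sided
  ideal.\<close>

lemma comp_perm_factors:
  assumes "x \<in> diagrams n" "y \<in> diagrams n" "diagram_comp n x y \<in> perms"
  shows "x \<in> perms" "y \<in> perms"
proof -
  obtain g where g: "diagram_comp n x y = perm_diagram n g" using assms(3) by blast
  show "x \<in> perms"
    unfolding Sn_eq
    by (rule diagram_without_left_arc[OF assms(1)])
       (use left_arc_persists[OF _ _ _ assms(1)] perm_diagram_no_side_arc(1) g in metis)
  show "y \<in> perms"
    unfolding Sn_eq
    by (rule diagram_without_right_arc[OF assms(2)])
       (use right_arc_persists[OF _ _ _ assms(2)] perm_diagram_no_side_arc(2) g in metis)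
qed

text \<open>In coordinates, the quotient map by the ideal spanned by the diagrams that are not
  permutations.\<close>

definition proj :: "(int set set \<Rightarrow> 'a) \<Rightarrow> (nat \<Rightarrow> nat) \<Rightarrow> 'a" where
  "proj v = (\<lambda>g\<in>Sn. v (perm_diagram n g))"

lemma RS_carrier: "v \<in> carrier RS \<longleftrightarrow> v \<in> Sn \<rightarrow>\<^sub>E carrier R"
  by (simp add: group_ring_def twisted_algebra_def)

lemma RS_mult: "g \<in> Sn \<Longrightarrow> (v \<otimes>\<^bsub>RS\<^esub> w) g = finsum R (\<lambda>(h, k). \<one> \<otimes> (v h \<otimes> w k)) {(h, k) \<in> Sn \<times> Sn. h \<circ> k = g}"
  by (simp add: group_ring_def twisted_algebra_def sym_group_mult)

text \<open>A coefficient at a permutation diagram receives contributions only from pairs of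
  permutation diagrams. These form no loops, so the powers of \<open>\<delta>\<close> are one and
  the convolution of the group ring remains.\<close>

lemma proj_mult:
  assumes v: "v \<in> carrier TA" and w: "w \<in> carrier TA" and g: "g \<in> Sn"
  shows "(v \<otimes>\<^bsub>TA\<^esub> w) (perm_diagram n g) = (proj v \<otimes>\<^bsub>RS\<^esub> proj w) g"
proof -
  let ?f = "\<lambda>(x, y). \<delta> [^] loops n x y \<otimes> (v x \<otimes> w y)"
  let ?I = "{(h, k) \<in> Sn \<times> Sn. h \<circ> k = g}" and ?p = "\<lambda>(h, k). (perm_diagram n h, perm_diagram n k)"
  have comp: "diagram_comp n (perm_diagram n h) (perm_diagram n k) = perm_diagram n (h \<circ> k)"
      "loops n (perm_diagram n h) (perm_diagram n k) = 0" "h \<circ> k \<in> Sn" if "h \<in> Sn" "k \<in> Sn" for h k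
    using perm_diagram_comp that permutes_compose by (auto simp: Sn_eq)
  have "{(x, y) \<in> diagrams n \<times> diagrams n. diagram_comp n x y = perm_diagram n g} = ?p ` ?I"
  proof (intro equalityI subsetI)
    fix p assume "p \<in> {(x, y) \<in> diagrams n \<times> diagrams n. diagram_comp n x y = perm_diagram n g}"
    then obtain x y where xy: "p = (x, y)" "x \<in> diagrams n" "y \<in> diagrams n" "diagram_comp n x y = perm_diagram n g"
      by blast
    then obtain h k where hk: "h \<in> Sn" "k \<in> Sn" "x = perm_diagram n h" "y = perm_diagram n k"
      using comp_perm_factors[of x y] g by auto
    then have "h \<circ> k = g"
      using xy(4) comp inj_onD[OF perm_inj] g by simp
    then show "p \<in> ?p ` ?I" using hk xy(1) by force
  next
    fix p assume "p \<in> ?p ` ?I"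
    then show "p \<in> {(x, y) \<in> diagrams n \<times> diagrams n. diagram_comp n x y = perm_diagram n g}"
      using comp perms_diagrams by auto
  qed
  then have "(v \<otimes>\<^bsub>TA\<^esub> w) (perm_diagram n g) = finsum R ?f (?p ` ?I)"
    using g perms_diagrams by (subst mult_coeff) auto
  also have "\<dots> = finsum R (\<lambda>q. ?f (?p q)) ?I"
  proof (rule R.finsum_reindex)
    show "?f \<in> ?p ` ?I \<rightarrow> carrier R"
      using v w perms_diagrams \<delta> by (auto simp: subset_iff)
    show "inj_on ?p ?I"
      using perm_inj by (auto simp: inj_on_def)
  qed
  also have "\<dots> = (proj v \<otimes>\<^bsub>RS\<^esub> proj w) g"
    unfolding RS_mult[OF g]
    using v w perms_diagrams comp by (intro R.finsum_cong') (auto simp: proj_def subset_iff)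
  finally show ?thesis .
qed

lemma RS_add: "g \<in> Sn \<Longrightarrow> (v \<oplus>\<^bsub>RS\<^esub> w) g = v g \<oplus> w g"
  by (simp add: group_ring_def twisted_algebra_def)

lemma RS_one: "g \<in> Sn \<Longrightarrow> \<one>\<^bsub>RS\<^esub> g = (if g = id then \<one> else \<zero>)"
  by (simp add: group_ring_def twisted_algebra_def sym_group_one)

lemma TA_one: "b \<in> diagrams n \<Longrightarrow> \<one>\<^bsub>TA\<^esub> b = (if b = perm_diagram n id then \<one> else \<zero>)"
  by (simp add: twisted_algebra_def)

lemma RS_extensional:
  "v \<otimes>\<^bsub>RS\<^esub> w \<in> extensional Sn" "v \<oplus>\<^bsub>RS\<^esub> w \<in> extensional Sn" "\<one>\<^bsub>RS\<^esub> \<in> extensional Sn"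
  by (simp_all add: group_ring_def twisted_algebra_def)

lemma proj_extensional: "proj v \<in> extensional Sn"
  by (simp add: proj_def)

lemma id_Sn: "id \<in> Sn"
  by (simp add: sym_group_carrier permutes_id)

lemma proj_closed: "v \<in> carrier TA \<Longrightarrow> proj v \<in> carrier RS"
  using perms_diagrams by (auto simp: RS_carrier proj_def subset_iff)

lemma proj_hom: "proj \<in> ring_hom TA RS"
proof (rule ring_hom_memI)
  fix v w assume vw: "v \<in> carrier TA" "w \<in> carrier TA"
  show "proj v \<in> carrier RS" using vw(1) by (rule proj_closed)
  show "proj (v \<otimes>\<^bsub>TA\<^esub> w) = proj v \<otimes>\<^bsub>RS\<^esub> proj w"
    by (rule extensionalityI[OF proj_extensional RS_extensional(1)])
       (simp add: proj_def[of "v \<otimes>\<^bsub>TA\<^esub> w"] proj_mult[OF vw])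
  show "proj (v \<oplus>\<^bsub>TA\<^esub> w) = proj v \<oplus>\<^bsub>RS\<^esub> proj w"
    using perms_diagrams
    by (intro extensionalityI[OF proj_extensional RS_extensional(2)])
       (auto simp: proj_def RS_add add_coeff subset_iff)
next
  have "perm_diagram n g \<in> diagrams n" "perm_diagram n g = perm_diagram n id \<longleftrightarrow> g = id" if "g \<in> Sn" for g
    using that perms_diagrams inj_onD[OF perm_inj _ that id_Sn] by auto
  then show "proj \<one>\<^bsub>TA\<^esub> = \<one>\<^bsub>RS\<^esub>"
    by (intro extensionalityI[OF proj_extensional RS_extensional(3)])
       (simp add: proj_def RS_one TA_one)
qed

lemma incl_perm: "\<lbrakk>v \<in> carrier RS; g \<in> Sn\<rbrakk> \<Longrightarrow> brauer_incl R n v (perm_diagram n g) = v g"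
proof -
  assume v: "v \<in> carrier RS" and g: "g \<in> Sn"
  then have "{h \<in> Sn. perm_diagram n h = perm_diagram n g} = {g}" using inj_onD[OF perm_inj] by auto
  moreover have "v g \<in> carrier R" using v g by (auto simp: RS_carrier)
  ultimately show ?thesis using g perms_diagrams by (auto simp: brauer_incl_def)
qed

lemma incl_nonperm: "\<lbrakk>b \<in> diagrams n; b \<notin> perms\<rbrakk> \<Longrightarrow> brauer_incl R n v b = \<zero>"
proof -
  assume b: "b \<in> diagrams n" "b \<notin> perms"
  then have "{h \<in> Sn. perm_diagram n h = b} = {}" by auto
  then show ?thesis using b(1) unfolding brauer_incl_def by (simp only: restrict_apply' R.finsum_empty)
qed

lemma incl_closed: "v \<in> carrier RS \<Longrightarrow> brauer_incl R n v \<in> carrier TA"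
  unfolding carrier_TA
proof (rule PiE_I)
  fix b assume v: "v \<in> carrier RS" and b: "b \<in> diagrams n"
  show "brauer_incl R n v b \<in> carrier R"
  proof (cases "b \<in> perms")
    case True
    then obtain g where "g \<in> Sn" "b = perm_diagram n g" by blast
    then show ?thesis using v by (auto simp: incl_perm RS_carrier)
  qed (simp add: incl_nonperm b)
qed (simp add: brauer_incl_def)

lemma proj_incl: "v \<in> carrier RS \<Longrightarrow> proj (brauer_incl R n v) = v"
  by (rule PiE_ext[where k = Sn and s = "\<lambda>_. carrier R"])
     (use proj_closed[OF incl_closed] in \<open>auto simp: proj_def incl_perm RS_carrier\<close>)

text \<open>Closure is transported from the Brauer algebra: the product is the projection of a
  product of included elements.\<close>

lemma RS_mult_closed:
  assumes "v \<in> carrier RS" "w \<in> carrier RS" shows "v \<otimes>\<^bsub>RS\<^esub> w \<in> carrier RS"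
  using proj_closed[OF TA.m_closed[OF incl_closed[OF assms(1)] incl_closed[OF assms(2)]]]
    ring_hom_mult[OF proj_hom incl_closed[OF assms(1)] incl_closed[OF assms(2)]] proj_incl assms by simp

lemma RS_add_closed:
  assumes "v \<in> carrier RS" "w \<in> carrier RS" shows "v \<oplus>\<^bsub>RS\<^esub> w \<in> carrier RS"
  using proj_closed[OF TA.a_closed[OF incl_closed[OF assms(1)] incl_closed[OF assms(2)]]]
    ring_hom_add[OF proj_hom incl_closed[OF assms(1)] incl_closed[OF assms(2)]] proj_incl assms by simp

lemma TA_eq_if_proj_eq:
  assumes "a \<in> carrier TA" "b \<in> carrier TA" "proj a = proj b"
    and "\<And>x. \<lbrakk>x \<in> diagrams n; x \<notin> perms\<rbrakk> \<Longrightarrow> a x = b x"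
  shows "a = b"
proof (rule TA_ext[OF assms(1,2)])
  fix x assume x: "x \<in> diagrams n"
  show "a x = b x"
  proof (cases "x \<in> perms")
    case True
    then obtain g where g: "g \<in> Sn" "x = perm_diagram n g" by blast
    then show ?thesis using fun_cong[OF assms(3), of g] by (simp add: proj_def)
  qed (use assms(4) x in blast)
qed

text \<open>On permutation diagrams the claim follows by applying \<open>proj\<close>. On the others
  both sides vanish, as permutation diagrams compose to permutation diagrams.\<close>

lemma incl_hom: "brauer_incl R n \<in> ring_hom RS TA"
proof (rule ring_hom_memI)
  fix v w assume vw: "v \<in> carrier RS" "w \<in> carrier RS"
  let ?v = "brauer_incl R n v" and ?w = "brauer_incl R n w"
  have cl: "?v \<in> carrier TA" "?w \<in> carrier TA" using vw incl_closed by auto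
  show "?v \<in> carrier TA" by (rule cl)
  show "brauer_incl R n (v \<otimes>\<^bsub>RS\<^esub> w) = ?v \<otimes>\<^bsub>TA\<^esub> ?w"
  proof (rule TA_eq_if_proj_eq[OF incl_closed[OF RS_mult_closed[OF vw]] TA.m_closed[OF cl]])
    show "proj (brauer_incl R n (v \<otimes>\<^bsub>RS\<^esub> w)) = proj (?v \<otimes>\<^bsub>TA\<^esub> ?w)"
      using proj_incl[OF RS_mult_closed[OF vw]] ring_hom_mult[OF proj_hom cl] proj_incl vw by simp
    fix z assume z: "z \<in> diagrams n" "z \<notin> perms"
    have "\<delta> [^] loops n x y \<otimes> (?v x \<otimes> ?w y) = \<zero>"
      if xy: "x \<in> diagrams n" "y \<in> diagrams n" "diagram_comp n x y = z" for x y
    proof -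
      have "\<not> (x \<in> perms \<and> y \<in> perms)"
      proof
        assume "x \<in> perms \<and> y \<in> perms"
        then obtain h k where "h \<in> Sn" "k \<in> Sn" "x = perm_diagram n h" "y = perm_diagram n k" by blast
        then have "z = perm_diagram n (h \<circ> k)" "h \<circ> k \<in> Sn"
          using perm_diagram_comp(1)[of h n k] xy(3) permutes_compose[of k _ h] by (auto simp: Sn_eq)
        then show False using z(2) by blast
      qed
      then have "?v x = \<zero> \<or> ?w y = \<zero>" using incl_nonperm xy by auto
      then show ?thesis using xy cl \<delta> by auto
    qed
    then have "(?v \<otimes>\<^bsub>TA\<^esub> ?w) z = \<zero>"
      using z by (subst mult_coeff) (auto intro!: R.add.finprod_one_eqI)
    then show "brauer_incl R n (v \<otimes>\<^bsub>RS\<^esub> w) z = (?v \<otimes>\<^bsub>TA\<^esub> ?w) z"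
      using incl_nonperm z by simp
  qed
  show "brauer_incl R n (v \<oplus>\<^bsub>RS\<^esub> w) = ?v \<oplus>\<^bsub>TA\<^esub> ?w"
  proof (rule TA_eq_if_proj_eq[OF incl_closed[OF RS_add_closed[OF vw]] TA.a_closed[OF cl]])
    show "proj (brauer_incl R n (v \<oplus>\<^bsub>RS\<^esub> w)) = proj (?v \<oplus>\<^bsub>TA\<^esub> ?w)"
      using proj_incl[OF RS_add_closed[OF vw]] ring_hom_add[OF proj_hom cl] proj_incl vw by simp
  qed (simp add: incl_nonperm add_coeff)
next
  have one: "\<one>\<^bsub>RS\<^esub> \<in> carrier RS"
    using proj_closed[OF TA.one_closed] ring_hom_one[OF proj_hom] by simp
  show "brauer_incl R n \<one>\<^bsub>RS\<^esub> = \<one>\<^bsub>TA\<^esub>"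
  proof (rule TA_eq_if_proj_eq[OF incl_closed[OF one] TA.one_closed])
    show "proj (brauer_incl R n \<one>\<^bsub>RS\<^esub>) = proj \<one>\<^bsub>TA\<^esub>"
      using proj_incl[OF one] ring_hom_one[OF proj_hom] by simp
  qed (use id_Sn in \<open>auto simp: incl_nonperm TA_one\<close>)
qed

lemma kernel_proj: "{a \<in> carrier TA. proj a = \<zero>\<^bsub>RS\<^esub>} = spanned (diagrams n - perms)"
proof -
  have z: "\<zero>\<^bsub>RS\<^esub> = (\<lambda>g\<in>Sn. \<zero>)" by (simp add: group_ring_def twisted_algebra_def)
  have "proj a = \<zero>\<^bsub>RS\<^esub> \<longleftrightarrow> (\<forall>g\<in>Sn. a (perm_diagram n g) = \<zero>)" for a
    unfolding proj_def z restrict_def fun_eq_iff by (simp add: Ball_def)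
  then show ?thesis using perms_diagrams by (auto simp: spanned_def)
qed

end

section \<open>Ideals of diagrams with prescribed left arcs\<close>

definition left_arcs :: "nat \<Rightarrow> int set set" where
  "left_arcs n = {{x, y} | x y. x \<in> {- int n..-1} \<and> y \<in> {- int n..-1} \<and> x \<noteq> y}"

definition containing :: "nat \<Rightarrow> int set set \<Rightarrow> int set set set" where
  "containing n S = {b \<in> diagrams n. S \<subseteq> b}"

text \<open>The basis of the intersection of J_S with the sum of the J_t for t in T. The parameter S
  makes the family closed under the intersections that Mayer-Vietoris produces; S empty and T all
  left arcs give the ideal I.\<close>

definition containing_some :: "nat \<Rightarrow> int set set \<Rightarrow> int set set \<Rightarrow> int set set set" where
  "containing_some n S T = {b \<in> diagrams n. S \<subseteq> b \<and> T \<inter> b \<noteq> {}}"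

lemma left_arcs_cases:
  assumes "t \<in> left_arcs n"
  obtains p q where "t = {- p, - q}" "p \<in> {1..int n}" "q \<in> {1..int n}" "p \<noteq> q"
proof -
  obtain x y where "t = {x, y}" "x \<in> {- int n..-1}" "y \<in> {- int n..-1}" "x \<noteq> y"
    using assms by (auto simp: left_arcs_def)
  then show ?thesis using that[of "- x" "- y"] by auto
qed

lemma left_arc_comp:
  assumes "t \<in> left_arcs n" "t \<in> b1" "b1 \<in> diagrams n" shows "t \<in> diagram_comp n b1 b2"
  using assms(1)
proof (cases rule: left_arcs_cases)
  case (1 p q)
  then show ?thesis using left_arc_persists[of "- p" "- q" b1 n b2] assms(2,3) by simp
qed

context brauer
begin

lemma containing_right_ideal: "S \<subseteq> left_arcs n \<Longrightarrow> right_ideal TA (spanned (containing n S))"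
  by (rule spanned_right_ideal) (use left_arc_comp in \<open>auto simp: containing_def subset_iff\<close>)

lemma containing_some_right_ideal:
  assumes "S \<subseteq> left_arcs n" "T \<subseteq> left_arcs n" shows "right_ideal TA (spanned (containing_some n S T))"
proof (rule spanned_right_ideal)
  fix x y assume x: "x \<in> containing_some n S T" and xy: "diagram_comp n x y \<in> diagrams n"
  obtain t where t: "t \<in> T" "t \<in> x" using x by (auto simp: containing_some_def)
  have "x \<in> diagrams n" using x by (simp add: containing_some_def)
  then have "t \<in> diagram_comp n x y" "S \<subseteq> diagram_comp n x y"
    using left_arc_comp t assms x by (auto simp: containing_some_def subset_iff)
  then show "diagram_comp n x y \<in> containing_some n S T"
    using xy t(1) by (auto simp: containing_some_def)
qed

text \<open>If \<open>S\<close> misses the left node \<open>- v\<close>, then the product of the diagrams \<open>hook n p q v\<close> over the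
  arcs \<open>{- p, - q}\<close> in \<open>S\<close> is a left unit.\<close>

lemma containing_left_unit:
  assumes S: "S \<subseteq> left_arcs n" "finite S" "2 * card S < n"
  shows "\<exists>u\<in>spanned (containing n S). \<forall>w\<in>spanned (containing n S). u \<otimes>\<^bsub>TA\<^esub> w = w"
\<comment> \<open>If arcs of S overlap, for instance, no diagram contains S and the ideal is zero.
  Otherwise a diagram \<open>b0\<close> containing S shows that the members of S are disjoint
  pairs.\<close>
proof (cases "containing n S = {}")
  case True
  then show ?thesis by (simp add: spanned_empty)
next
  case False
  then obtain b0 where b0: "b0 \<in> diagrams n" "S \<subseteq> b0" by (auto simp: containing_def)
  have "finite s \<and> card s \<le> 2" if "s \<in> S" for s
  proof -
    have "card s = 2" using b0 that by (auto simp: diagrams_def)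
    then show ?thesis using card.infinite[of s] by auto
  qed
  then have fin: "finite (\<Union>S)" and "card (\<Union>S) \<le> 2 * card S"
    using S(2) card_Union_le_sum_card[of S] sum_bounded_above[of S card 2] by (auto simp: mult.commute)
  \<comment> \<open>The arcs of S have at most \<open>2 * card S\<close> endpoints, fewer than the n
    left nodes; a free node - v results, and it serves all the hooks.\<close>
  then have "card (\<Union>S) < card {- int n..-1}" using S(3) by simp
  then have "\<not> {- int n..-1} \<subseteq> \<Union>S" using card_mono[OF fin, of "{- int n..-1}"] by linarith
  then obtain x where "x \<in> {- int n..-1}" "x \<notin> \<Union>S" by blast
  then obtain v where v: "v \<in> {1..int n}" "- v \<notin> \<Union>S" by (intro that[of "- x"]) auto
  \<comment> \<open>While S' grows, the unit property is kept on the diagrams containing all of S: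
    each hook fixes the diagrams containing its arc, and these contain every arc of S.\<close>
  have "\<exists>u\<in>spanned (containing n S'). \<forall>w\<in>spanned (containing n S). u \<otimes>\<^bsub>TA\<^esub> w = w" if "finite S'" "S' \<subseteq> S" for S'
    using that
  proof (induction S')
    case empty
    have "containing n {} = diagrams n" by (auto simp: containing_def)
    then have "\<one>\<^bsub>TA\<^esub> \<in> spanned (containing n {})" using TA.one_closed by (simp only: spanned_B)
    moreover have "\<one>\<^bsub>TA\<^esub> \<otimes>\<^bsub>TA\<^esub> w = w" if "w \<in> spanned (containing n S)" for w
      by (rule TA.l_one[OF subsetD[OF spanned_closed that]])
    ultimately show ?case by blast
  next
    case (insert t S')
    then obtain u where u: "u \<in> spanned (containing n S')"
        "\<And>w. w \<in> spanned (containing n S) \<Longrightarrow> u \<otimes>\<^bsub>TA\<^esub> w = w"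
      by blast
    have "t \<in> left_arcs n" using insert.prems S(1) by blast
    then obtain p q where t: "t = {- p, - q}" and pq: "p \<in> {1..int n}" "q \<in> {1..int n}" "p \<noteq> q"
      by (rule left_arcs_cases)
    have tv: "- v \<notin> t" using v(2) insert.prems by blast
    then have distinct: "p \<noteq> v" "q \<noteq> v" using t by auto
    let ?e = "hook n p q v"
    note hook = pq(1,2) v(1) pq(3) distinct
    have "diagram_comp n ?e y \<in> containing n (insert t S')"
      if y: "y \<in> containing n S'" "diagram_comp n ?e y \<in> diagrams n" for y
    proof -
      have "s \<in> diagram_comp n ?e y" if s: "s \<in> S'" for s
      proof -
        have "s \<in> left_arcs n" using s insert.prems S(1) by blast
        then obtain p' q' where s': "s = {- p', - q'}" "p' \<in> {1..int n}" "q' \<in> {1..int n}"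
          by (rule left_arcs_cases)
        \<comment> \<open>Both are members of the matching \<open>b0\<close>, and t is not in S', so
          they are different and hence disjoint. The new hook therefore leaves s intact.\<close>
        have "s \<inter> t = {}"
          using diagram_disjoint[OF b0(1), of s t] s insert.hyps(2) insert.prems b0(2) by blast
        moreover have "- v \<notin> s" using s v(2) insert.prems by blast
        ultimately have "{- p', - q'} \<inter> {- p, - q, - v} = {}" using t s'(1) by auto
        moreover have "y \<in> diagrams n" "{- p', - q'} \<in> y" using y(1) s s'(1) by (auto simp: containing_def)
        ultimately show ?thesis
          using hook_comp_other_arc[OF hook, of y "- p'" "- q'"] s' by simp
      qed
      moreover have "t \<in> diagram_comp n ?e y" unfolding t by (rule hook_comp_arc[OF hook])
      ultimately show ?thesis using y(2) by (auto simp: containing_def)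
    qed
    then have eu: "basis ?e \<otimes>\<^bsub>TA\<^esub> u \<in> spanned (containing n (insert t S'))"
      by (intro basis_mult_spanned[OF _ u(1)])
    have "(basis ?e \<otimes>\<^bsub>TA\<^esub> u) \<otimes>\<^bsub>TA\<^esub> w = w" if w: "w \<in> spanned (containing n S)" for w
    proof -
      have cl: "u \<in> carrier TA" "w \<in> carrier TA" using u(1) w spanned_closed by blast+
      have "basis ?e \<otimes>\<^bsub>TA\<^esub> w = w"
      proof (rule basis_mult_fixed[OF hook_diagram[OF hook] _ w])
        fix y assume "y \<in> containing n S" "y \<in> diagrams n"
        then have "{- p, - q} \<in> y" using t insert.prems by (auto simp: containing_def)
        then show "diagram_comp n ?e y = y \<and> \<delta> [^] loops n ?e y = \<one>"
          using hook_comp_fixed[OF hook \<open>y \<in> diagrams n\<close>] by simp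
      qed
      then show ?thesis using TA.m_assoc[OF basis_closed cl] u(2)[OF w] by (simp only:)
    qed
    then show ?case using eu by blast
  qed
  then show ?thesis using S(2) by blast
qed

text \<open>A diagram fails to be a permutation exactly when it has a left arc; this presents I as
  the sum of the ideals J_t.\<close>

lemma nonperm_eq: "diagrams n - perms = containing_some n {} (left_arcs n)"
proof (intro equalityI subsetI)
  fix b assume b: "b \<in> diagrams n - perms"
  then obtain x y where xy: "x < 0" "y < 0" "{x, y} \<in> b"
    using diagram_without_left_arc[of b n] unfolding Sn_eq by blast
  then have "{x, y} \<in> left_arcs n"
    using diagram_nodes[of b n x y] b by (auto simp: left_arcs_def nodes_iff)
  then show "b \<in> containing_some n {} (left_arcs n)" using xy b by (auto simp: containing_some_def)
next
  fix b assume b: "b \<in> containing_some n {} (left_arcs n)"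
  then obtain t where t: "t \<in> left_arcs n" "t \<in> b" by (auto simp: containing_some_def)
  obtain p q where "t = {- p, - q}" "p \<in> {1..int n}" "q \<in> {1..int n}"
    using t(1) by (rule left_arcs_cases)
  then have "b \<notin> perms" using t(2) perm_diagram_no_side_arc(1)[of "- p" "- q" n] by auto
  then show "b \<in> diagrams n - perms" using b by (simp add: containing_some_def)
qed

lemma spanned_nonperm_annihilates:
  assumes "D \<inter> perms = {}" shows "annihilates (spanned D) (brauer_trivial R n)"
proof -
  have "finsum R a perms = \<zero>" if "a \<in> spanned D" for a
    using that assms perms_diagrams
    by (intro R.add.finprod_one_eqI) (auto simp: spanned_def subset_iff disjoint_iff)
  then show ?thesis
    by (simp add: annihilates_def brauer_trivial_def trivial_module_def)
qed

context
  fixes Q :: "nat \<Rightarrow> (int set set \<Rightarrow> 'a, 'q) module" and d e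
  assumes res: "projective_resolution TA (brauer_trivial R n) Q d e"
begin

abbreviation "exact_at \<equiv> acyclic_at (brauer_trivial R n) Q d e"

lemma containing_acyclic:
  assumes "S \<subseteq> left_arcs n" "finite S" "2 * card S < n"
  shows "exact_at (spanned (containing n S)) k"
  using containing_left_unit[OF assms] acyclic_if_left_unit[OF res containing_right_ideal[OF assms(1)]] by blast

text \<open>Adding t to T adds the ideal J of the set \<open>insert t S\<close>, which is acyclic by
  its left unit. The intersection to be treated has one more prescribed arc, but it is needed one
  degree lower, so \<open>card S + k + 1\<close> does not increase and the bound is
  preserved.\<close>

lemma containing_some_acyclic:
  assumes "finite T" "T \<subseteq> left_arcs n" "finite S" "S \<subseteq> left_arcs n" "2 * (card S + k + 1) < n"
  shows "exact_at (spanned (containing_some n S T)) k"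
  using assms
proof (induction T arbitrary: S k)
  case empty
  \<comment> \<open>No arc is left to choose, so the ideal is zero, and zero is its left
    unit.\<close>
  have "containing_some n S {} = {}" by (auto simp: containing_some_def)
  then have eq: "spanned (containing_some n S {}) = {\<zero>\<^bsub>TA\<^esub>}" by (simp only: spanned_empty)
  have "right_ideal TA {\<zero>\<^bsub>TA\<^esub>}" by (simp add: right_ideal_def)
  then show ?case
    unfolding eq by (rule acyclic_if_left_unit[OF res, where u = "\<zero>\<^bsub>TA\<^esub>"]) simp_all
next
  case (insert t T)
  have t: "t \<in> left_arcs n" and T: "T \<subseteq> left_arcs n" using insert.prems by auto
  have tS: "insert t S \<subseteq> left_arcs n" "finite (insert t S)" "card (insert t S) \<le> Suc (card S)"
    using t insert.prems by (auto simp: card_insert_le_m1 card_insert_if)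
  have eq: "containing_some n S (insert t T) = containing_some n S T \<union> containing n (insert t S)"
    by (auto simp: containing_some_def containing_def)
  have Int: "spanned (containing_some n S T) \<inter> spanned (containing n (insert t S)) = spanned (containing_some n (insert t S) T)"
    unfolding spanned_Int by (rule arg_cong[of _ _ spanned]) (auto simp: containing_some_def containing_def)
  have nonperm: "containing_some n S (insert t T) \<inter> perms = {}"
    using nonperm_eq insert.prems(1) by (auto simp: containing_some_def)
  show ?case
    unfolding eq
  proof (rule acyclic_sum[OF res containing_some_right_ideal[OF insert.prems(3) T] containing_right_ideal[OF tS(1)]
        spanned_closed spanned_Un])
    show "spanned (containing_some n S T) \<subseteq> spanned (containing_some n S T \<union> containing n (insert t S))"
      "spanned (containing n (insert t S)) \<subseteq> spanned (containing_some n S T \<union> containing n (insert t S))"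
      by (auto intro!: spanned_mono)
    show "annihilates (spanned (containing_some n S T)) (brauer_trivial R n)"
      "annihilates (spanned (containing n (insert t S))) (brauer_trivial R n)"
      using nonperm unfolding eq by (auto intro!: spanned_nonperm_annihilates)
    show "exact_at (spanned (containing_some n S T)) k"
      using insert.prems T by (intro insert.IH)
    show "exact_at (spanned (containing n (insert t S))) k"
      using tS insert.prems(4) by (intro containing_acyclic) auto
    show "exact_at (spanned (containing_some n S T) \<inter> spanned (containing n (insert t S))) m"
      if "k = Suc m" for m
      unfolding Int using tS T insert.prems(4) that by (intro insert.IH) auto
  qed
qed

lemma nonperm_acyclic:
  assumes "2 * (k + 1) < n"
  shows "exact_at (spanned (diagrams n - perms)) k"
proof -
  have "left_arcs n \<subseteq> Pow {- int n..-1}" by (auto simp: left_arcs_def)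
  then have "finite (left_arcs n)" by (rule finite_subset) simp
  then show ?thesis
    unfolding nonperm_eq using assms by (intro containing_some_acyclic) auto
qed

end

section \<open>The trivial modules over the two algebras and the comparison map\<close>

lemma finsum_perms: "f \<in> perms \<rightarrow> carrier R \<Longrightarrow> finsum R f perms = finsum R (\<lambda>g. f (perm_diagram n g)) Sn"
  by (rule R.finsum_reindex[OF _ perm_inj])

text \<open>Both trivial modules act through the sum of the coefficients at permutations.
  Compatibility of the actions with the inclusion is the equality of these two
  augmentations.\<close>

lemma finsum_incl:
  assumes v: "v \<in> carrier RS" shows "finsum R (brauer_incl R n v) perms = finsum R v Sn"
proof -
  have "brauer_incl R n v \<in> perms \<rightarrow> carrier R"
    using coeff_closed[OF incl_closed[OF v]] perms_diagrams by auto
  then have "finsum R (brauer_incl R n v) perms = finsum R (\<lambda>g. brauer_incl R n v (perm_diagram n g)) Sn"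
    by (rule finsum_perms)
  also have "\<dots> = finsum R v Sn"
    using v by (intro R.finsum_cong') (auto simp: incl_perm RS_carrier)
  finally show ?thesis .
qed

lemma finsum_proj:
  assumes a: "a \<in> carrier TA" shows "finsum R (proj a) Sn = finsum R a perms"
proof -
  have "a \<in> perms \<rightarrow> carrier R" using coeff_closed[OF a] perms_diagrams by auto
  then have "finsum R a perms = finsum R (\<lambda>g. a (perm_diagram n g)) Sn" by (rule finsum_perms)
  also have "\<dots> = finsum R (proj a) Sn"
    using \<open>a \<in> perms \<rightarrow> _\<close> by (intro R.finsum_cong') (auto simp: proj_def)
  finally show ?thesis by simp
qed

lemma incl_semilinear:
  "(\<lambda>x. x) \<in> semilinear RS (brauer_incl R n) (sym_trivial R n) (brauer_trivial R n)"
  by (rule semilinearI) (simp_all add: sym_trivial_def brauer_trivial_def trivial_module_def finsum_incl)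

lemma proj_semilinear:
  "(\<lambda>x. x) \<in> semilinear TA proj (brauer_trivial R n) (sym_trivial R n)"
  by (rule semilinearI) (simp_all add: sym_trivial_def brauer_trivial_def trivial_module_def finsum_proj)

lemma sym_trivial_cyclic:
  assumes "x \<in> carrier (sym_trivial R n)"
  shows "\<exists>a\<in>carrier RS. x = a \<odot>\<^bsub>sym_trivial R n\<^esub> \<one>"
proof
  have x: "x \<in> carrier R" using assms by (simp add: sym_trivial_def trivial_module_def)
  let ?a = "\<lambda>g\<in>Sn. if g = id then x else \<zero>"
  show a: "?a \<in> carrier RS" using x by (auto simp: RS_carrier)
  have "finsum R ?a Sn = ?a id"
    by (rule R.finsum_single[OF finite_Sn id_Sn]) (use x id_Sn in auto)
  then show "x = ?a \<odot>\<^bsub>sym_trivial R n\<^esub> \<one>"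
    using x id_Sn by (simp add: sym_trivial_def trivial_module_def)
qed

lemma scalar_linear:
  assumes r: "r \<in> carrier R"
  shows "(\<lambda>m. r \<otimes> m) \<in> linear_maps RS (sym_trivial R n) (sym_trivial R n)"
    and "(\<lambda>m. r \<otimes> m) \<in> linear_maps TA (brauer_trivial R n) (brauer_trivial R n)"
proof -
  have "finsum R v Sn \<in> carrier R" if "v \<in> carrier RS" for v
    using that by (intro R.finsum_closed) (auto simp: RS_carrier)
  then show "(\<lambda>m. r \<otimes> m) \<in> linear_maps RS (sym_trivial R n) (sym_trivial R n)"
    using r by (intro semilinearI) (auto simp: sym_trivial_def trivial_module_def R.r_distr R.m_lcomm)
  have "finsum R v perms \<in> carrier R" if "v \<in> carrier TA" for v
    using that perms_diagrams by (intro R.finsum_closed) auto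
  then show "(\<lambda>m. r \<otimes> m) \<in> linear_maps TA (brauer_trivial R n) (brauer_trivial R n)"
    using r by (intro semilinearI) (auto simp: brauer_trivial_def trivial_module_def R.r_distr R.m_lcomm)
qed

lemma split_comparison_brauer:
  assumes resP: "projective_resolution RS (sym_trivial R n) P d e"
    and resQ: "projective_resolution TA (brauer_trivial R n) Q d' e'" and n: "n \<ge> 2 * i + 1"
  shows "split_comparison RS TA (brauer_incl R n) proj (sym_trivial R n) (brauer_trivial R n) \<one>
    P d e Q d' e' (spanned (diagrams n - perms)) i"
proof (rule split_comparison.intro)
  show "\<one> \<in> carrier (sym_trivial R n)" by (simp add: sym_trivial_def trivial_module_def)
  \<comment> \<open>For k < i one has 2 (k + 1) \<le> 2 i < n; this is the point at which the stable
    range enters.\<close>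
  show "acyclic_at (brauer_trivial R n) Q d' e' (spanned (diagrams n - perms)) k" if "k < i" for k
    using n that by (intro nonperm_acyclic[OF resQ]) simp
qed (use resP resQ incl_hom proj_hom proj_incl incl_semilinear proj_semilinear kernel_proj sym_trivial_cyclic in blast)+

lemma Tor_comparison_iso:
  assumes "projective_resolution RS (sym_trivial R n) P d e"
    and "projective_resolution TA (brauer_trivial R n) Q d' e'" and "n \<ge> 2 * i + 1"
    and f: "chain_lift RS (brauer_incl R n) (\<lambda>x. x) P d e Q d' e' f"
  shows "Tor_map TA (brauer_trivial R n) Q d' i (\<lambda>x. x) f
    \<in> iso (Tor RS (sym_trivial R n) P d i) (Tor TA (brauer_trivial R n) Q d' i)"
  by (rule split_comparison.Tor_map_comparison_iso[OF split_comparison_brauer[OF assms(1-3)] f])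

lemma Tor_comparison_scalar:
  assumes "projective_resolution RS (sym_trivial R n) P d e"
    and "projective_resolution TA (brauer_trivial R n) Q d' e'" and "n \<ge> 2 * i + 1"
    and f: "chain_lift RS (brauer_incl R n) (\<lambda>x. x) P d e Q d' e' f"
    and "r \<in> carrier R" "c \<in> carrier (Tor RS (sym_trivial R n) P d i)"
  shows "Tor_map TA (brauer_trivial R n) Q d' i (\<lambda>x. x) f (Tor_scalar R RS (sym_trivial R n) P d i r c)
    = Tor_scalar R TA (brauer_trivial R n) Q d' i r (Tor_map TA (brauer_trivial R n) Q d' i (\<lambda>x. x) f c)"
  unfolding Tor_scalar_def
  using assms(5,6)
  by (intro tensor_chain_map.Tor_map_commute[OF
        split_comparison.chain_map_f[OF split_comparison_brauer[OF assms(1-3)] f]] scalar_linear) simp_all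

end

text \<open>The existence of a lift keeps the assertion about all lifts from being vacuous. The
  isomorphism is one of abelian groups, and the last clause upgrades it to one of R-modules.\<close>

theorem theoremB:
  fixes R :: "('r, 'x) ring_scheme" and \<delta> :: 'r and n i :: nat
    and P :: "nat \<Rightarrow> ((nat \<Rightarrow> nat) \<Rightarrow> 'r, 'p) module" and d :: "nat \<Rightarrow> 'p \<Rightarrow> 'p" and e :: "'p \<Rightarrow> 'r"
    and Q :: "nat \<Rightarrow> (int set set \<Rightarrow> 'r, 'q) module" and d' :: "nat \<Rightarrow> 'q \<Rightarrow> 'q" and e' :: "'q \<Rightarrow> 'r"
  assumes "cring R" and "\<delta> \<in> carrier R" and "n \<ge> 2 * i + 1"
    and "projective_resolution (group_ring R (sym_group n)) (sym_trivial R n) P d e"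
    and "projective_resolution (brauer_algebra R \<delta> n) (brauer_trivial R n) Q d' e'"
  shows "(\<exists>f. chain_lift (group_ring R (sym_group n)) (brauer_incl R n) (\<lambda>x. x) P d e Q d' e' f) \<and>
    (\<forall>f. chain_lift (group_ring R (sym_group n)) (brauer_incl R n) (\<lambda>x. x) P d e Q d' e' f \<longrightarrow>
      Tor_map (brauer_algebra R \<delta> n) (brauer_trivial R n) Q d' i (\<lambda>x. x) f
        \<in> iso (Tor (group_ring R (sym_group n)) (sym_trivial R n) P d i)
              (Tor (brauer_algebra R \<delta> n) (brauer_trivial R n) Q d' i) \<and>
      (\<forall>r\<in>carrier R. \<forall>c\<in>carrier (Tor (group_ring R (sym_group n)) (sym_trivial R n) P d i).
        Tor_map (brauer_algebra R \<delta> n) (brauer_trivial R n) Q d' i (\<lambda>x. x) f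
          (Tor_scalar R (group_ring R (sym_group n)) (sym_trivial R n) P d i r c) =
        Tor_scalar R (brauer_algebra R \<delta> n) (brauer_trivial R n) Q d' i r
          (Tor_map (brauer_algebra R \<delta> n) (brauer_trivial R n) Q d' i (\<lambda>x. x) f c)))"
proof -
  \<comment> \<open>That the Brauer algebra is a ring is read off from the resolution Q, as its
    target is a left module over that algebra.\<close>
  interpret brauer R \<delta> n
    using assms(1,2) left_module_ring[OF resolution_target[OF assms(5)]]
    by (intro brauer.intro brauer_axioms.intro)
  note resQ = assms(5)[unfolded Br_eq]
  show ?thesis
    unfolding Br_eq
    using chain_lift_exists[OF assms(4) resQ incl_hom incl_semilinear]
      Tor_comparison_iso[OF assms(4) resQ assms(3)] Tor_comparison_scalar[OF assms(4) resQ assms(3)]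
    by blast
qed

end
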